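(* Let $q:\mathcal{S}_0=\bigsqcup_{\lambda\in\Lambda}S_\lambda\to Z$ and $q':\mathcal{S}'_0=\bigsqcup_{\lambda'\in\Lambda'}S'_{\lambda'}\to Z'$ be striped atlases with graphs $G=(\Lambda,H,\xi,\sigma)$ and $G'=(\Lambda',H',\xi',\sigma')$. (1) If $(h,k)$ is an equivalence of $q$ and $q'$, then $(\nu,\eta,\delta,\tau)$ is an isomorphism $G\to G'$, where $\nu(\lambda)$ is defined by $h(S_\lambda)=S'_{\nu(\lambda)}$, $\eta(X)=h(X)$ for $X\in H$, and, writing $h|_{S_\lambda}(x,y)=(\alpha(x,y),\beta(y))$ (with each $\alpha_y=\alpha(\cdot,y)$ a homeomorphism of $\mathbb{R}$ for interior $y$ and $\beta$ a homeomorphism of the $y$-intervals), $\delta(\lambda)=+1$ if the $\alpha_y$ are increasing and $-1$ otherwise, $\tau(\lambda)=+1$ if $\beta$ is increasing and $-1$ otherwise. (2) Conversely, every isomorphism $G\to G'$ is induced in this way by some equivalence of the striped atlases $q$ and $q'$.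
   Context: Strips, boundary intervals ($\partial_\pm S$), model strips, canonical foliations and foliated homeomorphisms: a strip is $S\subset\mathbb{R}^2$ with $\mathbb{R}\times(u,v)\subset S\subset\mathbb{R}\times[u,v]$, $u<v$, open in $\mathbb{R}\times[u,v]$; $\partial_-S=S\cap(\mathbb{R}\times\{u\})$, $\partial_+S=S\cap(\mathbb{R}\times\{v\})$; boundary intervals are the components of $\partial S=\partial_-S\cup\partial_+S$; leaves of the canonical foliation are the lines $\mathbb{R}\times\{t\}$, $t\in(u,v)$, and the boundary intervals. Each of $\partial_\pm S$ is linearly ordered by $(a,x)<(b,x)$ iff $a<b$, inducing a linear order on the boundary intervals in $\partial_-S$ and on those in $\partial_+S$. Striped atlas: a quotient map $q:\mathcal{S}_0=\bigsqcup_{\lambda\in\Lambda}S_\lambda\to Z$ onto a 2-manifold from an at most countable disjoint union of strips, together with families $\{X_\gamma\}_{\gamma\in\Gamma}$, $\{Y_\gamma\}_{\gamma\in\Gamma}$ of mutually distinct boundary intervals such that $q$ is injective off $\bigcup_\gamma(X_\gamma\cup Y_\gamma)$, $q(X_\gamma)=q(Y_\gamma)$, and $q|_{X_\gamma},q|_{Y_\gamma}$ are embeddings with closed images. Gluing maps $\phi_\gamma=(q|_{X_\gamma})^{-1}\circ q|_{Y_\gamma}:Y_\gamma\to X_\gamma$. Equivalence of atlases $q,q'$: a pair of foliated homeomorphisms $h:\mathcal{S}_0\to\mathcal{S}'_0$, $k:Z\to Z'$ with $q'\circ h=k\circ q$ (foliation on $Z$: images of the leaves of the strips). For a homeomorphism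 $f$ between open horizontal intervals let $\mathrm{or}(f)=+1$ if $f$ preserves the order of first coordinates and $-1$ otherwise. Graph of the atlas $q$: $G=(\Lambda,H,\xi,\sigma)$ where $\Lambda$ is the index set of strips (vertices); $H=\bigsqcup_\lambda(d_{-1}(\lambda)\sqcup d_{+1}(\lambda))$, where $d_{-1}(\lambda)$ (resp. $d_{+1}(\lambda)$) is the set of boundary intervals of $\partial_-S_\lambda$ (resp. $\partial_+S_\lambda$) with its linear order (half-edges), $d(\lambda)=d_{-1}(\lambda)\sqcup d_{+1}(\lambda)$; $\xi:H\to H$ is the involution with $\xi(X_\gamma)=Y_\gamma$, $\xi(Y_\gamma)=X_\gamma$ and $\xi(X)=X$ for all other $X$; unordered pairs $\{X,\xi(X)\}$ with $X\ne\xi(X)$ are closed edges, and $\sigma(X_\gamma,Y_\gamma)=\sigma(Y_\gamma,X_\gamma)=\mathrm{or}(\phi_\gamma)\in\{\pm1\}$. An isomorphism $G\to G'$ is a quadruple $(\nu,\eta,\delta,\tau)$ with bijections $\nu:\Lambda\to\Lambda'$, $\eta:H\to H'$ and maps $\delta,\tau:\Lambda\to\{\pm1\}$ such that: (a) $\eta(d_s(\lambda))=d'_{\tau(\lambda)s}(\nu(\lambda))$ for all $\lambda$ and $s\in\{\pm1\}$, and both restrictions $\eta|_{d_{\pm1}(\lambda)}$ are increasing if $\delta(\lambda)=+1$ and decreasing if $\delta(\lambda)=-1$; (b) $\xi'\circ\eta=\eta\circ\xi$; (c) for every closed edge $\{X,Y\}$ of $G$ with $X\in d(\lambda)$, $Y=\xi(X)\in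 d(\mu)$: $\delta(\lambda)\,\sigma(X,Y)=\sigma'(\eta(X),\eta(Y))\,\delta(\mu)$. *)

theory Defs
  imports "HOL-Analysis.Analysis"
begin

definition is_strip :: "(real \<times> real) set \<Rightarrow> bool" where
  "is_strip S \<longleftrightarrow> (\<exists>u v. u < v \<and> UNIV \<times> {u<..<v} \<subseteq> S \<and> S \<subseteq> UNIV \<times> {u..v} \<and>
      openin (subtopology euclidean (UNIV \<times> {u..v})) S)"

text \<open>For a strip, u and v are recovered as inf / sup of the second coordinates.\<close>
definition strip_lo :: "(real \<times> real) set \<Rightarrow> real" where
  "strip_lo S = Inf (snd ` S)"

definition strip_hi :: "(real \<times> real) set \<Rightarrow> real" where
  "strip_hi S = Sup (snd ` S)"

definition bd :: "int \<Rightarrow> (real \<times> real) set \<Rightarrow> (real \<times> real) set" where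
  "bd s S = (if s = -1 then S \<inter> (UNIV \<times> {strip_lo S}) else S \<inter> (UNIV \<times> {strip_hi S}))"

definition bdry_intervals :: "(real \<times> real) set \<Rightarrow> (real \<times> real) set set" where
  "bdry_intervals S = components (bd (-1) S) \<union> components (bd 1 S)"

definition strip_leaves :: "(real \<times> real) set \<Rightarrow> (real \<times> real) set set" where
  "strip_leaves S = {UNIV \<times> {t} | t. strip_lo S < t \<and> t < strip_hi S} \<union> bdry_intervals S"

record ('i, 'g, 'z) striped_atlas =
  Lam :: "'i set"
  strip :: "'i \<Rightarrow> (real \<times> real) set"
  Zsp :: "'z topology"
  qmap :: "'i \<times> (real \<times> real) \<Rightarrow> 'z"
  Gam :: "'g set"
  Xg :: "'g \<Rightarrow> ('i \<times> (real \<times> real)) set"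
  Yg :: "'g \<Rightarrow> ('i \<times> (real \<times> real)) set"

definition S0 :: "('i, 'g, 'z, 'm) striped_atlas_scheme \<Rightarrow> ('i \<times> (real \<times> real)) set" where
  "S0 A = Sigma (Lam A) (strip A)"

definition S0top :: "('i, 'g, 'z, 'm) striped_atlas_scheme \<Rightarrow> ('i \<times> (real \<times> real)) topology" where
  "S0top A = subtopology (prod_topology (discrete_topology UNIV) euclidean) (S0 A)"

definition d :: "('i, 'g, 'z, 'm) striped_atlas_scheme \<Rightarrow> int \<Rightarrow> 'i \<Rightarrow> ('i \<times> (real \<times> real)) set set" where
  "d A s lam = {{lam} \<times> B | B. B \<in> components (bd s (strip A lam))}"

definition dall :: "('i, 'g, 'z, 'm) striped_atlas_scheme \<Rightarrow> 'i \<Rightarrow> ('i \<times> (real \<times> real)) set set" where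
  "dall A lam = d A (-1) lam \<union> d A 1 lam"

definition H :: "('i, 'g, 'z, 'm) striped_atlas_scheme \<Rightarrow> ('i \<times> (real \<times> real)) set set" where
  "H A = (\<Union>lam\<in>Lam A. dall A lam)"

definition S0_leaves :: "('i, 'g, 'z, 'm) striped_atlas_scheme \<Rightarrow> ('i \<times> (real \<times> real)) set set" where
  "S0_leaves A = {{lam} \<times> L | lam L. lam \<in> Lam A \<and> L \<in> strip_leaves (strip A lam)}"

definition Z_leaves :: "('i, 'g, 'z, 'm) striped_atlas_scheme \<Rightarrow> 'z set set" where
  "Z_leaves A = (\<lambda>L. qmap A ` L) ` S0_leaves A"

definition is_2manifold :: "'z topology \<Rightarrow> bool" where
  "is_2manifold T \<longleftrightarrow> (\<forall>z\<in>topspace T. \<exists>U. openin T U \<and> z \<in> U \<and>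
     (\<exists>V :: (real \<times> real) set. openin (subtopology euclidean {p. snd p \<ge> 0}) V \<and>
        (subtopology T U) homeomorphic_space (subtopology euclidean V)))"

definition is_striped_atlas :: "('i, 'g, 'z, 'm) striped_atlas_scheme \<Rightarrow> bool" where
  "is_striped_atlas A \<longleftrightarrow>
     countable (Lam A) \<and>
     (\<forall>lam\<in>Lam A. is_strip (strip A lam)) \<and>
     is_2manifold (Zsp A) \<and>
     quotient_map (S0top A) (Zsp A) (qmap A) \<and>
     (\<forall>g\<in>Gam A. Xg A g \<in> H A \<and> Yg A g \<in> H A) \<and>
     inj_on (Xg A) (Gam A) \<and> inj_on (Yg A) (Gam A) \<and> Xg A ` Gam A \<inter> Yg A ` Gam A = {} \<and>
     inj_on (qmap A) (S0 A - (\<Union>g\<in>Gam A. Xg A g \<union> Yg A g)) \<and>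
     (\<forall>g\<in>Gam A. qmap A ` Xg A g = qmap A ` Yg A g \<and>
        embedding_map (subtopology (S0top A) (Xg A g)) (Zsp A) (qmap A) \<and>
        embedding_map (subtopology (S0top A) (Yg A g)) (Zsp A) (qmap A) \<and>
        closedin (Zsp A) (qmap A ` Xg A g) \<and> closedin (Zsp A) (qmap A ` Yg A g))"

definition xc :: "'i \<times> (real \<times> real) \<Rightarrow> real" where
  "xc p = fst (snd p)"

definition glue :: "('i, 'g, 'z, 'm) striped_atlas_scheme \<Rightarrow> 'g \<Rightarrow> 'i \<times> (real \<times> real) \<Rightarrow> 'i \<times> (real \<times> real)" where
  "glue A g y = (THE x. x \<in> Xg A g \<and> qmap A x = qmap A y)"

definition orient :: "('a \<times> (real \<times> real) \<Rightarrow> 'b \<times> (real \<times> real)) \<Rightarrow> ('a \<times> (real \<times> real)) set \<Rightarrow> int" where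
  "orient f P = (if \<forall>a\<in>P. \<forall>b\<in>P. xc a < xc b \<longrightarrow> xc (f a) < xc (f b) then 1 else -1)"

definition xi :: "('i, 'g, 'z, 'm) striped_atlas_scheme \<Rightarrow> ('i \<times> (real \<times> real)) set \<Rightarrow> ('i \<times> (real \<times> real)) set" where
  "xi A P = (if \<exists>g\<in>Gam A. P = Xg A g then Yg A (SOME g. g \<in> Gam A \<and> P = Xg A g)
             else if \<exists>g\<in>Gam A. P = Yg A g then Xg A (SOME g. g \<in> Gam A \<and> P = Yg A g)
             else P)"

definition sigma :: "('i, 'g, 'z, 'm) striped_atlas_scheme \<Rightarrow> ('i \<times> (real \<times> real)) set \<Rightarrow> ('i \<times> (real \<times> real)) set \<Rightarrow> int" where
  "sigma A P Q = (let g = (SOME g. g \<in> Gam A \<and> ((P = Xg A g \<and> Q = Yg A g) \<or> (P = Yg A g \<and> Q = Xg A g)))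
                  in orient (glue A g) (Yg A g))"

definition hlt :: "('i \<times> (real \<times> real)) set \<Rightarrow> ('i \<times> (real \<times> real)) set \<Rightarrow> bool" where
  "hlt P Q \<longleftrightarrow> (\<forall>p\<in>P. \<forall>q\<in>Q. xc p < xc q)"

definition is_graph_iso ::
  "('i, 'g, 'z, 'm) striped_atlas_scheme \<Rightarrow> ('j, 'h, 'w, 'n) striped_atlas_scheme \<Rightarrow>
   ('i \<Rightarrow> 'j) \<Rightarrow> (('i \<times> (real \<times> real)) set \<Rightarrow> ('j \<times> (real \<times> real)) set) \<Rightarrow>
   ('i \<Rightarrow> int) \<Rightarrow> ('i \<Rightarrow> int) \<Rightarrow> bool" where
  "is_graph_iso A B nu eta delta tau \<longleftrightarrow>
     bij_betw nu (Lam A) (Lam B) \<and> bij_betw eta (H A) (H B) \<and>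
     (\<forall>lam\<in>Lam A. delta lam \<in> {-1, 1} \<and> tau lam \<in> {-1, 1}) \<and>
     (\<forall>lam\<in>Lam A. \<forall>s\<in>{-1, 1::int}.
        eta ` d A s lam = d B (tau lam * s) (nu lam) \<and>
        (delta lam = 1 \<longrightarrow> (\<forall>P\<in>d A s lam. \<forall>Q\<in>d A s lam. hlt P Q \<longrightarrow> hlt (eta P) (eta Q))) \<and>
        (delta lam = -1 \<longrightarrow> (\<forall>P\<in>d A s lam. \<forall>Q\<in>d A s lam. hlt P Q \<longrightarrow> hlt (eta Q) (eta P)))) \<and>
     (\<forall>P\<in>H A. xi B (eta P) = eta (xi A P)) \<and>
     (\<forall>P\<in>H A. xi A P \<noteq> P \<longrightarrow> (\<forall>lam\<in>Lam A. \<forall>mu\<in>Lam A.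
        P \<in> dall A lam \<longrightarrow> xi A P \<in> dall A mu \<longrightarrow>
        delta lam * sigma A P (xi A P) = sigma B (eta P) (eta (xi A P)) * delta mu))"

definition foliated_homeo :: "'a topology \<Rightarrow> 'a set set \<Rightarrow> 'b topology \<Rightarrow> 'b set set \<Rightarrow> ('a \<Rightarrow> 'b) \<Rightarrow> bool" where
  "foliated_homeo T F T' F' f \<longleftrightarrow> homeomorphic_map T T' f \<and>
     (\<forall>L\<in>F. f ` L \<in> F') \<and> (\<forall>L'\<in>F'. \<exists>L\<in>F. f ` L = L')"

definition atlas_equiv ::
  "('i, 'g, 'z, 'm) striped_atlas_scheme \<Rightarrow> ('j, 'h, 'w, 'n) striped_atlas_scheme \<Rightarrow>
   ('i \<times> (real \<times> real) \<Rightarrow> 'j \<times> (real \<times> real)) \<Rightarrow> ('z \<Rightarrow> 'w) \<Rightarrow> bool" where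
  "atlas_equiv A B h k \<longleftrightarrow>
     foliated_homeo (S0top A) (S0_leaves A) (S0top B) (S0_leaves B) h \<and>
     foliated_homeo (Zsp A) (Z_leaves A) (Zsp B) (Z_leaves B) k \<and>
     (\<forall>p\<in>S0 A. qmap B (h p) = k (qmap A p))"

definition induced_nu :: "('i, 'g, 'z, 'm) striped_atlas_scheme \<Rightarrow> ('j, 'h, 'w, 'n) striped_atlas_scheme \<Rightarrow>
   ('i \<times> (real \<times> real) \<Rightarrow> 'j \<times> (real \<times> real)) \<Rightarrow> 'i \<Rightarrow> 'j" where
  "induced_nu A B h lam = (THE mu. mu \<in> Lam B \<and> h ` ({lam} \<times> strip A lam) = {mu} \<times> strip B mu)"

definition induced_delta :: "('i, 'g, 'z, 'm) striped_atlas_scheme \<Rightarrow>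
   ('i \<times> (real \<times> real) \<Rightarrow> 'j \<times> (real \<times> real)) \<Rightarrow> 'i \<Rightarrow> int" where
  "induced_delta A h lam =
     (if \<forall>y a b. strip_lo (strip A lam) < y \<and> y < strip_hi (strip A lam) \<and> a < b \<longrightarrow>
           fst (snd (h (lam, (a, y)))) < fst (snd (h (lam, (b, y)))) then 1 else -1)"

definition induced_tau :: "('i, 'g, 'z, 'm) striped_atlas_scheme \<Rightarrow>
   ('i \<times> (real \<times> real) \<Rightarrow> 'j \<times> (real \<times> real)) \<Rightarrow> 'i \<Rightarrow> int" where
  "induced_tau A h lam =
     (if \<forall>p\<in>strip A lam. \<forall>p'\<in>strip A lam. snd p < snd p' \<longrightarrow>
           snd (snd (h (lam, p))) < snd (snd (h (lam, p'))) then 1 else -1)"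

end

theory Submission
  imports Defs
begin

text \<open>
  The fibres of \<open>q\<close> are pairs \<open>{p, mate p}\<close>: by invariance of domain the interior of a strip, and two collars
  folded together along a pair of glued boundary intervals, have open images in \<open>Z\<close>, so a further point of a
  fibre, being a limit of interior points, cannot exist. Hence an equivalence is the same as a foliated
  homeomorphism of the strips that commutes with \<open>mate\<close>, and \<open>\<xi>\<close> and \<open>\<sigma>\<close> can be read off from \<open>mate\<close>. This gives
  part (1), the signs \<open>\<delta>\<close> and \<open>\<tau>\<close> being constant on each strip by connectedness. For part (2) one chooses order
  isomorphisms of the boundary intervals compatible with \<open>mate\<close> and extends them over each strip: in the
  coordinate \<open>s = x + f x\<close> the graph of a strictly increasing \<open>f\<close> is a pair of monotone Lipschitz functions of
  \<open>s\<close>, which are interpolated with the identity away from the boundary.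
\<close>

section \<open>Extending boundary maps over a strip\<close>

text \<open>The obstacle in part (2) is that a boundary trace may have infinitely many components
  accumulating at finite points, and that an order isomorphism between traces may open or close the
  gaps between them: the line minus a point is order isomorphic to the line minus a segment. Neither
  the boundary map nor its inverse then extends to a continuous map of the line, so blending it with
  the identity in the coordinate \<open>x\<close> is not possible. The coordinate
  \<open>x + f x\<close> treats source and target alike, and the extension is one blend composed
  with the inverse of another. In part (1) the obstacle is that injectivity of \<open>q\<close> is
  required only off the glued intervals. This alone does not prevent a point of a glued interval
  from being identified with an interior point or with a point of another pair; the manifold
  condition excludes it. Signs multiply inequalities throughout, so that increasing and decreasing
  maps share one formula.\<close>

definition strip_of :: "real \<Rightarrow> real \<Rightarrow> real set \<Rightarrow> real set \<Rightarrow> (real \<times> real) set" where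
  "strip_of u v P Q = {(x, y). u < y \<and> y < v \<or> y = u \<and> x \<in> P \<or> y = v \<and> x \<in> Q}"

lemma row_homeomorphism:
  fixes U :: "real \<times> real \<Rightarrow> real"
  assumes cont: "continuous_on (UNIV \<times> K) U" and D: "D \<subseteq> UNIV \<times> K"
    and mono: "\<And>s t y. y \<in> K \<Longrightarrow> s \<le> t \<Longrightarrow> U (s, y) \<le> U (t, y)"
    and row: "\<And>y. open {s. (s, y) \<in> D}"
    and inj: "\<And>s t y. (s, y) \<in> D \<Longrightarrow> (t, y) \<in> D \<Longrightarrow> U (s, y) = U (t, y) \<Longrightarrow> s = t"
    and img: "S = (\<lambda>p. (U p, snd p)) ` D"
  shows "\<exists>G. homeomorphism D S (\<lambda>p. (U p, snd p)) G"
proof -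
  let ?F = "\<lambda>p. (U p, snd p)"
  have injF: "inj_on ?F D"
    by (auto simp: inj_on_def intro: inj)
  have contF: "continuous_on D ?F"
    by (intro continuous_intros continuous_on_subset[OF cont D])
  define G where "G = inv_into D ?F"
  have GF: "G (?F p) = p" if "p \<in> D" for p
    unfolding G_def by (rule inv_into_f_f[OF injF that])
  have contG: "continuous_on S G"
    unfolding continuous_on_iff
  proof (intro ballI allI impI)
    fix p e assume "p \<in> S" and e: "(0::real) < e"
    then obtain s0 y0 where p: "p = (U (s0, y0), y0)" "(s0, y0) \<in> D"
      by (auto simp: img)
    have y0K: "y0 \<in> K" using p D by auto
    obtain e1 where e1: "e1 > 0" "\<And>s. dist s s0 < e1 \<Longrightarrow> (s, y0) \<in> D"
      using row[of y0] p(2) unfolding open_dist by auto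
    define h where "h = min e e1 / 2"
    have h: "h > 0" "h < e1" "h \<le> e / 2" using e e1(1) by (auto simp: h_def)
    have mem: "(s0 - h, y0) \<in> D" "(s0 + h, y0) \<in> D"
      using h by (auto intro!: e1(2) simp: dist_real_def)
    have lt: "U (s0 - h, y0) < U (s0, y0)" "U (s0, y0) < U (s0 + h, y0)"
      using mono[OF y0K, of "s0 - h" s0] mono[OF y0K, of s0 "s0 + h"] inj[OF mem(1) p(2)] inj[OF p(2) mem(2)] h(1)
      by fastforce+
    \<comment> \<open>Half of the smaller gap: when all three values move by less than
      \<open>g\<close>, they stay in the same order.\<close>
    define g where "g = min (U (s0, y0) - U (s0 - h, y0)) (U (s0 + h, y0) - U (s0, y0)) / 2"
    have g: "g > 0" "U (s0 - h, y0) + g \<le> U (s0, y0) - g" "U (s0, y0) + g \<le> U (s0 + h, y0) - g"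
      using lt by (auto simp: g_def min_def field_simps)
    have "\<exists>k>0. \<forall>y\<in>K. dist y y0 < k \<longrightarrow> dist (U (a, y)) (U (a, y0)) < g" for a
    proof -
      have "continuous_on K (\<lambda>y. U (a, y))"
        by (rule continuous_on_compose2[OF cont]) (auto intro!: continuous_intros)
      then show ?thesis
        using y0K g(1) unfolding continuous_on_iff by blast
    qed
    then obtain k1 k2 where k: "k1 > 0" "\<And>y. y \<in> K \<Longrightarrow> dist y y0 < k1 \<Longrightarrow> dist (U (s0 - h, y)) (U (s0 - h, y0)) < g"
      "k2 > 0" "\<And>y. y \<in> K \<Longrightarrow> dist y y0 < k2 \<Longrightarrow> dist (U (s0 + h, y)) (U (s0 + h, y0)) < g"
      by metis
    show "\<exists>dd>0. \<forall>p'\<in>S. dist p' p < dd \<longrightarrow> dist (G p') (G p) < e"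
    proof (intro exI[of _ "Min {k1, k2, g, e / 2}"] conjI ballI impI)
      fix p' assume "p' \<in> S" and dd: "dist p' p < Min {k1, k2, g, e / 2}"
      then obtain s y where p': "p' = (U (s, y), y)" "(s, y) \<in> D" by (auto simp: img)
      have yK: "y \<in> K" using p' D by auto
      have dy: "dist y y0 < k1" "dist y y0 < k2" "dist y y0 < e / 2" and dU: "dist (U (s, y)) (U (s0, y0)) < g"
        using dd dist_snd_le[of p' p] dist_fst_le[of p' p] by (auto simp: p p')
      have "U (s0 - h, y) < U (s, y)" "U (s, y) < U (s0 + h, y)"
        using k(2)[OF yK dy(1)] k(4)[OF yK dy(2)] dU g by (auto simp: dist_real_def)
      then have "s0 - h < s" "s < s0 + h"
        using mono[OF yK, of s "s0 - h"] mono[OF yK, of "s0 + h" s] by linarith+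
      then have "dist s s0 < e / 2" using h unfolding dist_real_def by linarith
      then have "dist (s, y) (s0, y0) < e"
        using dy(3) by (smt (verit) dist_Pair_Pair dist_real_def real_sqrt_sum_squares_triangle_ineq field_sum_of_halves sqrt_sum_squares_le_sum_abs)
      then show "dist (G p') (G p) < e"
        using GF[OF p(2)] GF[OF p'(2)] by (simp add: p p')
    qed (use k g e in auto)
  qed
  have "homeomorphism D S ?F G"
    by (rule homeomorphismI[OF contF contG]) (use GF img in auto)
  then show ?thesis by blast
qed

text \<open>That \<open>X\<close> and \<open>s - X\<close> are both nondecreasing means that
  \<open>X\<close> is nondecreasing and 1-Lipschitz. \<open>X\<close> may be constant on segments,
  so the boundary rows are restricted to sets where it is injective; on interior rows a positive
  multiple of the identity is added, which gives strict growth and surjectivity.\<close>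

lemma blend_homeomorphism:
  fixes X0 X1 :: "real \<Rightarrow> real"
  assumes uv: "u < v"
    and X0: "mono X0" "mono (\<lambda>s. s - X0 s)"
    and X1: "mono X1" "mono (\<lambda>s. s - X1 s)"
    and E: "open E0" "open E1" and inj: "inj_on X0 E0" "inj_on X1 E1"
  shows "\<exists>U G. homeomorphism (strip_of u v E0 E1) (strip_of u v (X0 ` E0) (X1 ` E1)) (\<lambda>p. (U p, snd p)) G \<and>
    (\<forall>s. U (s, u) = X0 s \<and> U (s, v) = X1 s) \<and>
    (\<forall>s t y. u < y \<longrightarrow> y < v \<longrightarrow> s < t \<longrightarrow> U (s, y) < U (t, y))"
proof -
  \<comment> \<open>\<open>w0\<close> falls from 1 on the bottom row to 0 on the middle row, and
    \<open>w1\<close> rises from 0 there to 1 on the top row. Strictly in between their sum is below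
    1, which leaves a positive coefficient for the identity.\<close>
  define w0 where "w0 y = max 0 (1 - 2 * ((y - u) / (v - u)))" for y
  define w1 where "w1 y = max 0 (2 * ((y - u) / (v - u)) - 1)" for y
  define U where "U p = (1 - w0 (snd p) - w1 (snd p)) * fst p + w0 (snd p) * X0 (fst p) + w1 (snd p) * X1 (fst p)" for p
  have w: "0 \<le> w0 y" "0 \<le> w1 y" for y by (auto simp: w0_def w1_def)
  have wlt: "w0 y + w1 y < 1" if "u < y" "y < v" for y
    using that uv by (auto simp: w0_def w1_def max_def field_simps)
  have wle: "w0 y + w1 y \<le> 1" if "u \<le> y" "y \<le> v" for y
    using that uv by (auto simp: w0_def w1_def max_def field_simps)
  have Uu: "U (s, u) = X0 s" for s by (simp add: U_def w0_def w1_def)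
  have Uv: "U (s, v) = X1 s" for s using uv by (simp add: U_def w0_def w1_def)
  have lip: "continuous_on UNIV X" if "mono X" "mono (\<lambda>s. s - X s)" for X :: "real \<Rightarrow> real"
  proof -
    have "dist (X s) (X t) \<le> 1 * dist s t" for s t
      using monoD[OF that(1), of s t] monoD[OF that(2), of s t] monoD[OF that(1), of t s] monoD[OF that(2), of t s]
      by (cases "s \<le> t") (auto simp: dist_real_def)
    then have "1-lipschitz_on UNIV X" by (auto intro: lipschitz_onI)
    then show ?thesis by (rule lipschitz_on_continuous_on)
  qed
  have cont: "continuous_on (UNIV \<times> {u..v}) U"
    unfolding U_def w0_def w1_def using uv
    by (intro continuous_intros continuous_on_compose2[OF lip[OF X0]] continuous_on_compose2[OF lip[OF X1]]) auto
  have growth: "(1 - w0 y - w1 y) * (t - s) \<le> U (t, y) - U (s, y)" if "s \<le> t" for s t y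
  proof -
    have "U (t, y) - U (s, y) = (1 - w0 y - w1 y) * (t - s) + w0 y * (X0 t - X0 s) + w1 y * (X1 t - X1 s)"
      by (simp add: U_def algebra_simps)
    moreover have "0 \<le> w0 y * (X0 t - X0 s)" "0 \<le> w1 y * (X1 t - X1 s)"
      using w monoD[OF X0(1) that] monoD[OF X1(1) that] by auto
    ultimately show ?thesis by linarith
  qed
  have mono: "U (s, y) \<le> U (t, y)" if "y \<in> {u..v}" "s \<le> t" for s t y
  proof -
    have "0 \<le> (1 - w0 y - w1 y) * (t - s)" using wle[of y] that by auto
    then show ?thesis using growth[OF that(2), of y] by linarith
  qed
  have strict: "U (s, y) < U (t, y)" if "u < y" "y < v" "s < t" for s t y
  proof -
    have "0 < (1 - w0 y - w1 y) * (t - s)" using wlt[of y] that by auto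
    then show ?thesis using growth[of s t y] that by linarith
  qed
  have surj: "\<exists>s. U (s, y) = x" if "u < y" "y < v" for x y
  proof -
    define c where "c = 1 - w0 y - w1 y"
    have c: "c > 0" using wlt[OF that] by (simp add: c_def)
    \<comment> \<open>On this row \<open>U\<close> grows with slope at least \<open>c\<close>, so
      the interval from \<open>- r\<close> to \<open>r\<close> is long enough for its end values to
      enclose \<open>x\<close>.\<close>
    define r where "r = \<bar>x - U (0, y)\<bar> / c"
    have r: "r \<ge> 0" "c * r = \<bar>x - U (0, y)\<bar>" using c by (auto simp: r_def)
    have "x \<le> U (r, y)" "U (- r, y) \<le> x"
      using growth[of 0 r y] growth[of "- r" 0 y] r unfolding c_def[symmetric] by auto
    moreover have "continuous_on {- r..r} (\<lambda>s. U (s, y))"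
      using that by (intro continuous_on_compose2[OF cont]) (auto intro!: continuous_intros)
    ultimately show ?thesis
      using IVT'[of "\<lambda>s. U (s, y)" "- r" x r] r by auto
  qed
  have rows: "open {s. (s, y) \<in> strip_of u v E0 E1}" for y
  proof -
    have "{s. (s, y) \<in> strip_of u v E0 E1} = (if u < y \<and> y < v then UNIV else if y = u then E0 else if y = v then E1 else {})"
      using uv by (auto simp: strip_of_def)
    then show ?thesis using E by auto
  qed
  have img: "strip_of u v (X0 ` E0) (X1 ` E1) = (\<lambda>p. (U p, snd p)) ` strip_of u v E0 E1"
  proof (intro equalityI subsetI)
    fix p assume p: "p \<in> strip_of u v (X0 ` E0) (X1 ` E1)"
    obtain x y where [simp]: "p = (x, y)" by fastforce
    consider "u < y" "y < v" | "y = u" "x \<in> X0 ` E0" | "y = v" "x \<in> X1 ` E1"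
      using p by (auto simp: strip_of_def)
    then have "\<exists>s. (s, y) \<in> strip_of u v E0 E1 \<and> x = U (s, y)"
    proof cases
      case 1
      then show ?thesis using surj[OF 1, of x] by (auto simp: strip_of_def)
    next
      case 2
      then show ?thesis by (auto simp: strip_of_def Uu)
    next
      case 3
      then show ?thesis by (auto simp: strip_of_def Uv)
    qed
    then show "p \<in> (\<lambda>p. (U p, snd p)) ` strip_of u v E0 E1" by force
  qed (auto simp: strip_of_def Uu Uv)
  have injrow: "s = t" if st: "(s, y) \<in> strip_of u v E0 E1" "(t, y) \<in> strip_of u v E0 E1" "U (s, y) = U (t, y)" for s t y
  proof -
    consider "u < y" "y < v" | "y = u" "s \<in> E0" "t \<in> E0" | "y = v" "s \<in> E1" "t \<in> E1"
      using st uv by (auto simp: strip_of_def)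
    then show ?thesis
    proof cases
      case 1
      then show ?thesis using strict[OF 1, of s t] strict[OF 1, of t s] st(3) by (cases s t rule: linorder_cases) auto
    next
      case 2
      then show ?thesis using inj(1) st(3) by (auto simp: Uu inj_on_def)
    next
      case 3
      then show ?thesis using inj(2) st(3) by (auto simp: Uv inj_on_def)
    qed
  qed
  have "strip_of u v E0 E1 \<subseteq> UNIV \<times> {u..v}" using uv by (auto simp: strip_of_def)
  then have "\<exists>G. homeomorphism (strip_of u v E0 E1) (strip_of u v (X0 ` E0) (X1 ` E1)) (\<lambda>p. (U p, snd p)) G"
    by (intro row_homeomorphism[OF cont]) (use mono rows injrow img in blast)+
  then show ?thesis using Uu Uv strict by blast
qed

text \<open>A strictly increasing map may have infinite one-sided limits, but its graph is a Lipschitz curve in the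
  coordinate \<open>s = x + f x\<close>.\<close>

lemma graph_parametrization:
  fixes f :: "real \<Rightarrow> real"
  assumes mono: "strict_mono_on P f"
  shows "\<exists>X. mono X \<and> mono (\<lambda>s. s - X s) \<and> (\<forall>x\<in>P. X (x + f x) = x)"
proof (cases "P = {}")
  case True
  then show ?thesis by (intro exI[of _ "\<lambda>s. s"]) (auto simp: mono_def)
next
  case False
  \<comment> \<open>The graph point over \<open>x\<close> has parameter \<open>x + f x\<close>.
    Among the nondecreasing 1-Lipschitz functions that take the value \<open>x\<close> there,
    \<open>m s x\<close> is the largest; the infimum over \<open>x\<close> is the largest candidate
    that could meet all these conditions.\<close>
  define m where "m s x = x + max 0 (s - (x + f x))" for s x
  define X where "X s = (INF x\<in>P. m s x)" for s
  \<comment> \<open>This bounds the infimum below, and at \<open>s = x + f x\<close> the bound is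
    \<open>x\<close> itself.\<close>
  have key: "min x (s - f x) \<le> m s y" if "x \<in> P" "y \<in> P" for s x y
    using strict_mono_onD[OF mono that] strict_mono_onD[OF mono that(2,1)]
    by (cases x y rule: linorder_cases) (auto simp: m_def)
  have bdd: "bdd_below (m s ` P)" for s
    using False key unfolding bdd_below_def by blast
  have "mono X"
    unfolding X_def by (rule monoI, intro cINF_mono[OF False bdd]) (auto simp: m_def intro!: bexI)
  moreover have "mono (\<lambda>s. s - X s)"
  proof (rule monoI)
    fix s t :: real assume st: "s \<le> t"
    have "X t - (t - s) \<le> X s"
      unfolding X_def[of s]
    proof (rule cINF_greatest[OF False])
      fix x assume "x \<in> P"
      then have "X t \<le> m t x" unfolding X_def by (intro cINF_lower bdd)
      also have "\<dots> \<le> m s x + (t - s)" using st by (auto simp: m_def)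
      finally show "X t - (t - s) \<le> m s x" by simp
    qed
    then show "s - X s \<le> t - X t" by simp
  qed
  moreover have "X (x + f x) = x" if "x \<in> P" for x
    unfolding X_def
  proof (rule antisym)
    show "(INF y\<in>P. m (x + f x) y) \<le> x"
      using cINF_lower[OF bdd that, of "x + f x"] by (simp add: m_def)
    show "x \<le> (INF y\<in>P. m (x + f x) y)"
      using key[OF that, of _ "x + f x"] by (intro cINF_greatest[OF False]) auto
  qed
  ultimately show ?thesis by blast
qed

text \<open>At a jump of \<open>f\<close> its value would not be interior to the image, so the open
  image makes \<open>f\<close> continuous. Then \<open>x + f x\<close> is continuous and injective,
  and invariance of domain on the line makes its range, the set \<open>E\<close>, open.\<close>

lemma graph_parametrization_open:
  fixes f :: "real \<Rightarrow> real"
  assumes mono: "strict_mono_on P f" and "open P" "open (f ` P)"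
  shows "\<exists>X E. mono X \<and> mono (\<lambda>s. s - X s) \<and> open E \<and>
    inj_on X E \<and> X ` E = P \<and> inj_on (\<lambda>s. s - X s) E \<and> (\<lambda>s. s - X s) ` E = f ` P \<and>
    (\<forall>s\<in>E. s - X s = f (X s))"
proof -
  obtain X where X: "mono X" "mono (\<lambda>s. s - X s)" "\<And>x. x \<in> P \<Longrightarrow> X (x + f x) = x"
    using graph_parametrization[OF mono] by blast
  define g where "g x = x + f x" for x
  have g: "X (g x) = x" "g x - X (g x) = f x" if "x \<in> P" for x
    using X(3)[OF that] by (auto simp: g_def)
  have cont: "continuous_on P f"
    using mono by (intro continuous_onI_mono assms) (auto simp: le_less strict_mono_on_def)
  have injf: "inj_on f P" using mono by (rule strict_mono_on_imp_inj_on)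
  have "continuous_on P g" unfolding g_def by (intro continuous_intros cont)
  moreover have "inj_on g P" by (metis g(1) inj_onI)
  ultimately have op: "open (g ` P)" by (intro invariance_of_domain assms)
  have i1: "inj_on X (g ` P)" by (auto simp: inj_on_def g)
  have i2: "inj_on (\<lambda>s. s - X s) (g ` P)"
    by (rule inj_onI) (metis g(2) inj_onD[OF injf] imageE)
  have e1: "X ` g ` P = P" by (auto simp: image_image g)
  have e2: "(\<lambda>s. s - X s) ` g ` P = f ` P" using g(2) by (auto simp: image_image)
  have "\<forall>s\<in>g ` P. s - X s = f (X s)" using g by auto
  then show ?thesis using X(1,2) op i1 i2 e1 e2 by blast
qed

text \<open>Both coordinates \<open>X\<close> and \<open>s - X\<close> of the graph curve satisfy
  the hypotheses of \<open>blend_homeomorphism\<close>. One blend maps a common parameter strip onto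
  the source, the other maps it onto the target; \<open>F\<close> goes back along the first and out
  along the second. Both keep heights and are increasing on interior rows, and so is
  \<open>F\<close>.\<close>

lemma strip_of_extension:
  fixes f0 f1 :: "real \<Rightarrow> real"
  assumes uv: "u < v"
    and f0: "strict_mono_on P f0" "open P" "open (f0 ` P)"
    and f1: "strict_mono_on Q f1" "open Q" "open (f1 ` Q)"
  shows "\<exists>F G. homeomorphism (strip_of u v P Q) (strip_of u v (f0 ` P) (f1 ` Q)) F G \<and>
    (\<forall>p\<in>strip_of u v P Q. snd (F p) = snd p) \<and>
    (\<forall>x\<in>P. F (x, u) = (f0 x, u)) \<and> (\<forall>x\<in>Q. F (x, v) = (f1 x, v)) \<and>
    (\<forall>a b y. u < y \<longrightarrow> y < v \<longrightarrow> a < b \<longrightarrow> fst (F (a, y)) < fst (F (b, y)))"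
proof -
  obtain X0 E0 where X0: "mono X0" "mono (\<lambda>s. s - X0 s)" "open E0"
    "inj_on X0 E0" "X0 ` E0 = P" "inj_on (\<lambda>s. s - X0 s) E0" "(\<lambda>s. s - X0 s) ` E0 = f0 ` P"
    "\<And>s. s \<in> E0 \<Longrightarrow> s - X0 s = f0 (X0 s)"
    using graph_parametrization_open[OF f0] by blast
  obtain X1 E1 where X1: "mono X1" "mono (\<lambda>s. s - X1 s)" "open E1"
    "inj_on X1 E1" "X1 ` E1 = Q" "inj_on (\<lambda>s. s - X1 s) E1" "(\<lambda>s. s - X1 s) ` E1 = f1 ` Q"
    "\<And>s. s \<in> E1 \<Longrightarrow> s - X1 s = f1 (X1 s)"
    using graph_parametrization_open[OF f1] by blast
  let ?D = "strip_of u v E0 E1"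
  obtain U G1 where U: "homeomorphism ?D (strip_of u v P Q) (\<lambda>p. (U p, snd p)) G1"
    "\<And>s. U (s, u) = X0 s" "\<And>s. U (s, v) = X1 s"
    "\<And>s t y. u < y \<Longrightarrow> y < v \<Longrightarrow> s < t \<Longrightarrow> U (s, y) < U (t, y)"
    using blend_homeomorphism[OF uv X0(1,2) X1(1,2) X0(3) X1(3) X0(4) X1(4)] unfolding X0(5) X1(5) by blast
  have Y: "mono (\<lambda>s. s - (s - X0 s))" "mono (\<lambda>s. s - (s - X1 s))"
    using X0(1) X1(1) by auto
  obtain V G2 where V: "homeomorphism ?D (strip_of u v (f0 ` P) (f1 ` Q)) (\<lambda>p. (V p, snd p)) G2"
    "\<And>s. V (s, u) = s - X0 s" "\<And>s. V (s, v) = s - X1 s"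
    "\<And>s t y. u < y \<Longrightarrow> y < v \<Longrightarrow> s < t \<Longrightarrow> V (s, y) < V (t, y)"
    using blend_homeomorphism[OF uv X0(2) Y(1) X1(2) Y(2) X0(3) X1(3) X0(6) X1(6)] unfolding X0(7) X1(7) by blast
  define F where "F = (\<lambda>p. (V p, snd p)) \<circ> G1"
  have hF: "homeomorphism (strip_of u v P Q) (strip_of u v (f0 ` P) (f1 ` Q)) F ((\<lambda>p. (U p, snd p)) \<circ> G2)"
    unfolding F_def by (rule homeomorphism_compose[OF homeomorphism_symD[OF U(1)] V(1)])
  have G1: "G1 (U p, snd p) = p" if "p \<in> ?D" for p using homeomorphism_apply1[OF U(1) that] .
  have G1': "G1 p \<in> ?D \<and> (U (G1 p), snd (G1 p)) = p" if "p \<in> strip_of u v P Q" for p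
    using homeomorphism_apply2[OF U(1) that] homeomorphism_image2[OF U(1)] that by blast
  have sndF: "snd (F p) = snd p" if "p \<in> strip_of u v P Q" for p
    using G1'[OF that] by (metis F_def comp_apply snd_conv)
  have Fu: "F (x, u) = (f0 x, u)" if x: "x \<in> P" for x
  proof -
    obtain s where s: "s \<in> E0" "X0 s = x" using X0(5) x by auto
    then have "(s, u) \<in> ?D" by (auto simp: strip_of_def)
    then have "G1 (x, u) = (s, u)" using G1[of "(s, u)"] s U by auto
    then show ?thesis using s X0(8)[of s] by (simp add: F_def V)
  qed
  have Fv: "F (x, v) = (f1 x, v)" if x: "x \<in> Q" for x
  proof -
    obtain s where s: "s \<in> E1" "X1 s = x" using X1(5) x by auto
    then have "(s, v) \<in> ?D" by (auto simp: strip_of_def)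
    then have "G1 (x, v) = (s, v)" using G1[of "(s, v)"] s U by auto
    then show ?thesis using s X1(8)[of s] by (simp add: F_def V)
  qed
  have "fst (F (a, y)) < fst (F (b, y))" if y: "u < y" "y < v" and ab: "a < b" for a b y
  proof -
    have "(a, y) \<in> strip_of u v P Q" "(b, y) \<in> strip_of u v P Q" using y by (auto simp: strip_of_def)
    from G1'[OF this(1)] G1'[OF this(2)] obtain s t where st: "G1 (a, y) = (s, y)" "G1 (b, y) = (t, y)" "U (s, y) = a" "U (t, y) = b"
      by (metis prod.collapse fst_conv snd_conv)
    then have "s < t" using ab U(4)[OF y, of t s] by (cases s t rule: linorder_cases) auto
    then show ?thesis using V(4)[OF y] st by (simp add: F_def)
  qed
  then show ?thesis using hF sndF Fu Fv by blast
qed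

section \<open>Strips described by their height bounds and boundary traces\<close>

definition side :: "int \<Rightarrow> (real \<times> real) set \<Rightarrow> real" where
  "side s S = (if s = -1 then strip_lo S else strip_hi S)"

definition btrace :: "int \<Rightarrow> (real \<times> real) set \<Rightarrow> real set" where
  "btrace s S = {x. (x, side s S) \<in> S}"

lemma bd_eq_btrace: "bd s S = btrace s S \<times> {side s S}"
  by (auto simp: bd_def btrace_def side_def)

text \<open>The open band inside the strip forces the infimum and supremum of the heights to be
  \<open>u\<close> and \<open>v\<close>. The traces are open because the strip is relatively open in
  the closed band.\<close>

lemma is_strip_structure:
  assumes "is_strip S"
  shows "strip_lo S < strip_hi S"
    and "S = strip_of (strip_lo S) (strip_hi S) (btrace (-1) S) (btrace 1 S)"
    and "open (btrace s S)"
proof -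
  obtain u v where uv: "u < v" and inS: "UNIV \<times> {u<..<v} \<subseteq> S" and Sin: "S \<subseteq> UNIV \<times> {u..v}"
    and op: "openin (subtopology euclidean (UNIV \<times> {u..v})) S"
    using assms unfolding is_strip_def by blast
  have sub: "{u<..<v} \<subseteq> snd ` S" using inS by force
  have ne: "{u<..<v} \<noteq> {}" using dense[OF uv] by auto
  then have ne': "snd ` S \<noteq> {}" using sub by blast
  have bdd: "bdd_below (snd ` S)" "bdd_above (snd ` S)"
    using Sin by (auto intro!: bdd_belowI[of _ u] bdd_aboveI[of _ v])
  have lo: "strip_lo S = u"
    unfolding strip_lo_def
  proof (rule antisym)
    show "Inf (snd ` S) \<le> u"
      using cInf_superset_mono[OF ne bdd(1) sub] uv by simp
    show "u \<le> Inf (snd ` S)" using Sin by (intro cInf_greatest[OF ne']) auto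
  qed
  have hi: "strip_hi S = v"
    unfolding strip_hi_def
  proof (rule antisym)
    show "v \<le> Sup (snd ` S)"
      using cSup_subset_mono[OF ne bdd(2) sub] uv by simp
    show "Sup (snd ` S) \<le> v" using Sin by (intro cSup_least[OF ne']) auto
  qed
  show "strip_lo S < strip_hi S" using uv by (simp add: lo hi)
  show "S = strip_of (strip_lo S) (strip_hi S) (btrace (-1) S) (btrace 1 S)"
  proof (intro equalityI subsetI)
    fix p assume p: "p \<in> S"
    then show "p \<in> strip_of (strip_lo S) (strip_hi S) (btrace (-1) S) (btrace 1 S)"
      using Sin by (cases p) (auto simp: strip_of_def btrace_def side_def lo hi)
  next
    fix p assume "p \<in> strip_of (strip_lo S) (strip_hi S) (btrace (-1) S) (btrace 1 S)"
    then show "p \<in> S"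
      using inS by (cases p) (auto simp: strip_of_def btrace_def side_def lo hi)
  qed
  obtain T where T: "open T" "S = (UNIV \<times> {u..v}) \<inter> T"
    using op by (auto simp: openin_open)
  have "btrace s S = (\<lambda>x. (x, side s S)) -` T"
    unfolding btrace_def using uv by (subst T(2)) (auto simp: side_def lo hi)
  also have "open \<dots>"
    by (intro open_vimage T continuous_intros)
  finally show "open (btrace s S)" .
qed

lemma mem_strip_iff:
  assumes "is_strip S"
  shows "(x, y) \<in> S \<longleftrightarrow> strip_lo S < y \<and> y < strip_hi S \<or> y = side (-1) S \<and> x \<in> btrace (-1) S \<or> y = side 1 S \<and> x \<in> btrace 1 S"
  by (subst is_strip_structure(2)[OF assms]) (auto simp: strip_of_def side_def)

text \<open>Reduction to increasing maps and unchanged heights: multiplying the boundary maps by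
  \<open>dl\<close> makes them increasing, and a product of a reflection or the identity in
  \<open>x\<close> with an affine map of heights carries the result onto \<open>S'\<close>.\<close>

lemma strip_extension:
  fixes f :: "int \<Rightarrow> real \<Rightarrow> real" and dl tu :: int
  assumes S: "is_strip S" and S': "is_strip S'" and dl: "dl \<in> {-1, 1}" and tu: "tu \<in> {-1, 1}"
    and mono: "\<And>s. s \<in> {-1, 1} \<Longrightarrow> strict_mono_on (btrace s S) (\<lambda>x. dl * f s x)"
    and img: "\<And>s. s \<in> {-1, 1} \<Longrightarrow> f s ` btrace s S = btrace (tu * s) S'"
  shows "\<exists>(F :: real \<times> real \<Rightarrow> real \<times> real) G (T :: real \<Rightarrow> real). homeomorphism S S' F G \<and> (\<forall>p\<in>S. snd (F p) = T (snd p)) \<and>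
    strict_mono (\<lambda>y. tu * T y) \<and>
    (\<forall>s\<in>{-1, 1}. \<forall>x\<in>btrace s S. F (x, side s S) = (f s x, side (tu * s) S')) \<and>
    (\<forall>a b y. strip_lo S < y \<longrightarrow> y < strip_hi S \<longrightarrow> a < b \<longrightarrow> dl * fst (F (a, y)) < dl * fst (F (b, y)))"
proof -
  define u v u' v' where "u = strip_lo S" "v = strip_hi S" "u' = strip_lo S'" "v' = strip_hi S'"
  note uv_def = this
  have uv: "u < v" "u' < v'" using is_strip_structure(1)[OF S] is_strip_structure(1)[OF S'] by (auto simp: uv_def)
  define P Q where "P = btrace (-1) S" "Q = btrace 1 S"
  note PQ_def = this
  have PQ: "open P" "open Q" using is_strip_structure(3)[OF S] by (auto simp: PQ_def)
  have Seq: "S = strip_of u v P Q" using is_strip_structure(2)[OF S] by (simp add: uv_def PQ_def)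
  define f0 f1 where "f0 x = dl * f (-1) x" "f1 x = dl * f 1 x" for x
  note f_def = this
  have dd: "real_of_int dl * (real_of_int dl * x) = x" for x using dl by auto
  have im: "f0 ` P = (\<lambda>x. dl * x) ` btrace (- tu) S'" "f1 ` Q = (\<lambda>x. dl * x) ` btrace tu S'"
    using img[of "-1"] img[of 1] by (auto simp: f_def PQ_def image_image[symmetric] simp flip: image_image)
  have op: "open (f0 ` P)" "open (f1 ` Q)"
    unfolding im using dl open_scaling[of "of_int dl" "btrace _ S'"] is_strip_structure(3)[OF S']
    by auto
  have mo: "strict_mono_on P f0" "strict_mono_on Q f1"
    using mono[of "-1"] mono[of 1] by (auto simp: f_def PQ_def strict_mono_on_def)
  obtain F G where F: "homeomorphism S (strip_of u v (f0 ` P) (f1 ` Q)) F G"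
    "\<And>p. p \<in> S \<Longrightarrow> snd (F p) = snd p"
    "\<And>x. x \<in> P \<Longrightarrow> F (x, u) = (f0 x, u)" "\<And>x. x \<in> Q \<Longrightarrow> F (x, v) = (f1 x, v)"
    "\<And>a b y. u < y \<Longrightarrow> y < v \<Longrightarrow> a < b \<Longrightarrow> fst (F (a, y)) < fst (F (b, y))"
    using strip_of_extension[OF uv(1) mo(1) PQ(1) op(1) mo(2) PQ(2) op(2)] Seq by metis
  define c where "c = (v' - u') / (v - u)"
  have c: "c > 0" "c * (v - u) = v' - u'" using uv by (auto simp: c_def)
  \<comment> \<open>The affine bijection between the two ranges of heights, reversing when
    \<open>tu\<close> is -1; \<open>c\<close> is the ratio of the lengths.\<close>
  define T where "T y = (if tu = 1 then u' + c * (y - u) else v' - c * (y - u))" for y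
  define T' where "T' y = (if tu = 1 then u + (y - u') / c else u + (v' - y) / c)" for y
  have TT: "T (T' y) = y" "T' (T y) = y" for y using c by (auto simp: T_def T'_def)
  have Tmono: "strict_mono (\<lambda>y. tu * T y)"
    using tu c by (auto simp: T_def strict_mono_def)
  have contT: "continuous_on UNIV T" "continuous_on UNIV T'"
    using c by (cases "tu = 1"; auto simp: T_def[abs_def] T'_def[abs_def] intro!: continuous_intros)+
  have Tu: "T u = side (- tu) S'" and Tv: "T v = side tu S'"
    using tu c(2) by (auto simp: T_def side_def uv_def)
  have Tin: "u' < T y \<and> T y < v' \<longleftrightarrow> u < y \<and> y < v" for y
  proof -
    have *: "c * (y - u) < v' - u' \<longleftrightarrow> y < v" using c by (auto simp flip: c(2))
    show ?thesis using tu c(1) * by (auto simp: T_def algebra_simps zero_less_mult_iff)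
  qed
  define A where "A p = (dl * fst p, T (snd p))" for p :: "real \<times> real"
  define A' where "A' p = (dl * fst p, T' (snd p))" for p :: "real \<times> real"
  have AA: "A (A' p) = p" "A' (A p) = p" for p by (auto simp: A_def A'_def TT dd)
  have Aiff: "A p \<in> S' \<longleftrightarrow> p \<in> strip_of u v (f0 ` P) (f1 ` Q)" for p
  proof -
    obtain x y where [simp]: "p = (x, y)" by fastforce
    have i0: "x \<in> f0 ` P \<longleftrightarrow> dl * x \<in> btrace (- tu) S'" unfolding im using dd by (metis (no_types, lifting) image_iff)
    have i1: "x \<in> f1 ` Q \<longleftrightarrow> dl * x \<in> btrace tu S'" unfolding im using dd by (metis (no_types, lifting) image_iff)
    have eq: "T y = side (- tu) S' \<longleftrightarrow> y = u" "T y = side tu S' \<longleftrightarrow> y = v"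
      unfolding Tu[symmetric] Tv[symmetric] by (metis TT(2))+
    have "A p \<in> S' \<longleftrightarrow> u' < T y \<and> T y < v' \<or> T y = side (- tu) S' \<and> dl * x \<in> btrace (- tu) S' \<or> T y = side tu S' \<and> dl * x \<in> btrace tu S'"
      unfolding A_def using tu by (auto simp: mem_strip_iff[OF S'] uv_def)
    then show ?thesis unfolding Tin eq i0[symmetric] i1[symmetric] by (simp add: strip_of_def)
  qed
  have hA: "homeomorphism (strip_of u v (f0 ` P) (f1 ` Q)) S' A A'"
  proof (rule homeomorphismI)
    show "continuous_on (strip_of u v (f0 ` P) (f1 ` Q)) A"
      unfolding A_def by (intro continuous_intros continuous_on_compose2[OF contT(1)]) auto
    show "continuous_on S' A'"
      unfolding A'_def by (intro continuous_intros continuous_on_compose2[OF contT(2)]) auto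
    show "A ` strip_of u v (f0 ` P) (f1 ` Q) \<subseteq> S'" using Aiff by auto
    show "A' ` S' \<subseteq> strip_of u v (f0 ` P) (f1 ` Q)" using Aiff AA by (metis image_subsetI)
  qed (simp_all add: AA)
  have h: "homeomorphism S S' (A \<circ> F) (G \<circ> A')" by (rule homeomorphism_compose[OF F(1) hA])
  have 1: "\<forall>p\<in>S. snd ((A \<circ> F) p) = T (snd p)" using F(2) by (simp add: A_def)
  have 2: "\<forall>s\<in>{-1, 1}. \<forall>x\<in>btrace s S. (A \<circ> F) (x, side s S) = (f s x, side (tu * s) S')"
  proof (intro ballI)
    fix s :: int and x assume s: "s \<in> {-1, 1}" and x: "x \<in> btrace s S"
    consider "s = -1" "x \<in> P" "side s S = u" | "s = 1" "x \<in> Q" "side s S = v"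
      using s x by (auto simp: PQ_def side_def uv_def)
    then show "(A \<circ> F) (x, side s S) = (f s x, side (tu * s) S')"
      by cases (auto simp: A_def F(3,4) Tu Tv f_def dd)
  qed
  have 3: "\<forall>a b y. strip_lo S < y \<longrightarrow> y < strip_hi S \<longrightarrow> a < b \<longrightarrow> dl * fst ((A \<circ> F) (a, y)) < dl * fst ((A \<circ> F) (b, y))"
    using F(5) by (simp add: A_def dd uv_def)
  show ?thesis using h 1 Tmono 2 3 by blast
qed

section \<open>The strips and the surface\<close>

text \<open>Composed with a chart, \<open>f\<close> becomes a continuous injection between planar
  sets with open domain, so its image is open in the plane. Charts take values in a half-plane, but
  a planar open set contained in \<open>V\<close> is also open relative to \<open>V\<close>.\<close>

lemma manifold_open_image:
  fixes f :: "real \<times> real \<Rightarrow> 'z"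
  assumes T: "is_2manifold T" and W: "open W" and cont: "continuous_map (top_of_set W) T f" and inj: "inj_on f W"
  shows "openin T (f ` W)"
proof (subst openin_subopen, intro ballI)
  fix z assume "z \<in> f ` W"
  then obtain w where w: "w \<in> W" "z = f w" by auto
  have "z \<in> topspace T" using cont w by (auto simp: continuous_map_def)
  then obtain U V and c :: "'z \<Rightarrow> real \<times> real" where U: "openin T U" "z \<in> U"
    and c: "homeomorphic_map (subtopology T U) (top_of_set V) c"
    using T unfolding is_2manifold_def homeomorphic_space by blast
  define W' where "W' = {w \<in> W. f w \<in> U}"
  have "openin (top_of_set W) W'"
    using openin_continuous_map_preimage[OF cont U(1)] by (simp add: W'_def)
  then have oW': "open W'" using W openin_open_trans by blast
  have Usub: "U \<subseteq> topspace T" using U(1) openin_subset by blast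
  have cf: "continuous_map (top_of_set W') (subtopology T U) f"
  proof (rule continuous_map_into_subtopology)
    show "continuous_map (top_of_set W') T f"
      using continuous_map_from_subtopology_mono[OF cont, of W'] by (auto simp: W'_def)
  qed (auto simp: W'_def)
  have cc: "continuous_map (subtopology T U) (top_of_set V) c" and injc: "inj_on c U" and imc: "c ` U = V"
    using c Usub by (auto simp: homeomorphic_eq_everything_map topspace_subtopology Int_absorb1)
  have "continuous_map (top_of_set W') (top_of_set V) (c \<circ> f)"
    using cf cc by (rule continuous_map_compose)
  then have "continuous_on W' (c \<circ> f)" by (auto simp: continuous_map_in_subtopology)
  moreover have "inj_on (c \<circ> f) W'"
    using inj injc by (intro comp_inj_on) (auto simp: W'_def inj_on_def)
  ultimately have "open ((c \<circ> f) ` W')" using oW' by (intro invariance_of_domain)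
  moreover have "(c \<circ> f) ` W' \<subseteq> V" using imc by (auto simp: W'_def)
  ultimately have "openin (top_of_set V) ((c \<circ> f) ` W')" by (rule open_subset[rotated])
  from openin_continuous_map_preimage[OF cc this]
  have "openin (subtopology T U) {z \<in> U. c z \<in> (c \<circ> f) ` W'}"
    using Usub by (simp add: Int_absorb1)
  also have "{z \<in> U. c z \<in> (c \<circ> f) ` W'} = f ` W'"
    using injc by (auto simp: W'_def inj_on_def)
  finally have "openin T (f ` W')" using U(1) openin_trans_full by blast
  then show "\<exists>T'. openin T T' \<and> z \<in> T' \<and> T' \<subseteq> f ` W"
    using w U(2) by (intro exI[of _ "f ` W'"]) (auto simp: W'_def)
qed

lemma connected_nonzero_sign:
  fixes f :: "'a :: topological_space \<Rightarrow> real"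
  assumes "connected K" "continuous_on K f" "\<And>x. x \<in> K \<Longrightarrow> f x \<noteq> 0"
  shows "(\<forall>x\<in>K. f x > 0) \<or> (\<forall>x\<in>K. f x < 0)"
proof (rule ccontr)
  assume "\<not> ?thesis"
  then obtain x y where xy: "x \<in> K" "f x \<le> 0" "y \<in> K" "f y \<ge> 0" by (auto simp: not_less)
  have "connected (f ` K)" by (rule connected_continuous_image) (use assms in auto)
  then have "0 \<in> f ` K" using xy connectedD_interval[of "f ` K" "f x" "f y" 0] by auto
  then show False using assms(3) by auto
qed

text \<open>The difference \<open>f y - f x\<close> has no zero on the convex set of pairs
  \<open>x < y\<close> in \<open>I\<close>, hence a constant sign.\<close>

lemma continuous_inj_on_interval_monotone:
  fixes f :: "real \<Rightarrow> real"
  assumes "connected I" "continuous_on I f" "inj_on f I"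
  shows "strict_mono_on I f \<or> strict_mono_on I (\<lambda>x. - f x)"
proof -
  let ?K = "I \<times> I \<inter> {p. fst p < snd p}"
  have cI: "convex I" using assms(1) by (metis is_interval_connected_1 is_interval_convex_1)
  have "{p :: real \<times> real. fst p < snd p} = {p. inner (1, -1) p < 0}" by (auto simp: inner_prod_def)
  then have "convex {p :: real \<times> real. fst p < snd p}" by (metis convex_halfspace_lt)
  then have "convex ?K" by (intro convex_Int convex_Times cI)
  then have "connected ?K" by (rule convex_connected)
  moreover have "continuous_on ?K (\<lambda>p. f (snd p) - f (fst p))"
    by (intro continuous_intros continuous_on_compose2[OF assms(2)]) auto
  moreover have "f (snd p) - f (fst p) \<noteq> 0" if "p \<in> ?K" for p
    using that assms(3) by (auto simp: inj_on_def)
  ultimately consider "\<forall>p\<in>?K. f (snd p) - f (fst p) > 0" | "\<forall>p\<in>?K. f (snd p) - f (fst p) < 0"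
    using connected_nonzero_sign[of ?K "\<lambda>p. f (snd p) - f (fst p)"] by blast
  then show ?thesis
  proof cases
    case 1
    then have "strict_mono_on I f" by (force simp: strict_mono_on_def)
    then show ?thesis ..
  next
    case 2
    then have "strict_mono_on I (\<lambda>x. - f x)" by (force simp: strict_mono_on_def)
    then show ?thesis ..
  qed
qed

section \<open>The disjoint union of the strips as a topological space\<close>

definition Sint :: "('i, 'g, 'z, 'm) striped_atlas_scheme \<Rightarrow> ('i \<times> (real \<times> real)) set" where
  "Sint A = {(l, (x, y)) | l x y. l \<in> Lam A \<and> strip_lo (strip A l) < y \<and> y < strip_hi (strip A l)}"

lemma topspace_S0top [simp]: "topspace (S0top A) = S0 A"
  by (simp add: S0top_def)

text \<open>Identifies a subspace of a product with a discrete space as a disjoint union, so that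
  openness and continuity can be examined one strip at a time.\<close>

lemma openin_S0top:
  "openin (S0top A) W \<longleftrightarrow> W \<subseteq> S0 A \<and> (\<forall>l\<in>Lam A. openin (top_of_set (strip A l)) {p. (l, p) \<in> W})"
proof (intro iffI conjI ballI)
  assume W: "openin (S0top A) W"
  show "W \<subseteq> S0 A" using openin_subset[OF W] by simp
  fix l assume l: "l \<in> Lam A"
  have "continuous_map (top_of_set (strip A l)) (S0top A) (Pair l)"
    unfolding S0top_def using l by (auto simp: continuous_map_in_subtopology S0_def continuous_map_pairwise o_def)
  from openin_continuous_map_preimage[OF this W]
  have "openin (top_of_set (strip A l)) {p \<in> strip A l. (l, p) \<in> W}" by simp
  also have "{p \<in> strip A l. (l, p) \<in> W} = {p. (l, p) \<in> W}"
    using \<open>W \<subseteq> S0 A\<close> by (auto simp: S0_def)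
  finally show "openin (top_of_set (strip A l)) {p. (l, p) \<in> W}" .
next
  assume W: "W \<subseteq> S0 A \<and> (\<forall>l\<in>Lam A. openin (top_of_set (strip A l)) {p. (l, p) \<in> W})"
  then have "\<forall>l\<in>Lam A. \<exists>T. open T \<and> {p. (l, p) \<in> W} = strip A l \<inter> T" by (auto simp: openin_open)
  then obtain T where T: "\<And>l. l \<in> Lam A \<Longrightarrow> open (T l)" "\<And>l. l \<in> Lam A \<Longrightarrow> {p. (l, p) \<in> W} = strip A l \<inter> T l"
    by metis
  have "openin (prod_topology (discrete_topology UNIV) euclidean) (\<Union>l\<in>Lam A. {l} \<times> T l)"
    by (intro openin_Union ballI) (auto simp: openin_prod_Times_iff T)
  moreover have "W = (\<Union>l\<in>Lam A. {l} \<times> T l) \<inter> S0 A"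
    using W T(2) by (fastforce simp: S0_def set_eq_iff)
  ultimately show "openin (S0top A) W" unfolding S0top_def openin_subtopology by blast
qed

lemma continuous_map_Pair_S0top:
  assumes "l \<in> Lam A" shows "continuous_map (top_of_set (strip A l)) (S0top A) (Pair l)"
  unfolding S0top_def using assms by (auto simp: continuous_map_in_subtopology S0_def continuous_map_pairwise o_def)

lemma continuous_map_into_S0top:
  assumes "l \<in> Lam A" "continuous_on W f" "f ` W \<subseteq> strip A l"
  shows "continuous_map (top_of_set W) (S0top A) (\<lambda>w. (l, f w))"
proof -
  have "continuous_map (top_of_set W) (top_of_set (strip A l)) f" using assms by (auto simp: continuous_map_in_subtopology)
  from continuous_map_compose[OF this continuous_map_Pair_S0top[OF assms(1)]] show ?thesis by (simp add: o_def)
qed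

lemma continuous_map_from_S0top:
  assumes "\<And>l. l \<in> Lam A \<Longrightarrow> continuous_map (top_of_set (strip A l)) T (\<lambda>p. f (l, p))"
  shows "continuous_map (S0top A) T f"
  unfolding continuous_map_def
proof (intro conjI allI impI)
  show "f \<in> topspace (S0top A) \<rightarrow> topspace T"
    using assms by (fastforce simp: S0_def continuous_map_def)
  fix U assume U: "openin T U"
  have "openin (top_of_set (strip A l)) {p. (l, p) \<in> {x \<in> topspace (S0top A). f x \<in> U}}" if "l \<in> Lam A" for l
    using openin_continuous_map_preimage[OF assms[OF that] U] that by (simp add: S0_def)
  then show "openin (S0top A) {x \<in> topspace (S0top A). f x \<in> U}"
    by (auto simp: openin_S0top)
qed

lemma Hausdorff_S0top: "Hausdorff_space (S0top A)"
  unfolding S0top_def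
  by (intro Hausdorff_space_subtopology) (auto simp: Hausdorff_space_prod_topology Hausdorff_space_discrete_topology)

lemma continuous_map_xc: "continuous_map (S0top A) euclideanreal xc"
proof (rule continuous_map_from_S0top)
  show "continuous_map (top_of_set (strip A l)) euclideanreal (\<lambda>p. xc (l, p))" for l
    unfolding xc_def by (auto intro!: continuous_intros)
qed

text \<open>Components of an open subset of the line are open: a small ball around a point of a
  component is connected and stays in the trace, so it lies in that component.\<close>

lemma bd_component_interval:
  assumes S: "is_strip S" and B: "B \<in> components (bd s S)"
  shows "\<exists>I. open I \<and> connected I \<and> I \<noteq> {} \<and> I \<subseteq> btrace s S \<and> B = I \<times> {side s S}"
proof -
  have sub: "B \<subseteq> btrace s S \<times> {side s S}" using in_components_subset[OF B] by (simp add: bd_eq_btrace)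
  define I where "I = fst ` B"
  have BI: "B = I \<times> {side s S}" using sub by (force simp: I_def)
  have conn: "connected I" unfolding I_def
    by (rule connected_continuous_image) (auto intro!: continuous_intros in_components_connected[OF B])
  have ne: "I \<noteq> {}" using in_components_nonempty[OF B] by (simp add: I_def)
  have IO: "I \<subseteq> btrace s S" using sub by (auto simp: I_def)
  have "open I"
    unfolding open_contains_ball
  proof
    fix x assume x: "x \<in> I"
    then obtain e where e: "e > 0" "ball x e \<subseteq> btrace s S"
      using is_strip_structure(3)[OF S, of s] IO unfolding open_contains_ball by blast
    have "connected (ball x e \<times> {side s S})" by (intro connected_Times) auto
    then have "ball x e \<times> {side s S} \<subseteq> B"
      using e x BI by (intro components_maximal[OF B]) (auto simp: bd_eq_btrace)
    then show "\<exists>e>0. ball x e \<subseteq> I" using e BI by blast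
  qed
  then show ?thesis using conn ne IO BI by blast
qed

lemma S0_separation:
  assumes "p \<in> S0 A" "w \<in> S0 A" "p \<noteq> w"
  shows "\<exists>U V. openin (S0top A) U \<and> openin (S0top A) V \<and> p \<in> U \<and> w \<in> V \<and> disjnt U V"
  using Hausdorff_S0top[of A] assms unfolding Hausdorff_space_def topspace_S0top by blast

section \<open>Half-edges, interior points and gluing in one atlas\<close>

locale striped =
  fixes A :: "('i, 'g, 'z, 'm) striped_atlas_scheme"
  assumes atlas: "is_striped_atlas A"
begin

lemma strip_in: "l \<in> Lam A \<Longrightarrow> is_strip (strip A l)"
  using atlas by (auto simp: is_striped_atlas_def)

lemma lo_less_hi: "l \<in> Lam A \<Longrightarrow> strip_lo (strip A l) < strip_hi (strip A l)"
  using is_strip_structure(1)[OF strip_in] .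

lemma manifold: "is_2manifold (Zsp A)"
  using atlas by (auto simp: is_striped_atlas_def)

lemma quotient: "quotient_map (S0top A) (Zsp A) (qmap A)"
  using atlas by (auto simp: is_striped_atlas_def)

lemma continuous_qmap: "continuous_map (S0top A) (Zsp A) (qmap A)"
  using quotient by (rule quotient_imp_continuous_map)

lemma half_edge_cases:
  assumes "P \<in> H A"
  obtains l s I where "l \<in> Lam A" "s \<in> {-1, 1}" "P \<in> d A s l" "open I" "connected I" "I \<noteq> {}"
    "I \<subseteq> btrace s (strip A l)" "P = {l} \<times> (I \<times> {side s (strip A l)})"
proof -
  obtain l s where ls: "l \<in> Lam A" "s \<in> {-1, 1}" "P \<in> d A s l"
    using assms by (auto simp: H_def dall_def)
  then obtain B where B: "B \<in> components (bd s (strip A l))" "P = {l} \<times> B" by (auto simp: d_def)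
  obtain I where "open I" "connected I" "I \<noteq> {}" "I \<subseteq> btrace s (strip A l)" "B = I \<times> {side s (strip A l)}"
    using bd_component_interval[OF strip_in[OF ls(1)] B(1)] by blast
  then show ?thesis using ls B(2) that by blast
qed

lemma d_subset_H: "l \<in> Lam A \<Longrightarrow> s \<in> {-1, 1} \<Longrightarrow> d A s l \<subseteq> H A"
  by (auto simp: H_def dall_def)

lemma side_eq_iff: "l \<in> Lam A \<Longrightarrow> s \<in> {-1, 1} \<Longrightarrow> t \<in> {-1, 1} \<Longrightarrow> side s (strip A l) = side t (strip A l) \<longleftrightarrow> s = t"
  using lo_less_hi[of l] by (auto simp: side_def)

text \<open>A common point fixes the strip by its index, the side by its height, and then the
  component.\<close>

lemma half_edges_disjoint:
  assumes "P \<in> H A" "Q \<in> H A" "p \<in> P" "p \<in> Q"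
  shows "P = Q"
proof -
  obtain l s where ls: "l \<in> Lam A" "s \<in> {-1, 1}" "P \<in> d A s l"
    using assms by (auto simp: H_def dall_def)
  obtain l' s' where ls': "l' \<in> Lam A" "s' \<in> {-1, 1}" "Q \<in> d A s' l'"
    using assms by (auto simp: H_def dall_def)
  obtain B where B: "B \<in> components (bd s (strip A l))" "P = {l} \<times> B" using ls by (auto simp: d_def)
  obtain B' where B': "B' \<in> components (bd s' (strip A l'))" "Q = {l'} \<times> B'" using ls' by (auto simp: d_def)
  have l: "l = l'" and pB: "snd p \<in> B" "snd p \<in> B'" using assms B B' by auto
  have "snd (snd p) = side s (strip A l)" "snd (snd p) = side s' (strip A l)"
    using pB in_components_subset[OF B(1)] in_components_subset[OF B'(1)] l by (auto simp: bd_eq_btrace)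
  then have "s = s'" using side_eq_iff ls ls' by metis
  then have "B = B'" using components_eq[OF B(1)] B'(1) l pB by blast
  then show ?thesis using B B' l by simp
qed

lemma half_edge_subset: "P \<in> H A \<Longrightarrow> P \<subseteq> S0 A - Sint A"
  by (erule half_edge_cases) (use lo_less_hi in \<open>auto simp: S0_def Sint_def btrace_def side_def\<close>)

lemma Sint_subset: "Sint A \<subseteq> S0 A"
  using mem_strip_iff[OF strip_in] by (auto simp: Sint_def S0_def)

lemma half_edges_cover:
  assumes "p \<in> S0 A" "p \<notin> Sint A" obtains P where "P \<in> H A" "p \<in> P"
proof -
  obtain l x y where p: "p = (l, (x, y))" "l \<in> Lam A" "(x, y) \<in> strip A l" using assms by (auto simp: S0_def)
  then obtain s where s: "s \<in> {-1, 1}" "y = side s (strip A l)" "x \<in> btrace s (strip A l)"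
    using assms(2) mem_strip_iff[OF strip_in[OF p(2)]] by (auto simp: Sint_def)
  then have "(x, y) \<in> bd s (strip A l)" by (simp add: bd_eq_btrace)
  then obtain B where "B \<in> components (bd s (strip A l))" "(x, y) \<in> B"
    using Union_components by blast
  then have "{l} \<times> B \<in> d A s l" "p \<in> {l} \<times> B" using p by (auto simp: d_def)
  then show ?thesis using that d_subset_H[OF p(2) s(1)] by blast
qed

text \<open>Lets an arbitrary point be approximated by points at which \<open>qmap\<close> is known
  to be injective.\<close>

lemma Sint_dense:
  assumes N: "openin (S0top A) N" and p: "p \<in> N"
  obtains w where "w \<in> N" "w \<in> Sint A"
proof -
  have "p \<in> S0 A" using openin_subset[OF N] p by auto
  then obtain l x y where pl: "p = (l, (x, y))" "l \<in> Lam A" "(x, y) \<in> strip A l" by (auto simp: S0_def)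
  define u v where "u = strip_lo (strip A l)" "v = strip_hi (strip A l)"
  note uv_def = this
  have uv: "u < v" using lo_less_hi[OF pl(2)] by (simp add: uv_def)
  have y: "u \<le> y" "y \<le> v" using mem_strip_iff[OF strip_in[OF pl(2)], of x y] pl(3) uv by (auto simp: side_def uv_def)
  obtain T where T: "open T" "{p. (l, p) \<in> N} = strip A l \<inter> T"
    using N pl(2) by (auto simp: openin_S0top openin_open)
  \<comment> \<open>Slides the height towards the middle row; it lies strictly between the bounds
    for \<open>0 < t < 1\<close> and tends to \<open>y\<close> as \<open>t\<close> tends to
    0.\<close>
  define c where "c t = y + t * ((u + v) / 2 - y)" for t
  have "((\<lambda>t. (x, c t)) \<longlongrightarrow> (x, c 0)) (at_right 0)"
    unfolding c_def by (intro tendsto_intros)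
  moreover have "(x, c 0) \<in> T" using p pl T by (auto simp: c_def)
  ultimately have "eventually (\<lambda>t. (x, c t) \<in> T) (at_right 0)" using T(1) topological_tendstoD by blast
  moreover have "eventually (\<lambda>t. t \<in> {0<..<1::real}) (at_right 0)"
    by (rule eventually_at_right_real) simp
  ultimately have "eventually (\<lambda>t. (x, c t) \<in> T \<and> t \<in> {0<..<1}) (at_right 0)" by (rule eventually_conj)
  then obtain t where t: "(x, c t) \<in> T" "0 < t" "t < 1"
    using eventually_happens'[of "at_right (0::real)"] by (auto simp: trivial_limit_at_right_real)
  have "c t = (1 - t) * y + t * ((u + v) / 2)" by (simp add: c_def algebra_simps)
  moreover have "(1 - t) * u \<le> (1 - t) * y" "(1 - t) * y \<le> (1 - t) * v" using t y by (auto intro: mult_left_mono)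
  moreover have "t * u < t * ((u + v) / 2)" "t * ((u + v) / 2) < t * v" using t uv by auto
  moreover have "(1 - t) * u + t * u = u" "(1 - t) * v + t * v = v" by (auto simp: algebra_simps)
  ultimately have ct: "u < c t" "c t < v" by linarith+
  then have "(l, (x, c t)) \<in> Sint A" using pl(2) by (auto simp: Sint_def uv_def)
  moreover from this have "(x, c t) \<in> strip A l" using Sint_subset by (auto simp: S0_def)
  then have "(l, (x, c t)) \<in> N" using t T(2) by auto
  ultimately show ?thesis using that by blast
qed

lemma Xg_Yg_in_H: "g \<in> Gam A \<Longrightarrow> Xg A g \<in> H A \<and> Yg A g \<in> H A"
  using atlas by (auto simp: is_striped_atlas_def)

lemma inj_on_Sint: "inj_on (qmap A) (Sint A)"
proof (rule inj_on_subset)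
  show "inj_on (qmap A) (S0 A - (\<Union>g\<in>Gam A. Xg A g \<union> Yg A g))"
    using atlas by (auto simp: is_striped_atlas_def)
  show "Sint A \<subseteq> S0 A - (\<Union>g\<in>Gam A. Xg A g \<union> Yg A g)"
    using Sint_subset Xg_Yg_in_H by (auto dest!: half_edge_subset)
qed

text \<open>A small disc around \<open>w\<close> has open image in \<open>Z\<close>, so its preimage
  is a neighbourhood of \<open>p\<close> and contains an interior point \<open>w'\<close>
  arbitrarily near \<open>p\<close>. That point shares its image with a point of the disc around
  \<open>w\<close>; by injectivity on the interior they coincide, although the two neighbourhoods
  were disjoint.\<close>

lemma fibre_Sint:
  assumes w: "w \<in> Sint A" and p: "p \<in> S0 A" and eq: "qmap A p = qmap A w"
  shows "p = w"
proof (rule ccontr)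
  assume "p \<noteq> w"
  then obtain Np Nw where N: "openin (S0top A) Np" "openin (S0top A) Nw" "p \<in> Np" "w \<in> Nw" "disjnt Np Nw"
    using S0_separation[of p A w] w p Sint_subset by blast
  obtain l x y where wl: "w = (l, (x, y))" "l \<in> Lam A" "strip_lo (strip A l) < y" "y < strip_hi (strip A l)"
    using w by (auto simp: Sint_def)
  let ?I = "UNIV \<times> {strip_lo (strip A l)<..<strip_hi (strip A l)}"
  have Isub: "?I \<subseteq> strip A l" using mem_strip_iff[OF strip_in[OF wl(2)]] by auto
  obtain T where T: "open T" "{p. (l, p) \<in> Nw} = strip A l \<inter> T"
    using N(2) wl(2) by (auto simp: openin_S0top openin_open)
  define W where "W = ?I \<inter> T"
  have W: "open W" unfolding W_def using T(1) by (intro open_Int open_Times) auto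
  have Wsub: "W \<subseteq> strip A l" "\<And>z. z \<in> W \<Longrightarrow> (l, z) \<in> Nw \<and> (l, z) \<in> Sint A"
    using Isub T(2) wl(2) by (auto simp: W_def Sint_def)
  have "continuous_map (top_of_set W) (Zsp A) (\<lambda>z. qmap A (l, z))"
    using continuous_map_compose[OF continuous_map_into_S0top[OF wl(2), of W "\<lambda>z. z"] continuous_qmap] Wsub(1)
    by (simp add: o_def)
  moreover have "inj_on (\<lambda>z. qmap A (l, z)) W"
    using inj_on_Sint Wsub(2) by (auto simp: inj_on_def)
  ultimately have oZ: "openin (Zsp A) ((\<lambda>z. qmap A (l, z)) ` W)"
    using manifold_open_image[OF manifold W] by blast
  have "(x, y) \<in> W" using N(4) wl T(2) Isub by (auto simp: W_def)
  then have "qmap A p \<in> (\<lambda>z. qmap A (l, z)) ` W" using eq wl by auto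
  moreover have "openin (S0top A) (Np \<inter> {z \<in> S0 A. qmap A z \<in> (\<lambda>z. qmap A (l, z)) ` W})"
    using N(1) openin_continuous_map_preimage[OF continuous_qmap oZ] by auto
  ultimately obtain w' where w': "w' \<in> Np" "w' \<in> Sint A" "qmap A w' \<in> (\<lambda>z. qmap A (l, z)) ` W"
    using Sint_dense[of "Np \<inter> {z \<in> S0 A. qmap A z \<in> (\<lambda>z. qmap A (l, z)) ` W}" p] N(3) p by blast
  then obtain z where "z \<in> W" "qmap A w' = qmap A (l, z)" by auto
  then have "w' = (l, z)" "(l, z) \<in> Nw" using inj_on_Sint Wsub(2) w'(2) by (auto simp: inj_on_def)
  then show False using N(5) w'(1) by (auto simp: disjnt_def)
qed

text \<open>Symmetric in \<open>P\<close> and \<open>Q\<close>, so that the arguments below need not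
  ask which of the two is the \<open>X\<close> and which is the \<open>Y\<close>.\<close>

definition glued :: "('i \<times> (real \<times> real)) set \<Rightarrow> ('i \<times> (real \<times> real)) set \<Rightarrow> bool" where
  "glued P Q \<longleftrightarrow> (\<exists>g\<in>Gam A. P = Xg A g \<and> Q = Yg A g \<or> P = Yg A g \<and> Q = Xg A g)"

lemma gluedD:
  assumes "glued P Q"
  shows "P \<in> H A" "Q \<in> H A" "P \<noteq> Q" "qmap A ` P = qmap A ` Q" "inj_on (qmap A) P"
    "embedding_map (subtopology (S0top A) P) (Zsp A) (qmap A)"
proof -
  obtain g where g: "g \<in> Gam A" "P = Xg A g \<and> Q = Yg A g \<or> P = Yg A g \<and> Q = Xg A g"
    using assms by (auto simp: glued_def)
  then show PH: "P \<in> H A" and "Q \<in> H A" using Xg_Yg_in_H by auto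
  show "P \<noteq> Q" using g atlas by (auto simp: is_striped_atlas_def)
  have "qmap A ` Xg A g = qmap A ` Yg A g" using g(1) atlas unfolding is_striped_atlas_def by blast
  then show "qmap A ` P = qmap A ` Q" using g(2) by auto
  show emb: "embedding_map (subtopology (S0top A) P) (Zsp A) (qmap A)" using g atlas by (auto simp: is_striped_atlas_def)
  have "topspace (subtopology (S0top A) P) = P" using half_edge_subset[OF PH] by auto
  then show "inj_on (qmap A) P" using emb by (metis embedding_map_def homeomorphic_imp_injective_map)
qed

lemma glued_sym: "glued P Q \<Longrightarrow> glued Q P"
  by (auto simp: glued_def)

text \<open>The gluing in terms of first coordinates. Its continuity comes from inverting
  \<open>qmap\<close> on \<open>Q\<close>, where it is an embedding, and its injectivity from that
  of \<open>qmap\<close> on \<open>P\<close>.\<close>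

lemma glued_coordinate:
  assumes PQ: "glued P Q" and l: "l \<in> Lam A" and P: "P = {l} \<times> (I \<times> {y0})" and Q: "Q = {m} \<times> (J \<times> {y1})"
  obtains \<psi> where "continuous_on I \<psi>" "inj_on \<psi> I" "\<And>x. x \<in> I \<Longrightarrow> \<psi> x \<in> J"
    "\<And>x. x \<in> I \<Longrightarrow> qmap A (m, (\<psi> x, y1)) = qmap A (l, (x, y0))"
proof -
  have "homeomorphic_map (subtopology (S0top A) Q) (subtopology (Zsp A) (qmap A ` topspace (subtopology (S0top A) Q))) (qmap A)"
    using gluedD(6)[OF glued_sym[OF PQ]] unfolding embedding_map_def .
  moreover have tQ: "topspace (subtopology (S0top A) Q) = Q" using half_edge_subset[OF gluedD(2)[OF PQ]] by auto
  ultimately obtain g where g: "homeomorphic_maps (subtopology (S0top A) Q) (subtopology (Zsp A) (qmap A ` Q)) (qmap A) g"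
    unfolding homeomorphic_map_maps by auto
  have gc: "continuous_map (subtopology (Zsp A) (qmap A ` Q)) (subtopology (S0top A) Q) g"
    using g by (simp add: homeomorphic_maps_def)
  have qZ: "qmap A ` Q \<subseteq> topspace (Zsp A)"
    using continuous_qmap half_edge_subset[OF gluedD(2)[OF PQ]] by (auto simp: continuous_map_def)
  have gq: "g z \<in> Q \<and> qmap A (g z) = z" if "z \<in> qmap A ` Q" for z
    using g that qZ tQ by (auto simp: homeomorphic_maps_def continuous_map_def)
  have Isub: "(\<lambda>x. (x, y0)) ` I \<subseteq> strip A l" using half_edge_subset[OF gluedD(1)[OF PQ]] P by (auto simp: S0_def)
  have "continuous_map (top_of_set I) (S0top A) (\<lambda>x. (l, (x, y0)))"
    using Isub by (intro continuous_map_into_S0top l) (auto intro!: continuous_intros)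
  then have "continuous_map (top_of_set I) (Zsp A) (\<lambda>x. qmap A (l, (x, y0)))"
    using continuous_map_compose[OF _ continuous_qmap] by (fastforce simp: o_def)
  moreover have inQ: "qmap A (l, (x, y0)) \<in> qmap A ` Q" if "x \<in> I" for x
    using that gluedD(4)[OF PQ] P by blast
  ultimately have "continuous_map (top_of_set I) (subtopology (Zsp A) (qmap A ` Q)) (\<lambda>x. qmap A (l, (x, y0)))"
    by (auto simp: continuous_map_in_subtopology)
  from continuous_map_compose[OF this gc]
  have "continuous_map (top_of_set I) (S0top A) (\<lambda>x. g (qmap A (l, (x, y0))))"
    by (auto simp: continuous_map_in_subtopology o_def)
  from continuous_map_compose[OF this continuous_map_xc]
  have 1: "continuous_on I (\<lambda>x. xc (g (qmap A (l, (x, y0)))))" by (simp add: o_def)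
  define \<psi> where "\<psi> x = xc (g (qmap A (l, (x, y0))))" for x
  have \<psi>: "g (qmap A (l, (x, y0))) = (m, (\<psi> x, y1)) \<and> \<psi> x \<in> J" if "x \<in> I" for x
    using gq[OF inQ[OF that]] Q by (auto simp: \<psi>_def xc_def)
  have 3: "qmap A (m, (\<psi> x, y1)) = qmap A (l, (x, y0))" if "x \<in> I" for x
    using gq[OF inQ[OF that]] \<psi>[OF that] by simp
  have "inj_on \<psi> I"
  proof (rule inj_onI)
    fix x x' assume x: "x \<in> I" "x' \<in> I" "\<psi> x = \<psi> x'"
    then have "qmap A (l, (x, y0)) = qmap A (l, (x', y0))" using 3[of x] 3[of x'] by simp
    then show "x = x'" using gluedD(5)[OF PQ] x P by (auto simp: inj_on_def)
  qed
  then show ?thesis using that[of \<psi>] 1 3 \<psi> unfolding \<psi>_def[abs_def] by blast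
qed

end

section \<open>Fibres of the quotient map\<close>

text \<open>Defined by the fibres alone, without the families \<open>X\<close> and \<open>Y\<close>,
  so that any map compatible with the quotient maps has a chance to respect it. The choice is
  unambiguous once fibres are known to have at most two points.\<close>

definition mate :: "('i, 'g, 'z, 'm) striped_atlas_scheme \<Rightarrow> 'i \<times> (real \<times> real) \<Rightarrow> 'i \<times> (real \<times> real)" where
  "mate A p = (if \<exists>p'\<in>S0 A. p' \<noteq> p \<and> qmap A p' = qmap A p
     then SOME p'. p' \<in> S0 A \<and> p' \<noteq> p \<and> qmap A p' = qmap A p else p)"

context striped
begin

text \<open>Subtracting \<open>s * t\<close> moves inwards from either side: down from the top for
  \<open>s = 1\<close>, up from the bottom for \<open>s = -1\<close>.\<close>

lemma collar_in_Sint: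
  assumes "l \<in> Lam A" "s \<in> {-1, 1}" "0 < t" "t < strip_hi (strip A l) - strip_lo (strip A l)"
  shows "(l, (x, side s (strip A l) - real_of_int s * t)) \<in> Sint A"
  using assms by (auto simp: Sint_def side_def)

text \<open>Two collars folded together along the glued boundary intervals form a disc in \<open>Z\<close>, which is open by
  invariance of domain; any further point of the fibre would be a limit of interior points outside of it.\<close>

lemma fibre_glued:
  assumes PQ: "glued P Q" and p0: "p0 \<in> P" and q0: "q0 \<in> Q" and pq: "qmap A p0 = qmap A q0"
    and p: "p \<in> S0 A" and eq: "qmap A p = qmap A p0"
  shows "p = p0 \<or> p = q0"
proof (rule ccontr)
  assume neg: "\<not> ?thesis"
  obtain l s I where P: "l \<in> Lam A" "s \<in> {-1, 1}" "P \<in> d A s l" "open I" "connected I" "I \<noteq> {}"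
    "I \<subseteq> btrace s (strip A l)" "P = {l} \<times> (I \<times> {side s (strip A l)})"
    using half_edge_cases[OF gluedD(1)[OF PQ]] .
  obtain m r J where Q: "m \<in> Lam A" "r \<in> {-1, 1}" "Q \<in> d A r m" "open J" "connected J" "J \<noteq> {}"
    "J \<subseteq> btrace r (strip A m)" "Q = {m} \<times> (J \<times> {side r (strip A m)})"
    using half_edge_cases[OF gluedD(2)[OF PQ]] .
  define y0 y1 where "y0 = side s (strip A l)" "y1 = side r (strip A m)"
  note y_def = this
  obtain \<psi> where \<psi>: "continuous_on I \<psi>" "inj_on \<psi> I" "\<And>x. x \<in> I \<Longrightarrow> \<psi> x \<in> J"
    "\<And>x. x \<in> I \<Longrightarrow> qmap A (m, (\<psi> x, y1)) = qmap A (l, (x, y0))"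
    using glued_coordinate[OF PQ P(1), of I y0 m J y1] P(8) Q(8) unfolding y_def by blast
  \<comment> \<open>Half of the smaller height, so that collars on opposite sides of one strip do
    not meet.\<close>
  define e where "e = min (strip_hi (strip A l) - strip_lo (strip A l)) (strip_hi (strip A m) - strip_lo (strip A m)) / 2"
  have e: "e > 0" "2 * e \<le> strip_hi (strip A l) - strip_lo (strip A l)" "2 * e \<le> strip_hi (strip A m) - strip_lo (strip A m)"
    using lo_less_hi[OF P(1)] lo_less_hi[OF Q(1)] by (auto simp: e_def)
  define D where "D = I \<times> {-e<..<e}"
  have oD: "open D" unfolding D_def using P(4) by (intro open_Times) auto
  define c1 where "c1 w = (l, (fst w, y0 - real_of_int s * \<bar>snd w\<bar>))" for w :: "real \<times> real"
  define c2 where "c2 w = (m, (\<psi> (fst w), y1 - real_of_int r * \<bar>snd w\<bar>))" for w :: "real \<times> real"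
  have int: "c1 w \<in> Sint A" "c2 w \<in> Sint A" if "w \<in> D" "snd w \<noteq> 0" for w
    using that e unfolding c1_def c2_def y_def
    by (auto intro!: collar_in_Sint P(1,2) Q(1,2) simp: D_def)
  have bdy: "c1 w \<in> P" "c2 w \<in> Q" if "w \<in> D" "snd w = 0" for w
    using that \<psi>(3) P(8) Q(8) by (auto simp: c1_def c2_def D_def y_def)
  have PS: "P \<subseteq> S0 A - Sint A" "Q \<subseteq> S0 A - Sint A"
    using half_edge_subset gluedD(1,2)[OF PQ] by auto
  have cS: "c1 w \<in> S0 A" "c2 w \<in> S0 A" if "w \<in> D" for w
    using int[OF that] bdy[OF that] PS Sint_subset by (cases "snd w = 0"; blast)+
  have cont1: "continuous_map (top_of_set D) (S0top A) c1"
    unfolding c1_def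
  proof (rule continuous_map_into_S0top[OF P(1)])
    show "continuous_on D (\<lambda>w. (fst w, y0 - real_of_int s * \<bar>snd w\<bar>))" by (intro continuous_intros)
    show "(\<lambda>w. (fst w, y0 - real_of_int s * \<bar>snd w\<bar>)) ` D \<subseteq> strip A l" using cS(1) by (auto simp: c1_def S0_def)
  qed
  have cont2: "continuous_map (top_of_set D) (S0top A) c2"
    unfolding c2_def
  proof (rule continuous_map_into_S0top[OF Q(1)])
    show "continuous_on D (\<lambda>w. (\<psi> (fst w), y1 - real_of_int r * \<bar>snd w\<bar>))"
      by (intro continuous_intros continuous_on_compose2[OF \<psi>(1)]) (auto simp: D_def)
    show "(\<lambda>w. (\<psi> (fst w), y1 - real_of_int r * \<bar>snd w\<bar>)) ` D \<subseteq> strip A m" using cS(2) by (auto simp: c2_def S0_def)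
  qed
  \<comment> \<open>The fold: the upper half of the rectangle goes to the collar of
    \<open>P\<close>, the lower half to that of \<open>Q\<close>, with the absolute value of the
    second coordinate as depth. On the middle line the two halves agree only after applying
    \<open>qmap\<close>.\<close>
  define c where "c w = (if 0 \<le> snd w then c1 w else c2 w)" for w
  have "continuous_map (top_of_set D) (Zsp A) (\<lambda>w. if 0 \<le> snd w then (qmap A \<circ> c1) w else (qmap A \<circ> c2) w)"
  proof (rule continuous_map_cases_le)
    show "continuous_map (top_of_set D) euclideanreal (\<lambda>w. 0)" "continuous_map (top_of_set D) euclideanreal snd"
      by (auto intro!: continuous_intros)
    show "continuous_map (subtopology (top_of_set D) {x \<in> topspace (top_of_set D). 0 \<le> snd x}) (Zsp A) (qmap A \<circ> c1)"
      by (intro continuous_map_from_subtopology continuous_map_compose[OF cont1 continuous_qmap])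
    show "continuous_map (subtopology (top_of_set D) {x \<in> topspace (top_of_set D). snd x \<le> 0}) (Zsp A) (qmap A \<circ> c2)"
      by (intro continuous_map_from_subtopology continuous_map_compose[OF cont2 continuous_qmap])
    show "(qmap A \<circ> c1) w = (qmap A \<circ> c2) w" if "w \<in> topspace (top_of_set D)" "0 = snd w" for w
      using that \<psi>(4)[of "fst w"] by (auto simp: c1_def c2_def D_def)
  qed
  then have contf: "continuous_map (top_of_set D) (Zsp A) (\<lambda>w. qmap A (c w))"
    by (rule continuous_map_eq) (auto simp: c_def)
  \<comment> \<open>The collars are disjoint: on one side of a strip because distinct half-edges
    are, on opposite sides because their depths are below \<open>e\<close>.\<close>
  have cross: "c1 w \<noteq> c2 w'" if "w \<in> D" "w' \<in> D" for w w'
  proof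
    assume eq: "c1 w = c2 w'"
    then have lm: "l = m" and x: "fst w = \<psi> (fst w')" and y: "y0 - real_of_int s * \<bar>snd w\<bar> = y1 - real_of_int r * \<bar>snd w'\<bar>"
      by (auto simp: c1_def c2_def)
    show False
    proof (cases "s = r")
      case True
      then have "(l, (fst w, y0)) \<in> P \<inter> Q"
        using that x lm \<psi>(3)[of "fst w'"] P(8) Q(8) by (auto simp: D_def y_def)
      then show False using half_edges_disjoint gluedD(1,2,3)[OF PQ] by blast
    next
      case False
      then show False
        using P(2) Q(2) y e(2) that lm by (auto simp: D_def y_def side_def)
    qed
  qed
  have injf: "inj_on (\<lambda>w. qmap A (c w)) D"
  proof (rule inj_onI)
    fix w w' assume w: "w \<in> D" "w' \<in> D" and eq: "qmap A (c w) = qmap A (c w')"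
    have cw: "c w \<in> S0 A" "c w' \<in> S0 A" using cS w by (auto simp: c_def)
    show "w = w'"
    proof (cases "snd w = 0 \<and> snd w' = 0")
      case True
      then have "qmap A (c1 w) = qmap A (c1 w')" using eq by (simp add: c_def)
      then have "c1 w = c1 w'" using gluedD(5)[OF PQ] bdy(1)[OF w(1)] bdy(1)[OF w(2)] True by (auto simp: inj_on_def)
      then show ?thesis using True by (simp add: c1_def prod_eq_iff)
    next
      case False
      then have "c w \<in> Sint A \<or> c w' \<in> Sint A" using int[OF w(1)] int[OF w(2)] by (auto simp: c_def)
      then have cc: "c w = c w'" using fibre_Sint cw eq by metis
      then have "0 \<le> snd w \<longleftrightarrow> 0 \<le> snd w'"
        using cross[OF w] cross[OF w(2,1)] by (auto simp: c_def split: if_splits)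
      then show ?thesis
        using cc P(2) Q(2) inj_onD[OF \<psi>(2), of "fst w" "fst w'"] w
        by (auto simp: c_def c1_def c2_def prod_eq_iff D_def split: if_splits)
    qed
  qed
  have p0S: "p0 \<in> S0 A" "q0 \<in> S0 A" using p0 q0 PS by auto
  obtain N1 U1 where N1: "openin (S0top A) N1" "openin (S0top A) U1" "p \<in> N1" "p0 \<in> U1" "disjnt N1 U1"
    using S0_separation[OF p p0S(1)] neg by blast
  obtain N2 U2 where N2: "openin (S0top A) N2" "openin (S0top A) U2" "p \<in> N2" "q0 \<in> U2" "disjnt N2 U2"
    using S0_separation[OF p p0S(2)] neg by blast
  \<comment> \<open>Shrinks the rectangle until \<open>c1\<close> avoids \<open>N1\<close> and
    \<open>c2\<close> avoids \<open>N2\<close>, so that the folded disc has no point in the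
    neighbourhood \<open>N1 \<inter> N2\<close> of \<open>p\<close>.\<close>
  define W where "W = {w \<in> D. c1 w \<in> U1} \<inter> {w \<in> D. c2 w \<in> U2}"
  have "openin (top_of_set D) W"
    unfolding W_def using openin_continuous_map_preimage[OF cont1 N1(2)] openin_continuous_map_preimage[OF cont2 N2(2)]
    by (auto intro!: openin_Int)
  then have oW: "open W" and WD: "W \<subseteq> D" using oD openin_open_trans by (blast, auto simp: W_def)
  define f where "f w = qmap A (c w)" for w
  have oZ: "openin (Zsp A) (f ` W)"
    unfolding f_def
    by (intro manifold_open_image[OF manifold oW] continuous_map_from_subtopology_mono[OF contf WD] inj_on_subset[OF injf WD])
  define w0 where "w0 = (xc p0, 0 :: real)"
  have w0: "w0 \<in> D" "c1 w0 = p0" using p0 P(8) e by (auto simp: w0_def D_def c1_def xc_def y_def)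
  have "c2 w0 = q0"
  proof -
    have "qmap A (c2 w0) = qmap A q0"
      using \<psi>(4)[of "xc p0"] w0 pq by (auto simp: c1_def c2_def w0_def D_def)
    then show ?thesis using gluedD(5)[OF glued_sym[OF PQ]] bdy(2)[OF w0(1)] q0 by (auto simp: inj_on_def w0_def)
  qed
  then have w0W: "w0 \<in> W" using w0 N1(4) N2(4) by (auto simp: W_def)
  have "qmap A p = f w0" using eq w0 by (simp add: f_def c_def w0_def)
  then have "p \<in> N1 \<inter> N2 \<inter> {z \<in> S0 A. qmap A z \<in> f ` W}" using w0W N1(3) N2(3) p by auto
  moreover have "openin (S0top A) (N1 \<inter> N2 \<inter> {z \<in> S0 A. qmap A z \<in> f ` W})"
    using N1(1) N2(1) openin_continuous_map_preimage[OF continuous_qmap oZ] by auto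
  ultimately obtain w' where w': "w' \<in> N1" "w' \<in> N2" "w' \<in> Sint A" "qmap A w' \<in> f ` W"
    using Sint_dense by blast
  then obtain w where w: "w \<in> W" "qmap A w' = qmap A (c w)" by (auto simp: f_def)
  have "c w \<in> S0 A" using cS[OF subsetD[OF WD w(1)]] by (simp add: c_def)
  then have "c w = w'" using fibre_Sint[OF w'(3)] w(2) by metis
  moreover have "c w \<in> U1 \<union> U2" using w(1) by (auto simp: c_def W_def)
  ultimately show False using w'(1,2) N1(5) N2(5) by (auto simp: disjnt_def)
qed

text \<open>When \<open>p\<close> is on no glued interval, injectivity off these intervals does not
  yet exclude a point \<open>z\<close> of the fibre that is on one. But then the fibre of
  \<open>z\<close> consists of \<open>z\<close> and its partner, both on glued intervals, and
  \<open>p\<close> is neither.\<close>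

lemma glued_or_single:
  assumes p: "p \<in> S0 A"
  obtains P Q p' where "glued P Q" "p \<in> P" "p' \<in> Q" "qmap A p' = qmap A p"
      "\<And>z. z \<in> S0 A \<Longrightarrow> qmap A z = qmap A p \<Longrightarrow> z = p \<or> z = p'"
    | "\<And>P Q. glued P Q \<Longrightarrow> p \<notin> P" "\<And>z. z \<in> S0 A \<Longrightarrow> qmap A z = qmap A p \<Longrightarrow> z = p"
proof (cases "\<exists>P Q. glued P Q \<and> p \<in> P")
  case True
  then obtain P Q where PQ: "glued P Q" "p \<in> P" by blast
  then have "qmap A p \<in> qmap A ` Q" using gluedD(4) by blast
  then obtain p' where p': "p' \<in> Q" "qmap A p' = qmap A p" by auto
  have "z = p \<or> z = p'" if "z \<in> S0 A" "qmap A z = qmap A p" for z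
    using fibre_glued[OF PQ p'(1) p'(2)[symmetric] that] .
  then show ?thesis using that(1)[OF PQ p'] by blast
next
  case False
  have "z = p" if z: "z \<in> S0 A" "qmap A z = qmap A p" for z
  proof (cases "\<exists>P Q. glued P Q \<and> z \<in> P")
    case True
    then obtain P Q where PQ: "glued P Q" "z \<in> P" by blast
    then have "qmap A z \<in> qmap A ` Q" using gluedD(4) by blast
    then obtain z' where z': "z' \<in> Q" "qmap A z' = qmap A z" by auto
    from fibre_glued[OF PQ z'(1) z'(2)[symmetric] p z(2)[symmetric]]
    show ?thesis using PQ z'(1) glued_sym[OF PQ(1)] False by blast
  next
    case nz: False
    have "inj_on (qmap A) (S0 A - (\<Union>g\<in>Gam A. Xg A g \<union> Yg A g))"
      using atlas by (auto simp: is_striped_atlas_def)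
    moreover have "w \<in> S0 A - (\<Union>g\<in>Gam A. Xg A g \<union> Yg A g)" if "w \<in> S0 A" "\<not> (\<exists>P Q. glued P Q \<and> w \<in> P)" for w
      using that unfolding glued_def by blast
    ultimately show ?thesis using z p nz False unfolding inj_on_def by blast
  qed
  then show ?thesis using that(2) False by blast
qed

lemma mate_eqI:
  assumes "p' \<in> S0 A" "p' \<noteq> p" "qmap A p' = qmap A p" "\<And>z. z \<in> S0 A \<Longrightarrow> qmap A z = qmap A p \<Longrightarrow> z = p \<or> z = p'"
  shows "mate A p = p'"
proof -
  have "(SOME p'. p' \<in> S0 A \<and> p' \<noteq> p \<and> qmap A p' = qmap A p) = p'"
    using assms by (intro some_equality) blast+
  then show ?thesis unfolding mate_def using assms by auto
qed

lemma mate_glued: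
  assumes PQ: "glued P Q" and p: "p \<in> P"
  shows "mate A p \<in> Q" "qmap A (mate A p) = qmap A p" "mate A p \<noteq> p"
proof -
  have "qmap A p \<in> qmap A ` Q" using PQ p gluedD(4) by blast
  then obtain p' where p': "p' \<in> Q" "qmap A p' = qmap A p" by auto
  have ne: "p' \<noteq> p" using half_edges_disjoint[OF gluedD(1,2)[OF PQ]] gluedD(3)[OF PQ] p p' by blast
  have "mate A p = p'"
  proof (rule mate_eqI)
    show "p' \<in> S0 A" using p' half_edge_subset[OF gluedD(2)[OF PQ]] by blast
    show "z = p \<or> z = p'" if "z \<in> S0 A" "qmap A z = qmap A p" for z
      using fibre_glued[OF PQ p p'(1) p'(2)[symmetric] that] .
  qed (use ne p' in auto)
  then show "mate A p \<in> Q" "qmap A (mate A p) = qmap A p" "mate A p \<noteq> p" using p' ne by auto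
qed

lemma mate_single: "p \<in> S0 A \<Longrightarrow> (\<And>P Q. glued P Q \<Longrightarrow> p \<notin> P) \<Longrightarrow> mate A p = p"
  by (erule glued_or_single) (auto simp: mate_def)

lemma mate_in_S0: assumes "p \<in> S0 A" shows "mate A p \<in> S0 A" and "qmap A (mate A p) = qmap A p"
proof -
  have "mate A p \<in> S0 A \<and> qmap A (mate A p) = qmap A p"
    using assms
  proof (rule glued_or_single)
    fix P Q assume "glued P Q" "p \<in> P"
    then show ?thesis using mate_glued[of P Q p] half_edge_subset[OF gluedD(2)] by blast
  next
    assume "\<And>P Q. glued P Q \<Longrightarrow> p \<notin> P"
    then show ?thesis using mate_single assms by auto
  qed
  then show "mate A p \<in> S0 A" "qmap A (mate A p) = qmap A p" by auto
qed

text \<open>Lets fibres of the two quotient maps be compared by comparing the two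
  involutions.\<close>

lemma qmap_eq_iff:
  assumes p: "p \<in> S0 A" and z: "z \<in> S0 A"
  shows "qmap A z = qmap A p \<longleftrightarrow> z = p \<or> z = mate A p"
proof
  assume eq: "qmap A z = qmap A p"
  show "z = p \<or> z = mate A p"
    using p
  proof (rule glued_or_single)
    fix P Q p' assume PQ: "glued P Q" "p \<in> P" and *: "\<And>z. z \<in> S0 A \<Longrightarrow> qmap A z = qmap A p \<Longrightarrow> z = p \<or> z = p'"
    then have "mate A p = p'" using mate_glued(3)[OF PQ] mate_in_S0[OF p] by blast
    then show ?thesis using *[OF z eq] by blast
  qed (use eq z in blast)
qed (use mate_in_S0[OF p] in auto)

lemma mate_mate: "p \<in> S0 A \<Longrightarrow> mate A (mate A p) = p"
  by (metis mate_in_S0 qmap_eq_iff)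

text \<open>No half-edge occurs twice among the \<open>X\<close> and \<open>Y\<close>, so the
  choices inside \<open>xi\<close> return the given index \<open>g\<close>.\<close>

lemma xi_glued:
  assumes PQ: "glued P Q" shows "xi A P = Q"
proof -
  have i: "inj_on (Xg A) (Gam A)" "inj_on (Yg A) (Gam A)" "Xg A ` Gam A \<inter> Yg A ` Gam A = {}"
    using atlas unfolding is_striped_atlas_def by blast+
  obtain g where g: "g \<in> Gam A" "P = Xg A g \<and> Q = Yg A g \<or> P = Yg A g \<and> Q = Xg A g"
    using PQ by (auto simp: glued_def)
  have s1: "(SOME h. h \<in> Gam A \<and> Xg A g = Xg A h) = g" "(SOME h. h \<in> Gam A \<and> Yg A g = Yg A h) = g"
    using i g(1) by (auto intro!: some_equality simp: inj_on_def)
  have "\<not> (\<exists>h\<in>Gam A. Yg A g = Xg A h)" using i(3) g(1) by auto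
  then show ?thesis using g s1 by (auto simp: xi_def)
qed

lemma xi_unglued: "(\<And>Q. \<not> glued P Q) \<Longrightarrow> xi A P = P"
  unfolding xi_def glued_def by auto

lemma xi_neq_glued: "xi A P \<noteq> P \<Longrightarrow> glued P (xi A P)"
  using xi_glued xi_unglued by metis

text \<open>Makes \<open>xi\<close> the action of \<open>mate\<close> on half-edges, so that
  compatibility of a map with \<open>xi\<close> follows from compatibility with
  \<open>mate\<close>.\<close>

lemma mate_image:
  assumes P: "P \<in> H A" shows "mate A ` P = xi A P"
proof (cases "\<exists>Q. glued P Q")
  case True
  then obtain Q where PQ: "glued P Q" by blast
  have "mate A ` P = Q"
  proof
    show "mate A ` P \<subseteq> Q" using mate_glued(1)[OF PQ] by auto
    show "Q \<subseteq> mate A ` P"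
    proof
      fix z assume z: "z \<in> Q"
      then have "z \<in> S0 A" using half_edge_subset[OF gluedD(2)[OF PQ]] by blast
      then show "z \<in> mate A ` P" using mate_glued(1)[OF glued_sym[OF PQ] z] mate_mate by (metis imageI)
    qed
  qed
  then show ?thesis using xi_glued[OF PQ] by simp
next
  case False
  have "mate A p = p" if "p \<in> P" for p
  proof (rule mate_single)
    show "p \<in> S0 A" using that half_edge_subset[OF P] by blast
    show "p \<notin> P'" if "glued P' Q'" for P' Q'
      using half_edges_disjoint[OF P gluedD(1)[OF that] \<open>p \<in> P\<close>] that False by blast
  qed
  then show ?thesis using xi_unglued False by simp
qed

lemma mate_unglued: "P \<in> H A \<Longrightarrow> xi A P = P \<Longrightarrow> p \<in> P \<Longrightarrow> mate A p = p"
proof (rule mate_single)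
  assume P: "P \<in> H A" "xi A P = P" "p \<in> P"
  show "p \<in> S0 A" using half_edge_subset[OF P(1)] P(3) by blast
  show "p \<notin> P'" if "glued P' Q'" for P' Q'
    using half_edges_disjoint[OF P(1) gluedD(1)[OF that] P(3)] that P(2) xi_glued[OF that] gluedD(3)[OF that] by blast
qed

lemma xi_in_H: "P \<in> H A \<Longrightarrow> xi A P \<in> H A"
  by (metis gluedD(2) xi_neq_glued)

text \<open>\<open>sigma\<close> is read off from the gluing map on \<open>Y\<close> only. On
  \<open>X\<close> the map \<open>mate\<close> is the inverse of that map, and the inverse of a
  monotone map is monotone with the same sign.\<close>

lemma mate_monotone:
  assumes PQ: "glued P Q"
  shows "sigma A P Q \<in> {-1, 1}"
    and "\<And>a b. a \<in> P \<Longrightarrow> b \<in> P \<Longrightarrow> xc a < xc b \<Longrightarrow> sigma A P Q * xc (mate A a) < sigma A P Q * xc (mate A b)"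
proof -
  have mono: "(\<forall>a\<in>P. \<forall>b\<in>P. xc a < xc b \<longrightarrow> xc (mate A a) < xc (mate A b)) \<or>
     (\<forall>a\<in>P. \<forall>b\<in>P. xc a < xc b \<longrightarrow> xc (mate A b) < xc (mate A a))" if PQ: "glued P Q" for P Q
  proof -
    obtain l s I where P: "l \<in> Lam A" "s \<in> {-1, 1}" "P \<in> d A s l" "open I" "connected I" "I \<noteq> {}"
      "I \<subseteq> btrace s (strip A l)" "P = {l} \<times> (I \<times> {side s (strip A l)})"
      using half_edge_cases[OF gluedD(1)[OF PQ]] .
    obtain m r J where Q: "m \<in> Lam A" "r \<in> {-1, 1}" "Q \<in> d A r m" "open J" "connected J" "J \<noteq> {}"
      "J \<subseteq> btrace r (strip A m)" "Q = {m} \<times> (J \<times> {side r (strip A m)})"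
      using half_edge_cases[OF gluedD(2)[OF PQ]] .
    obtain \<psi> where \<psi>: "continuous_on I \<psi>" "inj_on \<psi> I" "\<And>x. x \<in> I \<Longrightarrow> \<psi> x \<in> J"
      "\<And>x. x \<in> I \<Longrightarrow> qmap A (m, (\<psi> x, side r (strip A m))) = qmap A (l, (x, side s (strip A l)))"
      using glued_coordinate[OF PQ P(1) P(8) Q(8)] by blast
    have mt: "xc (mate A p) = \<psi> (xc p)" if p: "p \<in> P" for p
    proof -
      have x: "xc p \<in> I" "p = (l, (xc p, side s (strip A l)))" using p P(8) by (auto simp: xc_def)
      let ?z = "(m, (\<psi> (xc p), side r (strip A m)))"
      have "?z \<in> Q" using \<psi>(3)[OF x(1)] Q(8) by auto
      moreover have "qmap A ?z = qmap A (mate A p)" using \<psi>(4)[OF x(1)] x(2) mate_glued(2)[OF PQ p] by simp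
      ultimately have "?z = mate A p"
        using gluedD(5)[OF glued_sym[OF PQ]] mate_glued(1)[OF PQ p] by (auto simp: inj_on_def)
      then show ?thesis by (metis xc_def fst_conv snd_conv)
    qed
    have xI: "xc p \<in> I" if "p \<in> P" for p using that P(8) by (auto simp: xc_def)
    show ?thesis
      using continuous_inj_on_interval_monotone[OF P(5) \<psi>(1,2)]
      by (auto simp: strict_mono_on_def mt xI)
  qed
  have inv: "mate A (mate A p) = p" "mate A p \<in> Q" if "p \<in> P" for p
    using mate_mate mate_glued(1)[OF PQ that] half_edge_subset[OF gluedD(1)[OF PQ]] that by blast+
  have i: "inj_on (Xg A) (Gam A)" "inj_on (Yg A) (Gam A)" "Xg A ` Gam A \<inter> Yg A ` Gam A = {}"
    using atlas unfolding is_striped_atlas_def by blast+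
  obtain g where g: "g \<in> Gam A" "P = Xg A g \<and> Q = Yg A g \<or> P = Yg A g \<and> Q = Xg A g"
    using PQ by (auto simp: glued_def)
  have "(SOME h. h \<in> Gam A \<and> ((P = Xg A h \<and> Q = Yg A h) \<or> (P = Yg A h \<and> Q = Xg A h))) = g"
  proof (rule some_equality)
    show "g \<in> Gam A \<and> ((P = Xg A g \<and> Q = Yg A g) \<or> (P = Yg A g \<and> Q = Xg A g))" using g by blast
    fix h assume h: "h \<in> Gam A \<and> ((P = Xg A h \<and> Q = Yg A h) \<or> (P = Yg A h \<and> Q = Xg A h))"
    have "Xg A h \<noteq> Yg A g" "Yg A h \<noteq> Xg A g" using h g(1) i(3) by auto
    then show "h = g" using h g i(1) unfolding inj_on_def by metis
  qed
  then have sg: "sigma A P Q = orient (glue A g) (Yg A g)" by (simp add: sigma_def)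
  have XY: "glued (Yg A g) (Xg A g)" using g(1) by (auto simp: glued_def)
  have gl: "glue A g y = mate A y" if y: "y \<in> Yg A g" for y
    unfolding glue_def
  proof (rule the_equality)
    show "mate A y \<in> Xg A g \<and> qmap A (mate A y) = qmap A y" using mate_glued[OF XY y] by blast
    show "x = mate A y" if "x \<in> Xg A g \<and> qmap A x = qmap A y" for x
      using that gluedD(5)[OF glued_sym[OF XY]] mate_glued(1,2)[OF XY y] by (auto simp: inj_on_def)
  qed
  have sg2: "sigma A P Q = (if \<forall>a\<in>Yg A g. \<forall>b\<in>Yg A g. xc a < xc b \<longrightarrow> xc (mate A a) < xc (mate A b) then 1 else -1)"
    unfolding sg orient_def using gl by simp
  then show "sigma A P Q \<in> {-1, 1}" by auto
  have Y: "sigma A P Q * xc (mate A a) < sigma A P Q * xc (mate A b)" if "a \<in> Yg A g" "b \<in> Yg A g" "xc a < xc b" for a b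
    using mono[OF XY] that unfolding sg2 by auto
  fix a b assume ab: "a \<in> P" "b \<in> P" "xc a < xc b"
  show "sigma A P Q * xc (mate A a) < sigma A P Q * xc (mate A b)"
  proof (cases "P = Yg A g")
    case True
    then show ?thesis using Y ab by simp
  next
    case False
    then have Q: "Q = Yg A g" using g by auto
    have ne: "xc (mate A a) \<noteq> xc (mate A b)" using mono[OF PQ] ab by fastforce
    \<comment> \<open>Here \<open>a\<close> and \<open>b\<close> are on \<open>X\<close>; the known
      case applies to their mates and, \<open>mate\<close> being an involution, returns a comparison
      of \<open>a\<close> and \<open>b\<close>.\<close>
    have "mate A a \<in> Yg A g" "mate A b \<in> Yg A g" using inv ab Q by auto
    from Y[OF this] Y[OF this(2,1)] have
      "xc (mate A a) < xc (mate A b) \<Longrightarrow> sigma A P Q * xc a < sigma A P Q * xc b"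
      "xc (mate A b) < xc (mate A a) \<Longrightarrow> sigma A P Q * xc b < sigma A P Q * xc a"
      using inv(1) ab by auto
    then show ?thesis using \<open>sigma A P Q \<in> {-1, 1}\<close> ab(3) ne by fastforce
  qed
qed

end

section \<open>Signs of a foliated homeomorphism of strips\<close>

definition sint :: "(real \<times> real) set \<Rightarrow> (real \<times> real) set" where
  "sint S = UNIV \<times> {strip_lo S<..<strip_hi S}"

lemma sint_subset: "is_strip S \<Longrightarrow> sint S \<subseteq> S"
  using mem_strip_iff by (auto simp: sint_def)

lemma open_sint: "open (sint S)"
  unfolding sint_def by (intro open_Times) auto

lemma strip_bounds: "is_strip S \<Longrightarrow> p \<in> S \<Longrightarrow> strip_lo S \<le> snd p \<and> snd p \<le> strip_hi S"
  using mem_strip_iff[of S "fst p" "snd p"] is_strip_structure(1)[of S] by (auto simp: side_def)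

text \<open>A planar neighbourhood of a point contains points slightly above and slightly below it,
  which a boundary point of a strip does not allow.\<close>

lemma open_subset_sint:
  assumes S: "is_strip S" and U: "open U" "U \<subseteq> S" shows "U \<subseteq> sint S"
proof
  fix p assume p: "p \<in> U"
  then obtain e where e: "e > 0" "ball p e \<subseteq> U" using U(1) by (auto simp: open_contains_ball)
  have "(fst p, snd p + e / 2) \<in> ball p e" "(fst p, snd p - e / 2) \<in> ball p e"
    using e by (cases p; simp add: dist_Pair_Pair dist_real_def)+
  then have "strip_lo S \<le> snd p - e / 2" "snd p + e / 2 \<le> strip_hi S"
    using e U(2) strip_bounds[OF S] by fastforce+
  then show "p \<in> sint S" using e by (cases p) (auto simp: sint_def)
qed

lemma connected_strip: assumes S: "is_strip S" shows "connected S"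
proof (rule connected_intermediate_closure[OF _ sint_subset[OF S]])
  show "connected (sint S)" unfolding sint_def by (intro connected_Times) auto
  have "closure (sint S) = UNIV \<times> {strip_lo S..strip_hi S}"
    using is_strip_structure(1)[OF S] by (simp add: sint_def closure_Times)
  then show "S \<subseteq> closure (sint S)" using strip_bounds[OF S] by auto
qed

text \<open>Invariance of domain for \<open>F\<close> and for its inverse. It keeps a foliated
  homeomorphism from exchanging interior lines with boundary intervals.\<close>

lemma homeomorphism_sint:
  assumes S: "is_strip S" and S': "is_strip S'" and F: "homeomorphism S S' F G"
  shows "F ` sint S = sint S'"
proof -
  have sub: "F ` sint S \<subseteq> sint S'" if S: "is_strip S" and S': "is_strip S'" and F: "homeomorphism S S' F G" for S S' F G
  proof (rule open_subset_sint[OF S'])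
    have "inj_on F S" by (rule inj_on_inverseI[of _ G]) (rule homeomorphism_apply1[OF F])
    then show "open (F ` sint S)"
      by (intro invariance_of_domain open_sint continuous_on_subset[OF homeomorphism_cont1[OF F]] sint_subset[OF S])
        (use sint_subset[OF S] inj_on_subset in blast)
    show "F ` sint S \<subseteq> S'" using sint_subset[OF S] homeomorphism_image1[OF F] by blast
  qed
  have "G ` sint S' \<subseteq> sint S" using sub[OF S' S homeomorphism_symD[OF F]] .
  then have "F ` G ` sint S' \<subseteq> F ` sint S" by blast
  moreover have "F ` G ` sint S' = sint S'"
    using homeomorphism_apply2[OF F] sint_subset[OF S'] by (force simp: image_image)
  ultimately show ?thesis using sub[OF S S' F] by blast
qed

text \<open>Carries inequalities between interior rows over to the boundary. The last clause keeps
  the approach between the middle row and the side in question.\<close>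

lemma collar_tendsto:
  assumes S: "is_strip S" and s: "s \<in> {-1, 1}" and x: "x \<in> btrace s S" and F: "continuous_on S F"
  shows "((\<lambda>t. F (x, side s S - real_of_int s * t)) \<longlongrightarrow> F (x, side s S)) (at_right 0)"
    and "eventually (\<lambda>t. strip_lo S < side s S - real_of_int s * t \<and> side s S - real_of_int s * t < strip_hi S \<and>
       real_of_int s * ((strip_lo S + strip_hi S) / 2) < real_of_int s * (side s S - real_of_int s * t)) (at_right 0)"
proof -
  let ?c = "\<lambda>t. (x, side s S - real_of_int s * t)"
  have lh: "strip_lo S < strip_hi S" using is_strip_structure(1)[OF S] .
  have "eventually (\<lambda>t. t \<in> {0<..<(strip_hi S - strip_lo S) / 2}) (at_right 0)"
    using lh by (intro eventually_at_right_real) simp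
  then show ev: "eventually (\<lambda>t. strip_lo S < side s S - real_of_int s * t \<and> side s S - real_of_int s * t < strip_hi S \<and>
       real_of_int s * ((strip_lo S + strip_hi S) / 2) < real_of_int s * (side s S - real_of_int s * t)) (at_right 0)"
    by eventually_elim (use s lh in \<open>auto simp: side_def field_simps\<close>)
  have "(?c \<longlongrightarrow> (x, side s S - real_of_int s * 0)) (at_right 0)" by (intro tendsto_intros)
  then have lim: "(?c \<longlongrightarrow> (x, side s S)) (at_right 0)" by simp
  have inS: "eventually (\<lambda>t. ?c t \<in> S) (at_right 0)"
    using ev by eventually_elim (use mem_strip_iff[OF S] in auto)
  have "(x, side s S) \<in> S" using x by (simp add: btrace_def)
  then show "((\<lambda>t. F (?c t)) \<longlongrightarrow> F (x, side s S)) (at_right 0)"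
    using continuous_on_tendsto_compose[OF F lim _ inS] by blast
qed

lemma strip_homeomorphism_signs:
  fixes F G :: "real \<times> real \<Rightarrow> real \<times> real"
  assumes S: "is_strip S" and S': "is_strip S'" and F: "homeomorphism S S' F G"
    and leaf: "\<forall>L\<in>strip_leaves S. F ` L \<in> strip_leaves S'"
  shows "\<exists>(dl :: int) (tu :: int). dl \<in> {-1, 1} \<and> tu \<in> {-1, 1} \<and>
    (\<forall>a b y. strip_lo S < y \<longrightarrow> y < strip_hi S \<longrightarrow> a < b \<longrightarrow> dl * fst (F (a, y)) < dl * fst (F (b, y))) \<and>
    (\<forall>p\<in>S. \<forall>p'\<in>S. snd p < snd p' \<longrightarrow> tu * snd (F p) < tu * snd (F p')) \<and>
    (\<forall>s\<in>{-1, 1}. \<forall>x\<in>btrace s S. snd (F (x, side s S)) = side (tu * s) S') \<and>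
    (\<forall>s\<in>{-1, 1}. \<forall>x\<in>btrace s S. \<forall>x'\<in>btrace s S. x < x' \<longrightarrow> dl * fst (F (x, side s S)) < dl * fst (F (x', side s S)))"
proof -
  have injF: "inj_on F S" by (rule inj_on_inverseI[of _ G]) (rule homeomorphism_apply1[OF F])
  have contF: "continuous_on S F" using homeomorphism_cont1[OF F] .
  have lh: "strip_lo S < strip_hi S" using is_strip_structure(1)[OF S] .
  \<comment> \<open>The image is a leaf inside the interior of \<open>S'\<close>, which rules out
    boundary intervals.\<close>
  have row: "\<exists>t. F ` (UNIV \<times> {y}) = UNIV \<times> {t}" if y: "strip_lo S < y" "y < strip_hi S" for y
  proof -
    have "UNIV \<times> {y} \<in> strip_leaves S" using y by (auto simp: strip_leaves_def)
    then have L: "F ` (UNIV \<times> {y}) \<in> strip_leaves S'" using leaf by blast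
    have "F ` (UNIV \<times> {y}) \<subseteq> F ` sint S" using y by (intro image_mono) (auto simp: sint_def)
    then have sub: "F ` (UNIV \<times> {y}) \<subseteq> sint S'" using homeomorphism_sint[OF S S' F] by simp
    have "F ` (UNIV \<times> {y}) \<notin> bdry_intervals S'"
    proof
      assume "F ` (UNIV \<times> {y}) \<in> bdry_intervals S'"
      then obtain s where s: "s \<in> {-1, 1}" "F ` (UNIV \<times> {y}) \<in> components (bd s S')" by (auto simp: bdry_intervals_def)
      from bd_component_interval[OF S' s(2)] obtain I where "I \<noteq> {}" "F ` (UNIV \<times> {y}) = I \<times> {side s S'}" by blast
      then show False using sub s(1) by (auto simp: sint_def side_def)
    qed
    then show ?thesis using L by (auto simp: strip_leaves_def)
  qed
  have sndeq: "snd (F (a, y)) = snd (F (b, y))" if y: "strip_lo S < y" "y < strip_hi S" for a b y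
  proof -
    obtain t where "F ` (UNIV \<times> {y}) = UNIV \<times> {t}" using row[OF y] by blast
    then have "F (a, y) \<in> UNIV \<times> {t}" "F (b, y) \<in> UNIV \<times> {t}" by blast+
    then show ?thesis by auto
  qed
  have inS: "(a, y) \<in> S" if "strip_lo S < y" "y < strip_hi S" for a y
    using mem_strip_iff[OF S] that by auto
  obtain dl :: int where dl: "dl \<in> {-1, 1}" and
    dlm: "\<And>a b y. strip_lo S < y \<Longrightarrow> y < strip_hi S \<Longrightarrow> a < b \<Longrightarrow> dl * fst (F (a, y)) < dl * fst (F (b, y))"
  proof -
    \<comment> \<open>The triples \<open>(a, (b, y))\<close> with \<open>a < b\<close>, written with
      a half-space so that convexity is immediate; one connected set handles all rows at once, hence
      one sign for the whole strip.\<close>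
    let ?K = "{p :: real \<times> real \<times> real. inner (1, (-1, 0)) p < 0} \<inter> (UNIV \<times> (UNIV \<times> {strip_lo S<..<strip_hi S}))"
    let ?f = "\<lambda>p. fst (F (fst (snd p), snd (snd p))) - fst (F (fst p, snd (snd p)))"
    have "convex ?K" by (intro convex_Int convex_halfspace_lt convex_Times) auto
    then have "connected ?K" by (rule convex_connected)
    moreover have "continuous_on ?K ?f"
      by (intro continuous_intros continuous_on_compose2[OF contF]) (use inS in auto)
    moreover have "?f p \<noteq> 0" if p: "p \<in> ?K" for p
    proof
      assume "?f p = 0"
      then have "F (fst (snd p), snd (snd p)) = F (fst p, snd (snd p))"
        using sndeq[of "snd (snd p)"] p by (auto simp: prod_eq_iff)
      moreover have "(fst (snd p), snd (snd p)) \<in> S" "(fst p, snd (snd p)) \<in> S" using inS p by auto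
      ultimately show False using inj_onD[OF injF] p by (fastforce simp: inner_prod_def)
    qed
    ultimately consider "\<forall>p\<in>?K. ?f p > 0" | "\<forall>p\<in>?K. ?f p < 0"
      using connected_nonzero_sign[of ?K ?f] by blast
    then show ?thesis
    proof cases
      case 1
      have "real_of_int 1 * fst (F (a, y)) < real_of_int 1 * fst (F (b, y))" if "strip_lo S < y" "y < strip_hi S" "a < b" for a b y
        using bspec[OF 1, of "(a, (b, y))"] that by (simp add: inner_prod_def)
      then show ?thesis using that[of 1] by blast
    next
      case 2
      have "real_of_int (-1) * fst (F (a, y)) < real_of_int (-1) * fst (F (b, y))" if "strip_lo S < y" "y < strip_hi S" "a < b" for a b y
        using bspec[OF 2, of "(a, (b, y))"] that by (simp add: inner_prod_def)
      then show ?thesis using that[of "-1"] by blast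
    qed
  qed
  let ?I = "{strip_lo S<..<strip_hi S}"
  \<comment> \<open>Rows go to rows, so the height of the image depends on \<open>y\<close> alone
    and may be measured in column 0.\<close>
  define \<beta> where "\<beta> y = snd (F (0, y))" for y
  have \<beta>: "snd (F (a, y)) = \<beta> y" if "y \<in> ?I" for a y using sndeq[of y a 0] that by (simp add: \<beta>_def)
  have \<beta>in: "strip_lo S' < \<beta> y" "\<beta> y < strip_hi S'" if "y \<in> ?I" for y
  proof -
    have "F (0, y) \<in> F ` sint S" using that by (auto simp: sint_def)
    then have "F (0, y) \<in> sint S'" using homeomorphism_sint[OF S S' F] by simp
    then show "strip_lo S' < \<beta> y" "\<beta> y < strip_hi S'" by (auto simp: sint_def \<beta>_def mem_Times_iff)
  qed
  have "continuous_on ?I \<beta>"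
    unfolding \<beta>_def by (intro continuous_intros continuous_on_compose2[OF contF]) (use inS in auto)
  moreover have "inj_on \<beta> ?I"
  proof (rule inj_onI)
    fix y y' assume y: "y \<in> ?I" "y' \<in> ?I" "\<beta> y = \<beta> y'"
    obtain t where t: "F ` (UNIV \<times> {y}) = UNIV \<times> {t}" using row[of y] y by auto
    then have "F (0, y) \<in> UNIV \<times> {t}" by blast
    then have "t = \<beta> y" by (auto simp: \<beta>_def)
    then have "F (0, y') \<in> F ` (UNIV \<times> {y})" using y(3) t by (auto simp: \<beta>_def mem_Times_iff)
    then obtain a where "F (0, y') = F (a, y)" by auto
    then show "y = y'" using injF inS y by (auto simp: inj_on_def)
  qed
  ultimately have "strict_mono_on ?I \<beta> \<or> strict_mono_on ?I (\<lambda>x. - \<beta> x)"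
    by (intro continuous_inj_on_interval_monotone) auto
  then obtain tu :: int where tu: "tu \<in> {-1, 1}" and tum: "\<And>y y'. y \<in> ?I \<Longrightarrow> y' \<in> ?I \<Longrightarrow> y < y' \<Longrightarrow> tu * \<beta> y < tu * \<beta> y'"
  proof
    assume "strict_mono_on ?I \<beta>"
    then show ?thesis by (intro that[of 1]) (auto simp: strict_mono_on_def)
  next
    assume "strict_mono_on ?I (\<lambda>x. - \<beta> x)"
    then show ?thesis by (intro that[of "-1"]) (auto simp: strict_mono_on_def)
  qed
  define mid where "mid = (strip_lo S + strip_hi S) / 2"
  have mid: "mid \<in> ?I" using lh by (auto simp: mid_def)
  \<comment> \<open>Boundary points do not become interior, so only two heights are possible. The
    limit from inside decides: near side \<open>s\<close> the image heights lie beyond that of the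
    middle row, in the direction \<open>tu * s\<close>.\<close>
  have sides: "snd (F (x, side s S)) = side (tu * s) S'" if s: "s \<in> {-1, 1}" and x: "x \<in> btrace s S" for s x
  proof -
    have xS: "(x, side s S) \<in> S" using x by (simp add: btrace_def)
    then have FS': "F (x, side s S) \<in> S'" using homeomorphism_image1[OF F] by blast
    have "F (x, side s S) \<notin> sint S'"
    proof
      assume "F (x, side s S) \<in> sint S'"
      then have "F (x, side s S) \<in> F ` sint S" using homeomorphism_sint[OF S S' F] by simp
      then obtain w where "w \<in> sint S" "F w = F (x, side s S)" by auto
      then have "(x, side s S) \<in> sint S" using injF sint_subset[OF S] xS by (metis inj_onD subsetD)
      then show False using s by (auto simp: sint_def side_def)
    qed
    then have cases: "snd (F (x, side s S)) = strip_lo S' \<or> snd (F (x, side s S)) = strip_hi S'"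
      using mem_strip_iff[OF S', of "fst (F (x, side s S))" "snd (F (x, side s S))"] FS' by (auto simp: side_def sint_def mem_Times_iff)
    have "((\<lambda>t. tu * s * snd (F (x, side s S - real_of_int s * t))) \<longlongrightarrow> tu * s * snd (F (x, side s S))) (at_right 0)"
      by (intro tendsto_intros tendsto_snd collar_tendsto(1)[OF S s x contF])
    moreover have "eventually (\<lambda>t. tu * s * \<beta> mid \<le> tu * s * snd (F (x, side s S - real_of_int s * t))) (at_right 0)"
      using collar_tendsto(2)[OF S s x contF]
    proof eventually_elim
      case (elim t)
      then show ?case
        using s tum[OF mid, of "side s S - real_of_int s * t"] tum[OF _ mid, of "side s S - real_of_int s * t"]
          \<beta>[of "side s S - real_of_int s * t" x]
        unfolding mid_def[symmetric] by auto
    qed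
    ultimately have "tu * s * \<beta> mid \<le> tu * s * snd (F (x, side s S))"
      by (rule tendsto_lowerbound) auto
    then show ?thesis
      using cases \<beta>in[OF mid] s tu by (auto simp: side_def)
  qed
  \<comment> \<open>The limit yields only a weak inequality; equality is excluded by injectivity,
    since both images have the same height by \<open>sides\<close>.\<close>
  have bdryorder: "dl * fst (F (x, side s S)) < dl * fst (F (x', side s S))"
    if s: "s \<in> {-1, 1}" and x: "x \<in> btrace s S" and x': "x' \<in> btrace s S" and xx': "x < x'" for s x x'
  proof -
    have "((\<lambda>t. dl * fst (F (x, side s S - real_of_int s * t))) \<longlongrightarrow> dl * fst (F (x, side s S))) (at_right 0)"
      "((\<lambda>t. dl * fst (F (x', side s S - real_of_int s * t))) \<longlongrightarrow> dl * fst (F (x', side s S))) (at_right 0)"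
      by (intro tendsto_intros tendsto_fst collar_tendsto(1)[OF S s _ contF] x x')+
    moreover have "eventually (\<lambda>t. dl * fst (F (x, side s S - real_of_int s * t)) \<le> dl * fst (F (x', side s S - real_of_int s * t))) (at_right 0)"
      using collar_tendsto(2)[OF S s x contF] by eventually_elim (use dlm xx' in \<open>auto intro: less_imp_le\<close>)
    ultimately have "dl * fst (F (x, side s S)) \<le> dl * fst (F (x', side s S))"
      by (intro tendsto_le[of "at_right (0::real)"]) auto
    moreover have "fst (F (x, side s S)) \<noteq> fst (F (x', side s S))"
    proof
      assume "fst (F (x, side s S)) = fst (F (x', side s S))"
      then have "F (x, side s S) = F (x', side s S)" using sides[OF s x] sides[OF s x'] by (auto simp: prod_eq_iff)
      then show False using injF x x' xx' by (auto simp: inj_on_def btrace_def)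
    qed
    ultimately show ?thesis using dl by auto
  qed
  have "tu * snd (F p) < tu * snd (F p')" if p: "p \<in> S" "p' \<in> S" "snd p < snd p'" for p p'
  proof -
    have trich: "snd p \<in> ?I \<or> snd p = side (-1) S \<and> fst p \<in> btrace (-1) S \<or> snd p = side 1 S \<and> fst p \<in> btrace 1 S" if "p \<in> S" for p
      using mem_strip_iff[OF S, of "fst p" "snd p"] that by auto
    have val: "snd (F p) = \<beta> (snd p)" if "snd p \<in> ?I" for p using \<beta>[OF that, of "fst p"] by simp
    have val': "snd (F p) = side (tu * s) S'" if "snd p = side s S" "fst p \<in> btrace s S" "s \<in> {-1, 1}" for p s
      using sides[OF that(3,2)] that(1) by (metis prod.collapse)
    have lh': "strip_lo S' < strip_hi S'" using is_strip_structure(1)[OF S'] .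
    have ext: "tu * side (tu * -1) S' < tu * z" "tu * z < tu * side (tu * 1) S'" if "strip_lo S' < z" "z < strip_hi S'" for z :: real
      using tu that by (auto simp: side_def)
    have ext': "tu * side (tu * -1) S' < tu * side (tu * 1) S'" using tu lh' by (auto simp: side_def)
    consider (i) "snd p \<in> ?I" | (b) "snd p = side (-1) S" "fst p \<in> btrace (-1) S" | (t) "snd p = side 1 S"
      using trich[OF p(1)] by blast
    then show ?thesis
    proof cases
      case i
      consider "snd p' \<in> ?I" | "snd p' = side (-1) S" | "snd p' = side 1 S" "fst p' \<in> btrace 1 S"
        using trich[OF p(2)] by blast
      then show ?thesis
      proof cases
        case 1
        then show ?thesis using tum[OF i 1 p(3)] val i by simp
      next
        case 2
        then show ?thesis using i p(3) by (simp add: side_def)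
      next
        case 3
        then show ?thesis using ext(2)[OF \<beta>in[OF i]] val[OF i] val'[OF 3] by simp
      qed
    next
      case b
      consider "snd p' \<in> ?I" | "snd p' = side (-1) S" | "snd p' = side 1 S" "fst p' \<in> btrace 1 S"
        using trich[OF p(2)] by blast
      then show ?thesis
      proof cases
        case 1
        then show ?thesis using ext(1)[OF \<beta>in[OF 1]] val[OF 1] val'[OF b] by simp
      next
        case 2
        then show ?thesis using b p(3) by simp
      next
        case 3
        then show ?thesis using ext' val'[OF b] val'[OF 3] by simp
      qed
    next
      case t
      then show ?thesis using strip_bounds[OF S p(2)] p(3) by (simp add: side_def)
    qed
  qed
  then have 1: "\<forall>p\<in>S. \<forall>p'\<in>S. snd p < snd p' \<longrightarrow> tu * snd (F p) < tu * snd (F p')" by blast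
  have 2: "\<forall>a b y. strip_lo S < y \<longrightarrow> y < strip_hi S \<longrightarrow> a < b \<longrightarrow> dl * fst (F (a, y)) < dl * fst (F (b, y))"
    using dlm by blast
  have 3: "\<forall>s\<in>{-1, 1}. \<forall>x\<in>btrace s S. snd (F (x, side s S)) = side (tu * s) S'" using sides by blast
  have 4: "\<forall>s\<in>{-1, 1}. \<forall>x\<in>btrace s S. \<forall>x'\<in>btrace s S. x < x' \<longrightarrow> dl * fst (F (x, side s S)) < dl * fst (F (x', side s S))"
    using bdryorder by blast
  show ?thesis by (rule exI[of _ dl], rule exI[of _ tu], intro conjI) (fact dl tu 1 2 3 4)+
qed

section \<open>The graph isomorphism induced by an equivalence\<close>

text \<open>The value -1 is the default branch of \<open>induced_delta\<close>, so for a decreasing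
  family one row and one failing pair of points must be exhibited; the pair is 0 and 1.\<close>

lemma induced_delta_eq:
  fixes dl :: int and h :: "'i \<times> (real \<times> real) \<Rightarrow> 'j \<times> (real \<times> real)"
  assumes "is_strip (strip A l)" "dl \<in> {-1, 1}"
    and mono: "\<And>a b y. strip_lo (strip A l) < y \<Longrightarrow> y < strip_hi (strip A l) \<Longrightarrow> a < b \<Longrightarrow>
      dl * xc (h (l, (a, y))) < dl * xc (h (l, (b, y)))"
  shows "induced_delta A h l = dl"
proof (cases "dl = 1")
  case True
  then show ?thesis using mono by (auto simp: induced_delta_def xc_def)
next
  case False
  then have dl: "dl = -1" using assms(2) by auto
  obtain y where y: "strip_lo (strip A l) < y" "y < strip_hi (strip A l)"
    using dense[OF is_strip_structure(1)[OF assms(1)]] by blast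
  have "\<not> fst (snd (h (l, (0, y)))) < fst (snd (h (l, (1, y))))"
    using mono[OF y, of 0 1] dl by (simp add: xc_def)
  then show ?thesis using y dl unfolding induced_delta_def by (metis zero_less_one)
qed

lemma induced_tau_eq:
  fixes tu :: int and h :: "'i \<times> (real \<times> real) \<Rightarrow> 'j \<times> (real \<times> real)"
  assumes S: "is_strip (strip A l)" and "tu \<in> {-1, 1}"
    and mono: "\<And>p p'. p \<in> strip A l \<Longrightarrow> p' \<in> strip A l \<Longrightarrow> snd p < snd p' \<Longrightarrow>
      tu * snd (snd (h (l, p))) < tu * snd (snd (h (l, p')))"
  shows "induced_tau A h l = tu"
proof (cases "tu = 1")
  case True
  then show ?thesis using mono by (auto simp: induced_tau_def)
next
  case False
  then have tu: "tu = -1" using assms(2) by auto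
  obtain y where y: "strip_lo (strip A l) < y" "y < strip_hi (strip A l)"
    using dense[OF is_strip_structure(1)[OF S]] by blast
  obtain y' where y': "y < y'" "y' < strip_hi (strip A l)" using dense[OF y(2)] by blast
  have mem: "(0, y) \<in> strip A l" "(0, y') \<in> strip A l" using y y' mem_strip_iff[OF S] by auto
  then have "\<not> snd (snd (h (l, (0, y)))) < snd (snd (h (l, (0, y'))))"
    using mono[OF mem] y' tu by simp
  moreover have "snd (0 :: real, y) < snd (0 :: real, y')" using y'(1) by simp
  ultimately have "\<not> (\<forall>p\<in>strip A l. \<forall>p'\<in>strip A l. snd p < snd p' \<longrightarrow> snd (snd (h (l, p))) < snd (snd (h (l, p'))))"
    using mem by blast
  then show ?thesis using tu unfolding induced_tau_def by simp
qed

lemma induced_nu_eq: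
  assumes "m \<in> Lam B" "h ` ({l} \<times> strip A l) = {m} \<times> strip B m" "strip B m \<noteq> {}"
  shows "induced_nu A B h l = m"
  unfolding induced_nu_def
proof (rule the_equality)
  show "m' = m" if "m' \<in> Lam B \<and> h ` ({l} \<times> strip A l) = {m'} \<times> strip B m'" for m'
  proof -
    obtain z where "z \<in> strip B m" using assms(3) by blast
    then have "(m, z) \<in> {m'} \<times> strip B m'" using that assms(2) by blast
    then show ?thesis by blast
  qed
qed (use assms in blast)

lemma strip_nonempty: "is_strip S \<Longrightarrow> S \<noteq> {}"
  using sint_subset[of S] dense[OF is_strip_structure(1)[of S]] by (fastforce simp: sint_def)

lemma continuous_map_fst_S0top: "continuous_map (S0top A) (discrete_topology UNIV) fst"
  unfolding S0top_def by (intro continuous_map_from_subtopology continuous_map_fst)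

lemma continuous_map_snd_S0top: "continuous_map (S0top A) euclidean snd"
  unfolding S0top_def by (intro continuous_map_from_subtopology continuous_map_snd)

context striped
begin

text \<open>Half-edges are nonempty, and any point reveals the strip by its index and the side by
  its height.\<close>

lemma d_unique:
  assumes "P \<in> d A s l" "P \<in> d A s' l'" "l \<in> Lam A" "l' \<in> Lam A" "s \<in> {-1, 1}" "s' \<in> {-1, 1}"
  shows "l = l' \<and> s = s'"
proof -
  obtain B where B: "B \<in> components (bd s (strip A l))" "P = {l} \<times> B" using assms by (auto simp: d_def)
  obtain B' where B': "B' \<in> components (bd s' (strip A l'))" "P = {l'} \<times> B'" using assms by (auto simp: d_def)
  obtain z where z: "z \<in> B" using in_components_nonempty[OF B(1)] by blast
  then have l: "l = l'" "z \<in> B'" using B B' by auto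
  then have "snd z = side s (strip A l)" "snd z = side s' (strip A l)"
    using z in_components_subset[OF B(1)] in_components_subset[OF B'(1)] by (auto simp: bd_eq_btrace)
  then show ?thesis using side_eq_iff assms l by metis
qed

lemma S0_leaf_cases:
  assumes "L \<in> S0_leaves A"
  obtains l t where "l \<in> Lam A" "strip_lo (strip A l) < t" "t < strip_hi (strip A l)" "L = {l} \<times> (UNIV \<times> {t})"
    | "L \<in> H A"
proof -
  obtain l L0 where L: "l \<in> Lam A" "L0 \<in> strip_leaves (strip A l)" "L = {l} \<times> L0"
    using assms by (auto simp: S0_leaves_def)
  show ?thesis
  proof (cases "L0 \<in> bdry_intervals (strip A l)")
    case True
    then have "L \<in> d A (-1) l \<or> L \<in> d A 1 l" using L by (auto simp: bdry_intervals_def d_def)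
    then have "L \<in> H A" using L(1) by (auto simp: H_def dall_def)
    then show ?thesis by (rule that(2))
  next
    case False
    then obtain t where "strip_lo (strip A l) < t" "t < strip_hi (strip A l)" "L0 = UNIV \<times> {t}"
      using L(2) by (auto simp: strip_leaves_def)
    then show ?thesis using that(1) L by blast
  qed
qed

lemma H_subset_leaves: "H A \<subseteq> S0_leaves A"
  by (auto simp: H_def dall_def d_def S0_leaves_def strip_leaves_def bdry_intervals_def)

end

section \<open>Homeomorphisms between two disjoint unions of strips\<close>

locale striped_pair = A: striped A + B: striped B
  for A :: "('i, 'g, 'z, 'm) striped_atlas_scheme" and B :: "('j, 'h, 'w, 'n) striped_atlas_scheme"
begin

text \<open>A strip is connected, and the index of the image strip depends continuously on the
  point, with values in a discrete space.\<close>

lemma homeo_into_strip: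
  assumes h: "continuous_map (S0top A) (S0top B) h" and l: "l \<in> Lam A"
  shows "\<exists>m\<in>Lam B. h ` ({l} \<times> strip A l) \<subseteq> {m} \<times> strip B m"
proof -
  have "continuous_map (top_of_set (strip A l)) (discrete_topology UNIV) (fst \<circ> (h \<circ> Pair l))"
    by (rule continuous_map_compose[OF continuous_map_compose[OF continuous_map_Pair_S0top[OF l] h] continuous_map_fst_S0top])
  moreover have "connectedin (top_of_set (strip A l)) (strip A l)"
    using connected_strip[OF A.strip_in[OF l]] by (simp add: connectedin_subtopology)
  ultimately have "connectedin (discrete_topology UNIV) ((fst \<circ> (h \<circ> Pair l)) ` strip A l)"
    by (rule connectedin_continuous_map_image)
  then obtain m where m: "(fst \<circ> (h \<circ> Pair l)) ` strip A l \<subseteq> {m}" by (auto simp: connectedin_discrete_topology)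
  have hS: "h (l, p) \<in> S0 B" if "p \<in> strip A l" for p
    using h that l by (auto simp: continuous_map_def S0_def)
  have "h (l, p) \<in> {m} \<times> strip B m" if "p \<in> strip A l" for p
    using m hS[OF that] that by (auto simp: S0_def image_subset_iff mem_Sigma_iff split: prod.splits)
  moreover have "m \<in> Lam B"
    using strip_nonempty[OF A.strip_in[OF l]] hS m by (fastforce simp: S0_def)
  ultimately show ?thesis by blast
qed

text \<open>The inverse also sends strip \<open>m\<close> into a single strip, and that strip is
  \<open>l\<close> because some point of strip \<open>l\<close> comes back to itself.\<close>

lemma homeo_strips:
  assumes hg: "homeomorphic_maps (S0top A) (S0top B) h g" and l: "l \<in> Lam A"
  shows "\<exists>m\<in>Lam B. h ` ({l} \<times> strip A l) = {m} \<times> strip B m \<and>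
    homeomorphism (strip A l) (strip B m) (\<lambda>p. snd (h (l, p))) (\<lambda>p. snd (g (m, p)))"
proof -
  have h: "continuous_map (S0top A) (S0top B) h" and g: "continuous_map (S0top B) (S0top A) g"
    and gh: "\<And>p. p \<in> S0 A \<Longrightarrow> g (h p) = p" and hg': "\<And>p. p \<in> S0 B \<Longrightarrow> h (g p) = p"
    using hg by (auto simp: homeomorphic_maps_def)
  interpret BA: striped_pair B A ..
  obtain m where m: "m \<in> Lam B" "h ` ({l} \<times> strip A l) \<subseteq> {m} \<times> strip B m" using homeo_into_strip[OF h l] by blast
  obtain l' where l': "l' \<in> Lam A" "g ` ({m} \<times> strip B m) \<subseteq> {l'} \<times> strip A l'" using BA.homeo_into_strip[OF g m(1)] by blast
  obtain p where p: "p \<in> strip A l" using strip_nonempty[OF A.strip_in[OF l]] by blast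
  then have "g (h (l, p)) \<in> {l'} \<times> strip A l'" using m l' by blast
  then have ll': "l' = l" using gh[of "(l, p)"] p l by (auto simp: S0_def)
  have gm: "g ` ({m} \<times> strip B m) \<subseteq> {l} \<times> strip A l" using l' ll' by simp
  have hl: "h (l, p) = (m, snd (h (l, p))) \<and> snd (h (l, p)) \<in> strip B m" if "p \<in> strip A l" for p
  proof -
    have "h (l, p) \<in> {m} \<times> strip B m" using m(2) that by blast
    then show ?thesis by auto
  qed
  have gl: "g (m, p) = (l, snd (g (m, p))) \<and> snd (g (m, p)) \<in> strip A l" if "p \<in> strip B m" for p
  proof -
    have "g (m, p) \<in> {l} \<times> strip A l" using gm that by blast
    then show ?thesis by auto
  qed
  have "{m} \<times> strip B m \<subseteq> h ` ({l} \<times> strip A l)"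
  proof
    fix z assume z: "z \<in> {m} \<times> strip B m"
    then have "g z \<in> {l} \<times> strip A l" "h (g z) = z" using gm hg'[of z] m(1) by (auto simp: S0_def)
    then show "z \<in> h ` ({l} \<times> strip A l)" by (metis imageI)
  qed
  then have eq: "h ` ({l} \<times> strip A l) = {m} \<times> strip B m" using m(2) by blast
  have "homeomorphism (strip A l) (strip B m) (\<lambda>p. snd (h (l, p))) (\<lambda>p. snd (g (m, p)))"
  proof (rule homeomorphismI)
    show "continuous_on (strip A l) (\<lambda>p. snd (h (l, p)))"
      using continuous_map_compose[OF continuous_map_compose[OF continuous_map_Pair_S0top[OF l] h] continuous_map_snd_S0top]
      by (simp add: o_def)
    show "continuous_on (strip B m) (\<lambda>p. snd (g (m, p)))"
      using continuous_map_compose[OF continuous_map_compose[OF continuous_map_Pair_S0top[OF m(1)] g] continuous_map_snd_S0top]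
      by (simp add: o_def)
    show "(\<lambda>p. snd (h (l, p))) ` strip A l \<subseteq> strip B m" using hl by auto
    show "(\<lambda>p. snd (g (m, p))) ` strip B m \<subseteq> strip A l" using gl by auto
    show "snd (g (m, snd (h (l, p)))) = p" if "p \<in> strip A l" for p
      using hl[OF that] gh[of "(l, p)"] that l by (simp add: S0_def)
    show "snd (h (l, snd (g (m, p)))) = p" if "p \<in> strip B m" for p
      using gl[OF that] hg'[of "(m, p)"] that m(1) by (simp add: S0_def)
  qed
  then show ?thesis using m(1) eq by blast
qed

text \<open>If \<open>p\<close> has another point in its fibre, injectivity of \<open>h\<close>
  decides. If \<open>p\<close> is alone, injectivity of \<open>k\<close> is what counts: the
  preimage under \<open>h\<close> of the mate of \<open>h p\<close> lies in the fibre of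
  \<open>p\<close>.\<close>

lemma equivalence_commutes_mate:
  assumes eq: "atlas_equiv A B h k" and p: "p \<in> S0 A"
  shows "h (mate A p) = mate B (h p)"
proof -
  have h: "homeomorphic_map (S0top A) (S0top B) h" and k: "homeomorphic_map (Zsp A) (Zsp B) k"
    and qh: "\<And>p. p \<in> S0 A \<Longrightarrow> qmap B (h p) = k (qmap A p)"
    using eq by (auto simp: atlas_equiv_def foliated_homeo_def)
  have injh: "inj_on h (S0 A)" and imh: "h ` S0 A = S0 B"
    using h by (auto simp: homeomorphic_eq_everything_map)
  have injk: "inj_on k (topspace (Zsp A))" using k by (auto simp: homeomorphic_eq_everything_map)
  have qZ: "qmap A z \<in> topspace (Zsp A)" if "z \<in> S0 A" for z
    using A.continuous_qmap that by (auto simp: continuous_map_def)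
  have hp: "h p \<in> S0 B" "mate A p \<in> S0 A" "h (mate A p) \<in> S0 B" using p imh A.mate_in_S0(1)[OF p] by auto
  show ?thesis
  proof (cases "mate A p = p")
    case False
    have "qmap B (h (mate A p)) = qmap B (h p)" using qh p hp(2) A.mate_in_S0(2)[OF p] by simp
    then have "h (mate A p) = h p \<or> h (mate A p) = mate B (h p)" using B.qmap_eq_iff[OF hp(1,3)] by blast
    then show ?thesis using False injh p hp(2) by (auto simp: inj_on_def)
  next
    case True
    have "mate B (h p) \<in> S0 B" using B.mate_in_S0(1)[OF hp(1)] .
    then obtain w where w: "w \<in> S0 A" "h w = mate B (h p)" using imh by (metis imageE)
    then have "k (qmap A w) = k (qmap A p)" using qh p B.mate_in_S0(2)[OF hp(1)] by metis
    then have "qmap A w = qmap A p" using injk qZ w(1) p by (auto simp: inj_on_def)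
    then have "w = p" using A.qmap_eq_iff[OF p w(1)] True by auto
    then show ?thesis using True w(2) by simp
  qed
qed

end

section \<open>Action of an equivalence on strips and half-edges\<close>

context striped_pair
begin

context
  fixes h :: "'i \<times> (real \<times> real) \<Rightarrow> 'j \<times> (real \<times> real)" and k :: "'z \<Rightarrow> 'w"
  assumes eq: "atlas_equiv A B h k"
begin

abbreviation "nu \<equiv> induced_nu A B h"
abbreviation "dl \<equiv> induced_delta A h"
abbreviation "tu \<equiv> induced_tau A h"

lemma h_homeo: "homeomorphic_map (S0top A) (S0top B) h"
  and h_leaf: "L \<in> S0_leaves A \<Longrightarrow> h ` L \<in> S0_leaves B"
  and h_leaf_onto: "L' \<in> S0_leaves B \<Longrightarrow> \<exists>L\<in>S0_leaves A. h ` L = L'"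
  using eq by (auto simp: atlas_equiv_def foliated_homeo_def)

lemma h_inj: "inj_on h (S0 A)" and h_image: "h ` S0 A = S0 B"
  using h_homeo by (auto simp: homeomorphic_eq_everything_map)

text \<open>Restricted to one strip, \<open>h\<close> is a foliated homeomorphism onto a strip of
  \<open>B\<close>. The signs found by \<open>strip_homeomorphism_signs\<close> are then recognized
  as the induced ones.\<close>

lemma equivalence_on_strip:
  assumes l: "l \<in> Lam A"
  shows "nu l \<in> Lam B" "h ` ({l} \<times> strip A l) = {nu l} \<times> strip B (nu l)" "dl l \<in> {-1, 1}" "tu l \<in> {-1, 1}"
    "\<And>w. w \<in> Sint A \<Longrightarrow> fst w = l \<Longrightarrow> h w \<in> Sint B"
    "\<And>s x. s \<in> {-1, 1} \<Longrightarrow> x \<in> btrace s (strip A l) \<Longrightarrow>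
      fst (h (l, (x, side s (strip A l)))) = nu l \<and> snd (snd (h (l, (x, side s (strip A l))))) = side (tu l * s) (strip B (nu l))"
    "\<And>s x x'. s \<in> {-1, 1} \<Longrightarrow> x \<in> btrace s (strip A l) \<Longrightarrow> x' \<in> btrace s (strip A l) \<Longrightarrow> x < x' \<Longrightarrow>
      dl l * xc (h (l, (x, side s (strip A l)))) < dl l * xc (h (l, (x', side s (strip A l))))"
proof -
  obtain g where hg: "homeomorphic_maps (S0top A) (S0top B) h g"
    using h_homeo by (auto simp: homeomorphic_map_maps)
  obtain m where m: "m \<in> Lam B" "h ` ({l} \<times> strip A l) = {m} \<times> strip B m"
    "homeomorphism (strip A l) (strip B m) (\<lambda>p. snd (h (l, p))) (\<lambda>p. snd (g (m, p)))"
    using homeo_strips[OF hg l] by blast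
  have S: "is_strip (strip A l)" and S': "is_strip (strip B m)" using A.strip_in[OF l] B.strip_in[OF m(1)] .
  have nu: "nu l = m" using induced_nu_eq[OF m(1,2) strip_nonempty[OF S']] .
  have hl: "h (l, p) = (m, snd (h (l, p)))" if "p \<in> strip A l" for p
  proof -
    have "h (l, p) \<in> {m} \<times> strip B m" using that m(2) by blast
    then show ?thesis by auto
  qed
  have leaf: "(\<lambda>p. snd (h (l, p))) ` L \<in> strip_leaves (strip B m)" if L: "L \<in> strip_leaves (strip A l)" for L
  proof -
    have LS: "{l} \<times> L \<in> S0_leaves A" using L l by (auto simp: S0_leaves_def)
    have Lsub: "L \<subseteq> strip A l \<and> L \<noteq> {}"
    proof (cases "L \<in> bdry_intervals (strip A l)")
      case True
      then obtain s where "L \<in> components (bd s (strip A l))" by (auto simp: bdry_intervals_def)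
      then show ?thesis using in_components_subset[of L] in_components_nonempty[of L] by (auto simp: bd_def split: if_splits)
    next
      case False
      then show ?thesis using L mem_strip_iff[OF S] by (auto simp: strip_leaves_def)
    qed
    have "h ` ({l} \<times> L) \<in> S0_leaves B" by (rule h_leaf[OF LS])
    then obtain m' L' where L': "L' \<in> strip_leaves (strip B m')" "h ` ({l} \<times> L) = {m'} \<times> L'" by (auto simp: S0_leaves_def)
    obtain z where z: "z \<in> L" using Lsub by blast
    then have "h (l, z) \<in> {m'} \<times> L'" using L'(2) by blast
    then have mm: "m' = m" using hl[of z] z Lsub by auto
    have "(\<lambda>p. snd (h (l, p))) ` L = snd ` h ` ({l} \<times> L)" by (auto simp: image_image image_iff)
    also have "\<dots> = L'" using L'(2) by auto
    finally show ?thesis using L'(1) mm by simp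
  qed
  have leaf': "\<forall>L\<in>strip_leaves (strip A l). (\<lambda>p. snd (h (l, p))) ` L \<in> strip_leaves (strip B m)" using leaf by blast
  obtain dd tt :: int where signs: "dd \<in> {-1, 1}" "tt \<in> {-1, 1}"
    "\<forall>a b y. strip_lo (strip A l) < y \<longrightarrow> y < strip_hi (strip A l) \<longrightarrow> a < b \<longrightarrow>
      dd * fst (snd (h (l, (a, y)))) < dd * fst (snd (h (l, (b, y))))"
    "\<forall>p\<in>strip A l. \<forall>p'\<in>strip A l. snd p < snd p' \<longrightarrow> tt * snd (snd (h (l, p))) < tt * snd (snd (h (l, p')))"
    "\<forall>s\<in>{-1, 1}. \<forall>x\<in>btrace s (strip A l). snd (snd (h (l, (x, side s (strip A l))))) = side (tt * s) (strip B m)"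
    "\<forall>s\<in>{-1, 1}. \<forall>x\<in>btrace s (strip A l). \<forall>x'\<in>btrace s (strip A l). x < x' \<longrightarrow>
      dd * fst (snd (h (l, (x, side s (strip A l))))) < dd * fst (snd (h (l, (x', side s (strip A l)))))"
    using strip_homeomorphism_signs[OF S S' m(3) leaf'] by (elim exE conjE) (rule that; assumption)
  have dl: "dl l = dd" by (rule induced_delta_eq[OF S signs(1)]) (use signs(3) in \<open>simp add: xc_def\<close>)
  have tu: "tu l = tt" by (rule induced_tau_eq[OF S signs(2)]) (use signs(4) in simp)
  show "nu l \<in> Lam B" "h ` ({l} \<times> strip A l) = {nu l} \<times> strip B (nu l)" "dl l \<in> {-1, 1}" "tu l \<in> {-1, 1}"
    using m nu dl tu signs by auto
  show "h w \<in> Sint B" if w: "w \<in> Sint A" "fst w = l" for w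
  proof -
    obtain p where p: "w = (l, p)" "p \<in> sint (strip A l)" using w by (auto simp: Sint_def sint_def)
    then have "snd (h w) \<in> sint (strip B m)" using homeomorphism_sint[OF S S' m(3)] by blast
    moreover have "fst (h w) = m" using hl[of p] p sint_subset[OF S] by (metis fst_conv subsetD)
    ultimately show ?thesis using m(1) unfolding Sint_def sint_def
      by (cases "h w") auto
  qed
  show "fst (h (l, (x, side s (strip A l)))) = nu l \<and> snd (snd (h (l, (x, side s (strip A l))))) = side (tu l * s) (strip B (nu l))"
    if "s \<in> {-1, 1}" "x \<in> btrace s (strip A l)" for s x
  proof
    show "fst (h (l, (x, side s (strip A l)))) = nu l"
      using hl[of "(x, side s (strip A l))"] that(2) nu by (metis btrace_def fst_conv mem_Collect_eq)
    show "snd (snd (h (l, (x, side s (strip A l))))) = side (tu l * s) (strip B (nu l))"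
      using signs(5) that nu tu by auto
  qed
  show "dl l * xc (h (l, (x, side s (strip A l)))) < dl l * xc (h (l, (x', side s (strip A l))))"
    if "s \<in> {-1, 1}" "x \<in> btrace s (strip A l)" "x' \<in> btrace s (strip A l)" "x < x'" for s x x'
    using signs(6) that dl unfolding xc_def by blast
qed

lemma h_Sint: "w \<in> Sint A \<Longrightarrow> h w \<in> Sint B"
  using equivalence_on_strip(5)[of "fst w" w] by (auto simp: Sint_def)

text \<open>The image is some leaf of \<open>B\<close>, and one point tells which kind: its height
  is a bound of the target strip, so the leaf is no interior line, and strip and side are those of
  the point.\<close>

lemma h_half_edge:
  assumes l: "l \<in> Lam A" and s: "s \<in> {-1, 1}" and P: "P \<in> d A s l"
  shows "h ` P \<in> d B (tu l * s) (nu l)"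
proof -
  have PH: "P \<in> H A" using A.d_subset_H[OF l s] P by blast
  obtain B0 where B0: "B0 \<in> components (bd s (strip A l))" "P = {l} \<times> B0" using P by (auto simp: d_def)
  obtain I where I: "I \<noteq> {}" "I \<subseteq> btrace s (strip A l)" "B0 = I \<times> {side s (strip A l)}"
    using bd_component_interval[OF A.strip_in[OF l] B0(1)] by blast
  obtain x where x: "x \<in> I" using I(1) by blast
  let ?p = "(l, (x, side s (strip A l)))"
  have hp: "h ?p \<in> h ` P" using x I B0 by auto
  have ts: "tu l * s \<in> {-1, 1}" using equivalence_on_strip(4)[OF l] s by auto
  have hpv: "fst (h ?p) = nu l" "snd (snd (h ?p)) = side (tu l * s) (strip B (nu l))"
    using equivalence_on_strip(6)[OF l s, of x] x I(2) by auto
  have "h ` P \<in> S0_leaves B" using h_leaf A.H_subset_leaves PH by blast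
  then show ?thesis
  proof (cases rule: B.S0_leaf_cases)
    case (1 m t)
    then have "h ?p \<in> {m} \<times> (UNIV \<times> {t})" using hp by simp
    then have "m = nu l" "t = side (tu l * s) (strip B (nu l))" using hpv by auto
    then show ?thesis using 1 by (auto simp: side_def split: if_splits)
  next
    case 2
    then obtain m r J where Q: "m \<in> Lam B" "r \<in> {-1, 1}" "h ` P \<in> d B r m" "h ` P = {m} \<times> (J \<times> {side r (strip B m)})"
      by (rule B.half_edge_cases)
    then have "h ?p \<in> {m} \<times> (J \<times> {side r (strip B m)})" using hp by simp
    then have "m = nu l" "side r (strip B m) = side (tu l * s) (strip B (nu l))" using hpv by auto
    then show ?thesis using Q B.side_eq_iff[OF Q(1,2) ts] by auto
  qed
qed

lemma h_half_edge_in_H: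
  assumes P: "P \<in> H A" shows "h ` P \<in> H B"
proof -
  obtain l s where ls: "l \<in> Lam A" "s \<in> {-1, 1}" "P \<in> d A s l" using P by (rule A.half_edge_cases)
  have "tu l * s \<in> {-1, 1}" using equivalence_on_strip(4)[OF ls(1)] ls(2) by auto
  then show ?thesis using h_half_edge[OF ls] B.d_subset_H[OF equivalence_on_strip(1)[OF ls(1)]] by blast
qed

text \<open>The leaf that is mapped onto \<open>Q\<close> is not an interior line, because
  \<open>h\<close> sends interior points to interior points.\<close>

lemma h_half_edge_onto:
  assumes Q: "Q \<in> H B" shows "\<exists>P\<in>H A. h ` P = Q"
proof -
  obtain L where L: "L \<in> S0_leaves A" "h ` L = Q" using h_leaf_onto B.H_subset_leaves Q by blast
  from L(1) show ?thesis
  proof (cases rule: A.S0_leaf_cases)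
    case (1 l t)
    then have "(l, (0, t)) \<in> L" "(l, (0, t)) \<in> Sint A" by (auto simp: Sint_def)
    then have "h (l, (0, t)) \<in> Q \<inter> Sint B" using h_Sint L(2) by blast
    then show ?thesis using B.half_edge_subset[OF Q] by blast
  next
    case 2
    then show ?thesis using L by blast
  qed
qed

lemma h_order:
  assumes l: "l \<in> Lam A" and s: "s \<in> {-1, 1}" and P: "P \<in> d A s l" "Q \<in> d A s l" and ab: "a \<in> P" "b \<in> Q" "xc a < xc b"
  shows "dl l * xc (h a) < dl l * xc (h b)"
proof -
  have "\<exists>x\<in>btrace s (strip A l). c = (l, (x, side s (strip A l)))" if R: "R \<in> d A s l" "c \<in> R" for R c
  proof -
    obtain C where C: "C \<in> components (bd s (strip A l))" "R = {l} \<times> C" using R by (auto simp: d_def)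
    then show ?thesis using in_components_subset[OF C(1)] R(2) by (auto simp: bd_eq_btrace)
  qed
  then obtain x x' where x: "x \<in> btrace s (strip A l)" "a = (l, (x, side s (strip A l)))"
    "x' \<in> btrace s (strip A l)" "b = (l, (x', side s (strip A l)))" using P ab by metis
  then have "x < x'" using ab(3) by (simp add: xc_def)
  then show ?thesis using equivalence_on_strip(7)[OF l s x(1,3)] x by simp
qed

lemma nu_bij: "bij_betw nu (Lam A) (Lam B)"
proof (rule bij_betwI')
  fix l l' assume l: "l \<in> Lam A" "l' \<in> Lam A"
  show "nu l = nu l' \<longleftrightarrow> l = l'"
  proof
    assume nn: "nu l = nu l'"
    obtain p where p: "p \<in> strip A l" using strip_nonempty[OF A.strip_in[OF l(1)]] by blast
    then have "h (l, p) \<in> h ` ({l'} \<times> strip A l')" using equivalence_on_strip(2)[OF l(1)] equivalence_on_strip(2)[OF l(2)] nn by auto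
    then obtain p' where "p' \<in> strip A l'" "h (l, p) = h (l', p')" by auto
    then show "l = l'" using h_inj p l by (auto simp: inj_on_def S0_def)
  qed simp
next
  show "nu l \<in> Lam B" if "l \<in> Lam A" for l using equivalence_on_strip(1)[OF that] .
next
  fix m assume m: "m \<in> Lam B"
  obtain p where p: "p \<in> strip B m" using strip_nonempty[OF B.strip_in[OF m]] by blast
  then have "(m, p) \<in> h ` S0 A" using h_image m by (auto simp: S0_def)
  then obtain l p' where l: "l \<in> Lam A" "p' \<in> strip A l" "h (l, p') = (m, p)" by (auto simp: S0_def)
  then have "(m, p) \<in> {nu l} \<times> strip B (nu l)" using equivalence_on_strip(2)[OF l(1)] by (metis SigmaI imageI insertI1)
  then show "\<exists>l\<in>Lam A. m = nu l" using l(1) by auto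
qed

theorem equivalence_induces_graph_iso: "is_graph_iso A B nu (\<lambda>P. h ` P) dl tu"
  unfolding is_graph_iso_def
proof (intro conjI ballI impI)
  show "bij_betw nu (Lam A) (Lam B)" by (rule nu_bij)
  have "inj_on ((`) h) (H A)"
  proof (rule inj_onI)
    fix P Q assume "P \<in> H A" "Q \<in> H A" "h ` P = h ` Q"
    then show "P = Q" using inj_on_image_eq_iff[OF h_inj, of P Q] A.half_edge_subset by blast
  qed
  moreover have "(`) h ` H A = H B" using h_half_edge_in_H h_half_edge_onto by (auto simp: image_iff) metis
  ultimately show "bij_betw ((`) h) (H A) (H B)" by (simp add: bij_betw_def)
  fix l assume l: "l \<in> Lam A"
  show "dl l \<in> {-1, 1}" "tu l \<in> {-1, 1}" using equivalence_on_strip(3,4)[OF l] .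
  fix s :: int assume s: "s \<in> {-1, 1}"
  show "(`) h ` d A s l = d B (tu l * s) (nu l)"
  proof
    show "(`) h ` d A s l \<subseteq> d B (tu l * s) (nu l)" using h_half_edge[OF l s] by auto
    show "d B (tu l * s) (nu l) \<subseteq> (`) h ` d A s l"
    proof
      fix Q assume Q: "Q \<in> d B (tu l * s) (nu l)"
      have ts: "tu l * s \<in> {-1, 1}" using equivalence_on_strip(4)[OF l] s by auto
      then have "Q \<in> H B" using Q B.d_subset_H[OF equivalence_on_strip(1)[OF l]] by blast
      then obtain P where P: "P \<in> H A" "h ` P = Q" using h_half_edge_onto by blast
      obtain l' s' where ls: "l' \<in> Lam A" "s' \<in> {-1, 1}" "P \<in> d A s' l'" using P(1) by (rule A.half_edge_cases)
      have ts': "tu l' * s' \<in> {-1, 1}" using equivalence_on_strip(4)[OF ls(1)] ls(2) by auto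
      have "Q \<in> d B (tu l' * s') (nu l')" using h_half_edge[OF ls] P(2) by simp
      \<comment> \<open>The preimage half-edge might belong to another strip or side; since
        \<open>Q\<close> determines its own, injectivity of \<open>nu\<close> and invertibility of
        the sign bring both back to \<open>l\<close> and \<open>s\<close>.\<close>
      from B.d_unique[OF Q this equivalence_on_strip(1)[OF l] equivalence_on_strip(1)[OF ls(1)] ts ts']
      have "nu l = nu l'" "tu l * s = tu l' * s'" by auto
      then have "l = l'" using nu_bij l ls(1) by (auto simp: bij_betw_def inj_on_def)
      moreover from this have "s = s'" using \<open>tu l * s = tu l' * s'\<close> equivalence_on_strip(4)[OF l] by auto
      ultimately show "Q \<in> (`) h ` d A s l" using ls P by blast
    qed
  qed
  fix P Q assume PQ: "P \<in> d A s l" "Q \<in> d A s l" "hlt P Q"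
  show "hlt (h ` P) (h ` Q)" if "dl l = 1"
    using h_order[OF l s PQ(1,2)] PQ(3) that by (auto simp: hlt_def)
  show "hlt (h ` Q) (h ` P)" if "dl l = -1"
    using h_order[OF l s PQ(1,2)] PQ(3) that by (auto simp: hlt_def)
next
  have mate: "h (mate A p) = mate B (h p)" if "p \<in> S0 A" for p by (rule equivalence_commutes_mate[OF eq that])
  fix P assume P: "P \<in> H A"
  show xi: "xi B (h ` P) = h ` xi A P"
  proof -
    have "xi B (h ` P) = mate B ` h ` P" using B.mate_image[OF h_half_edge_in_H[OF P]] by simp
    also have "\<dots> = h ` mate A ` P" using mate A.half_edge_subset[OF P] by (force simp: image_image)
    finally show ?thesis using A.mate_image[OF P] by simp
  qed
  assume ne: "xi A P \<noteq> P"
  fix l m assume l: "l \<in> Lam A" and m: "m \<in> Lam A" and Pl: "P \<in> dall A l" and Qm: "xi A P \<in> dall A m"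
  have gA: "A.glued P (xi A P)" using A.xi_neq_glued[OF ne] .
  have "h ` xi A P \<noteq> h ` P"
    using ne inj_on_image_eq_iff[OF h_inj, of P "xi A P"] A.half_edge_subset[OF P] A.half_edge_subset[OF A.xi_in_H[OF P]] by blast
  then have gB: "B.glued (h ` P) (h ` xi A P)" using B.xi_neq_glued[of "h ` P"] xi by simp
  obtain s where s: "s \<in> {-1, 1}" "P \<in> d A s l" using Pl by (auto simp: dall_def)
  obtain r where r: "r \<in> {-1, 1}" "xi A P \<in> d A r m" using Qm by (auto simp: dall_def)
  obtain I y where I: "open I" "I \<noteq> {}" "P = {l} \<times> (I \<times> {y})"
    using bd_component_interval[OF A.strip_in[OF l]] s(2) unfolding d_def by blast
  \<comment> \<open>One pair of distinct points is enough to detect the sign of a monotone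
    map.\<close>
  obtain x x' where x: "x \<in> I" "x' \<in> I" "x < x'"
  proof -
    obtain x where x: "x \<in> I" using I(2) by blast
    then obtain e where "e > 0" "ball x e \<subseteq> I" using I(1) by (auto simp: open_contains_ball)
    then have "x + e / 2 \<in> I" by (auto simp: dist_real_def subset_iff)
    then show ?thesis using that[OF x] \<open>e > 0\<close> by auto
  qed
  define a b where "a = (l, (x, y))" "b = (l, (x', y))"
  have ab: "a \<in> P" "b \<in> P" "xc a < xc b" using x I by (auto simp: a_b_def xc_def)
  have S: "a \<in> S0 A" "b \<in> S0 A" using ab A.half_edge_subset[OF P] by auto
  let ?s = "sigma A P (xi A P)" and ?t = "sigma B (h ` P) (h ` xi A P)"
  have mm: "mate A a \<in> xi A P" "mate A b \<in> xi A P" using ab A.mate_glued(1)[OF gA] by auto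
  have 1: "?s * xc (mate A a) < ?s * xc (mate A b)" using A.mate_monotone(2)[OF gA ab] .
  have sg: "?s \<in> {-1, 1}" "?t \<in> {-1, 1}" using A.mate_monotone(1)[OF gA] B.mate_monotone(1)[OF gB] .
  have dls: "dl l \<in> {-1, 1}" "dl m \<in> {-1, 1}" using equivalence_on_strip(3) l m by auto
  \<comment> \<open>From \<open>P\<close> to the image of \<open>xi A P\<close> there are two
    routes, \<open>h\<close> after \<open>mate\<close> and \<open>mate\<close> after
    \<open>h\<close>. They agree, so their signs \<open>?s * dl m\<close> and
    \<open>dl l * ?t\<close> are equal.\<close>
  have 2: "?s * dl m * xc (h (mate A a)) < ?s * dl m * xc (h (mate A b))"
    using 1 sg(1) h_order[OF m r(1) r(2) r(2) mm] h_order[OF m r(1) r(2) r(2) mm(2,1)] by auto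
  have 3: "dl l * xc (h a) < dl l * xc (h b)" using h_order[OF l s(1) s(2) s(2) ab] .
  have hab: "h a \<in> h ` P" "h b \<in> h ` P" using ab by auto
  have 4: "dl l * ?t * xc (mate B (h a)) < dl l * ?t * xc (mate B (h b))"
    using 3 dls(1) B.mate_monotone(2)[OF gB hab] B.mate_monotone(2)[OF gB hab(2,1)] by auto
  show "dl l * ?s = ?t * dl m"
    using 2 4 sg dls mate[OF S(1)] mate[OF S(2)] by auto
qed

end

end

section \<open>The equivalence realizing a graph isomorphism\<close>

lemma open_unbounded_below_reparametrization:
  fixes I :: "real set"
  assumes I: "open I" "I \<noteq> {}"
  shows "\<exists>L. strict_mono_on I L \<and> continuous_on I L \<and> (\<forall>y. \<exists>x\<in>I. L x \<le> (y::real))"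
proof (cases "bdd_below I")
  case False
  then have "\<forall>y. \<exists>x\<in>I. x \<le> y" by (meson bdd_below.I linear)
  then show ?thesis by (intro exI[of _ "\<lambda>x. x"]) (auto simp: strict_mono_on_def)
next
  case True
  define a where "a = Inf I"
  have a: "a < x" if x: "x \<in> I" for x
  proof -
    obtain e where e: "e > 0" "ball x e \<subseteq> I" using I(1) x by (auto simp: open_contains_ball)
    then have "x - e / 2 \<in> I" by (auto simp: dist_real_def subset_iff)
    then have "a \<le> x - e / 2" unfolding a_def using True by (intro cInf_lower)
    then show ?thesis using e(1) by simp
  qed
  \<comment> \<open>The infimum \<open>a\<close> is not attained because \<open>I\<close> is open,
    and this function tends to minus infinity there; in the unbounded case the identity
    serves.\<close>
  define L where "L x = - (1 / (x - a))" for x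
  have "strict_mono_on I L"
    using a by (auto simp: strict_mono_on_def L_def intro!: divide_strict_left_mono mult_pos_pos)
  moreover have "continuous_on I L"
    unfolding L_def by (intro continuous_intros) (use a in force)
  moreover have "\<exists>x\<in>I. L x \<le> y" for y
  proof -
    define M where "M = max 1 (- y)"
    have M: "M > 0" "- M \<le> y" by (auto simp: M_def)
    have "Inf I < a + 1 / M" using M by (simp add: a_def)
    then obtain x where x: "x \<in> I" "x < a + 1 / M" using cInf_lessD[OF I(2)] by blast
    have "0 < x - a" "x - a < 1 / M" using a[OF x(1)] x(2) by auto
    then have "M \<le> 1 / (x - a)" using M by (simp add: field_simps)
    then show ?thesis using x(1) M(2) by (auto simp: L_def intro!: bexI[of _ x])
  qed
  ultimately show ?thesis by blast
qed

text \<open>Bounded and unbounded intervals are treated alike: \<open>L\<close> is unbounded below,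
  its reflected counterpart \<open>U\<close> is unbounded above, and the sum of the two is
  continuous, increasing and unbounded in both directions.\<close>

lemma open_interval_order_iso_real:
  fixes I :: "real set"
  assumes I: "open I" "connected I" "I \<noteq> {}"
  shows "\<exists>g :: real \<Rightarrow> real. strict_mono_on I g \<and> g ` I = UNIV"
proof -
  obtain L :: "real \<Rightarrow> real" where L: "strict_mono_on I L" "continuous_on I L" "\<And>y. \<exists>x\<in>I. L x \<le> y"
    using open_unbounded_below_reparametrization[OF I(1,3)] by blast
  have "open (uminus ` I)" "uminus ` I \<noteq> {}" using I by (auto intro: open_negations)
  then obtain V :: "real \<Rightarrow> real" where V: "strict_mono_on (uminus ` I) V" "continuous_on (uminus ` I) V" "\<And>y. \<exists>x\<in>uminus ` I. V x \<le> y"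
    using open_unbounded_below_reparametrization by blast
  define U where "U x = - V (- x)" for x
  have U: "strict_mono_on I U" "continuous_on I U" "\<exists>x\<in>I. y \<le> U x" for y
  proof -
    show "strict_mono_on I U" using V(1) by (auto simp: strict_mono_on_def U_def)
    show "continuous_on I U" unfolding U_def by (intro continuous_intros continuous_on_compose2[OF V(2)]) auto
    obtain x where "x \<in> I" "V (- x) \<le> - y" using V(3)[of "- y"] by auto
    then show "\<exists>x\<in>I. y \<le> U x" by (intro bexI[of _ x]) (auto simp: U_def)
  qed
  obtain x0 where x0: "x0 \<in> I" using I(3) by blast
  define g where "g x = L x + U x" for x
  have mono: "strict_mono_on I g" using L(1) U(1) by (auto simp: strict_mono_on_def g_def intro: add_strict_mono)
  have "y \<in> g ` I" for y
  proof -
    \<comment> \<open>The bound by \<open>L x0\<close> puts \<open>x1\<close> to the left of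
      \<open>x0\<close>, so that \<open>U x1 \<le> U x0\<close>; the other bound then pushes the sum
      below \<open>y\<close>.\<close>
    obtain x1 where x1: "x1 \<in> I" "L x1 \<le> min (y - U x0) (L x0)" using L(3) by blast
    have "x1 \<le> x0" using strict_mono_onD[OF L(1) x0 x1(1)] x1(2) by (cases "x0 < x1") auto
    then have "U x1 \<le> U x0" using strict_mono_onD[OF U(1) x1(1) x0] by (cases "x1 = x0") auto
    then have lo: "g x1 \<le> y" using x1(2) by (simp add: g_def)
    obtain x2 where x2: "x2 \<in> I" "max (y - L x0) (U x0) \<le> U x2" using U(3) by blast
    have "x0 \<le> x2" using strict_mono_onD[OF U(1) x2(1) x0] x2(2) by (cases "x2 < x0") auto
    then have "L x0 \<le> L x2" using strict_mono_onD[OF L(1) x0 x2(1)] by (cases "x2 = x0") auto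
    then have hi: "y \<le> g x2" using x2(2) by (simp add: g_def)
    have "connected (g ` I)"
      unfolding g_def by (intro connected_continuous_image continuous_intros L U I)
    then show ?thesis using connectedD_interval[of "g ` I" "g x1" "g x2" y] lo hi x1(1) x2(1) by auto
  qed
  then show ?thesis using mono by blast
qed

text \<open>Pass through the whole line, where multiplication by \<open>dl\<close> preserves or
  reverses the order as required.\<close>

lemma interval_order_iso:
  fixes I J :: "real set" and dl :: int
  assumes I: "open I" "connected I" "I \<noteq> {}" and J: "open J" "connected J" "J \<noteq> {}" and dl: "dl \<in> {-1, 1}"
  shows "\<exists>f :: real \<Rightarrow> real. f ` I = J \<and> (\<forall>x\<in>I. \<forall>x'\<in>I. x < x' \<longrightarrow> dl * f x < dl * f x')"
proof -
  obtain g :: "real \<Rightarrow> real" where g: "strict_mono_on I g" "g ` I = UNIV" using open_interval_order_iso_real[OF I] by blast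
  obtain k :: "real \<Rightarrow> real" where k: "strict_mono_on J k" "k ` J = UNIV" using open_interval_order_iso_real[OF J] by blast
  define f where "f x = inv_into J k (dl * g x)" for x
  have f: "f x \<in> J" "k (f x) = dl * g x" for x
    using k(2) by (auto simp: f_def inv_into_into f_inv_into_f)
  have dd: "real_of_int dl * (real_of_int dl * x) = x" for x using dl by auto
  have "y \<in> f ` I" if y: "y \<in> J" for y
  proof -
    obtain x where x: "x \<in> I" "g x = dl * k y" using g(2) by (metis UNIV_I imageE)
    then have "k (f x) = k y" using f(2)[of x] dd by simp
    then have "f x = y" using strict_mono_on_imp_inj_on[OF k(1)] f(1) y by (auto simp: inj_on_def)
    then show ?thesis using x(1) by blast
  qed
  then have "f ` I = J" using f(1) by blast
  moreover have "dl * f x < dl * f x'" if x: "x \<in> I" "x' \<in> I" "x < x'" for x x'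
  proof -
    have less: "z < z' \<longleftrightarrow> k z < k z'" if "z \<in> J" "z' \<in> J" for z z'
      using strict_mono_onD[OF k(1), of z z'] strict_mono_onD[OF k(1), of z' z] that by (cases z z' rule: linorder_cases) auto
    have "g x < g x'" using strict_mono_onD[OF g(1)] x by blast
    then show ?thesis using dl less[OF f(1) f(1), of x x'] less[OF f(1) f(1), of x' x] f(2) by auto
  qed
  ultimately show ?thesis by blast
qed

lemma sigma_commute: "sigma A P Q = sigma A Q P"
proof -
  have "(\<lambda>g. g \<in> Gam A \<and> ((P = Xg A g \<and> Q = Yg A g) \<or> (P = Yg A g \<and> Q = Xg A g))) =
    (\<lambda>g. g \<in> Gam A \<and> ((Q = Xg A g \<and> P = Yg A g) \<or> (Q = Yg A g \<and> P = Xg A g)))" by auto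
  then show ?thesis unfolding sigma_def by (simp only:)
qed

context striped
begin

lemma d_point:
  assumes "P \<in> d A s l" "p \<in> P"
  shows "p = (l, (xc p, side s (strip A l)))" "xc p \<in> btrace s (strip A l)"
proof -
  obtain C where C: "C \<in> components (bd s (strip A l))" "P = {l} \<times> C" using assms by (auto simp: d_def)
  then show "p = (l, (xc p, side s (strip A l)))" "xc p \<in> btrace s (strip A l)"
    using in_components_subset[OF C(1)] assms(2) by (auto simp: bd_eq_btrace xc_def)
qed

lemma d_cover:
  assumes "x \<in> btrace s (strip A l)" obtains P where "P \<in> d A s l" "(l, (x, side s (strip A l))) \<in> P"
proof -
  have "(x, side s (strip A l)) \<in> bd s (strip A l)" using assms by (simp add: bd_eq_btrace)
  then obtain C where "C \<in> components (bd s (strip A l))" "(x, side s (strip A l)) \<in> C" using Union_components by blast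
  then show ?thesis using that[of "{l} \<times> C"] by (auto simp: d_def)
qed

text \<open>Distinct half-edges on one side are disjoint intervals. A second pair of points in the
  opposite order would force a point of one interval into the other, so a single pair fixes the
  order of the half-edges.\<close>

lemma d_trichotomy:
  assumes l: "l \<in> Lam A" and s: "s \<in> {-1, 1}" and P: "P \<in> d A s l" and Q: "Q \<in> d A s l"
    and a: "a \<in> P" and b: "b \<in> Q" and ab: "xc a < xc b" and ne: "P \<noteq> Q"
  shows "hlt P Q"
proof -
  obtain C where C: "C \<in> components (bd s (strip A l))" "P = {l} \<times> C" using P by (auto simp: d_def)
  obtain I where I: "connected I" "C = I \<times> {side s (strip A l)}" using bd_component_interval[OF strip_in[OF l] C(1)] by blast
  obtain D where D: "D \<in> components (bd s (strip A l))" "Q = {l} \<times> D" using Q by (auto simp: d_def)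
  obtain J where J: "connected J" "D = J \<times> {side s (strip A l)}" using bd_component_interval[OF strip_in[OF l] D(1)] by blast
  have disj: "I \<inter> J = {}"
  proof (rule ccontr)
    assume "I \<inter> J \<noteq> {}"
    then obtain x where "x \<in> I" "x \<in> J" by blast
    then have "(l, (x, side s (strip A l))) \<in> P \<inter> Q" using C D I J by auto
    then show False using half_edges_disjoint d_subset_H[OF l s] P Q ne by blast
  qed
  have mem: "xc a \<in> I" "xc b \<in> J" using a b C D I J by (auto simp: xc_def)
  show ?thesis
    unfolding hlt_def
  proof (intro ballI)
    fix p q assume pq: "p \<in> P" "q \<in> Q"
    then have m2: "xc p \<in> I" "xc q \<in> J" using C D I J by (auto simp: xc_def)
    show "xc p < xc q"
    proof (rule ccontr)
      assume "\<not> xc p < xc q"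
      then have le: "xc q \<le> xc p" by simp
      show False
      proof (cases "xc a \<le> xc q")
        case True
        then show False using connectedD_interval[OF I(1) mem(1) m2(1) True le] m2(2) disj by blast
      next
        case False
        then have "xc q \<le> xc a" "xc a \<le> xc b" using ab by auto
        then show False using connectedD_interval[OF J(1) m2(2) mem(2)] mem(1) disj by blast
      qed
    qed
  qed
qed

end

section \<open>Building a boundary map and an equivalence from a graph isomorphism\<close>

context striped_pair
begin

context
  fixes nu :: "'i \<Rightarrow> 'j" and eta and delta tau :: "'i \<Rightarrow> int"
  assumes iso: "is_graph_iso A B nu eta delta tau"
begin

lemma iso_nu: "bij_betw nu (Lam A) (Lam B)"
  and iso_eta: "bij_betw eta (H A) (H B)"
  and iso_signs: "l \<in> Lam A \<Longrightarrow> delta l \<in> {-1, 1} \<and> tau l \<in> {-1, 1}"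
  and iso_d: "l \<in> Lam A \<Longrightarrow> s \<in> {-1, 1} \<Longrightarrow> eta ` d A s l = d B (tau l * s) (nu l)"
  and iso_order: "l \<in> Lam A \<Longrightarrow> s \<in> {-1, 1} \<Longrightarrow> P \<in> d A s l \<Longrightarrow> Q \<in> d A s l \<Longrightarrow> hlt P Q \<Longrightarrow>
    (delta l = 1 \<longrightarrow> hlt (eta P) (eta Q)) \<and> (delta l = -1 \<longrightarrow> hlt (eta Q) (eta P))"
  and iso_xi: "P \<in> H A \<Longrightarrow> xi B (eta P) = eta (xi A P)"
  and iso_sigma: "P \<in> H A \<Longrightarrow> xi A P \<noteq> P \<Longrightarrow> l \<in> Lam A \<Longrightarrow> m \<in> Lam A \<Longrightarrow> P \<in> dall A l \<Longrightarrow> xi A P \<in> dall A m \<Longrightarrow>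
    delta l * sigma A P (xi A P) = sigma B (eta P) (eta (xi A P)) * delta m"
proof -
  note c1 = iso[unfolded is_graph_iso_def]
  note c2 = conjunct2[OF c1]
  note c3 = conjunct2[OF c2]
  note c4 = conjunct2[OF c3]
  note c5 = conjunct2[OF c4]
  note c6 = conjunct2[OF c5]
  show "bij_betw nu (Lam A) (Lam B)" by (rule conjunct1[OF c1])
  show "bij_betw eta (H A) (H B)" by (rule conjunct1[OF c2])
  show "l \<in> Lam A \<Longrightarrow> delta l \<in> {-1, 1} \<and> tau l \<in> {-1, 1}" using conjunct1[OF c3] by blast
  show "l \<in> Lam A \<Longrightarrow> s \<in> {-1, 1} \<Longrightarrow> eta ` d A s l = d B (tau l * s) (nu l)" using conjunct1[OF c4] by blast
  show "l \<in> Lam A \<Longrightarrow> s \<in> {-1, 1} \<Longrightarrow> P \<in> d A s l \<Longrightarrow> Q \<in> d A s l \<Longrightarrow> hlt P Q \<Longrightarrow>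
    (delta l = 1 \<longrightarrow> hlt (eta P) (eta Q)) \<and> (delta l = -1 \<longrightarrow> hlt (eta Q) (eta P))"
    using conjunct1[OF c4] by blast
  show "P \<in> H A \<Longrightarrow> xi B (eta P) = eta (xi A P)" using conjunct1[OF c5] by blast
  show "P \<in> H A \<Longrightarrow> xi A P \<noteq> P \<Longrightarrow> l \<in> Lam A \<Longrightarrow> m \<in> Lam A \<Longrightarrow> P \<in> dall A l \<Longrightarrow> xi A P \<in> dall A m \<Longrightarrow>
    delta l * sigma A P (xi A P) = sigma B (eta P) (eta (xi A P)) * delta m" using c6 by blast
qed

lemma iso_nu_in: "l \<in> Lam A \<Longrightarrow> nu l \<in> Lam B"
  using iso_nu by (auto simp: bij_betw_def)

lemma iso_eta_in: "P \<in> H A \<Longrightarrow> eta P \<in> H B"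
  using iso_eta by (auto simp: bij_betw_def)

definition signed_iso :: "'i \<Rightarrow> ('i \<times> (real \<times> real)) set \<Rightarrow> ('i \<times> (real \<times> real) \<Rightarrow> 'j \<times> (real \<times> real)) \<Rightarrow> bool" where
  "signed_iso l P f \<longleftrightarrow> f ` P = eta P \<and> (\<forall>a\<in>P. \<forall>b\<in>P. xc a < xc b \<longrightarrow> delta l * xc (f a) < delta l * xc (f b))"

lemma dall_cases:
  assumes "P \<in> dall A l" obtains s where "s \<in> {-1, 1}" "P \<in> d A s l"
  using assms by (auto simp: dall_def)

lemma H_dall: "P \<in> H A \<Longrightarrow> \<exists>l\<in>Lam A. P \<in> dall A l"
  by (auto simp: H_def)

lemma dall_H: "l \<in> Lam A \<Longrightarrow> P \<in> dall A l \<Longrightarrow> P \<in> H A"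
  by (auto simp: H_def)

lemma dall_unique: "l \<in> Lam A \<Longrightarrow> l' \<in> Lam A \<Longrightarrow> P \<in> dall A l \<Longrightarrow> P \<in> dall A l' \<Longrightarrow> l = l'"
  by (metis A.d_unique dall_cases)

lemma signed_iso_exists:
  assumes l: "l \<in> Lam A" and P: "P \<in> dall A l" shows "\<exists>f. signed_iso l P f"
proof -
  have PH: "P \<in> H A" using dall_H[OF l P] .
  obtain l' s' I where I: "open I" "connected I" "I \<noteq> {}" "P = {l'} \<times> (I \<times> {side s' (strip A l')})"
    using PH by (rule A.half_edge_cases)
  obtain m r J where J: "open J" "connected J" "J \<noteq> {}" "eta P = {m} \<times> (J \<times> {side r (strip B m)})"
    using iso_eta_in[OF PH] by (rule B.half_edge_cases)
  have "delta l \<in> {-1, 1}" using iso_signs[OF l] by blast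
  then obtain f :: "real \<Rightarrow> real" where f: "f ` I = J" "\<forall>x\<in>I. \<forall>x'\<in>I. x < x' \<longrightarrow> delta l * f x < delta l * f x'"
    using interval_order_iso[OF I(1-3) J(1-3)] by blast
  have "signed_iso l P (\<lambda>p. (m, (f (xc p), side r (strip B m))))"
    unfolding signed_iso_def
  proof (intro conjI ballI impI)
    show "(\<lambda>p. (m, (f (xc p), side r (strip B m)))) ` P = eta P"
    proof -
      have "xc ` P = I" unfolding I(4) by (force simp: xc_def)
      then have "(\<lambda>x. (m, (f x, side r (strip B m)))) ` xc ` P = {m} \<times> (f ` I \<times> {side r (strip B m)})" by auto
      then show ?thesis unfolding J(4) f(1) by (simp add: image_image)
    qed
    show "delta l * xc (m, (f (xc a), side r (strip B m))) < delta l * xc (m, (f (xc b), side r (strip B m)))"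
      if "a \<in> P" "b \<in> P" "xc a < xc b" for a b
      using f(2) that I(4) by (auto simp: xc_def)
  qed
  then show ?thesis by blast
qed

text \<open>Order isomorphisms may be chosen freely on the intervals that are not of the form \<open>Y\<^sub>\<gamma>\<close>; on the latter
  compatibility with the gluing leaves no choice.\<close>

lemma boundary_map_exists:
  "\<exists>b. (\<forall>l\<in>Lam A. \<forall>P\<in>dall A l. signed_iso l P b) \<and> (\<forall>P\<in>H A. \<forall>p\<in>P. b (mate A p) = mate B (b p))"
proof -
  have "\<forall>P\<in>H A. \<exists>f. \<forall>l\<in>Lam A. P \<in> dall A l \<longrightarrow> signed_iso l P f"
    using signed_iso_exists dall_unique H_dall by metis
  then obtain ord where ord: "\<And>P l. P \<in> H A \<Longrightarrow> l \<in> Lam A \<Longrightarrow> P \<in> dall A l \<Longrightarrow> signed_iso l P (ord P)"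
    by metis
  define he where "he p = (THE P. P \<in> H A \<and> p \<in> P)" for p
  have he: "he p = P" if "P \<in> H A" "p \<in> P" for p P
    unfolding he_def using that A.half_edges_disjoint by (intro the_equality) blast+
  define Ys where "Ys = Yg A ` Gam A"
  \<comment> \<open>On a \<open>Y\<close> the value is obtained by crossing to the glued
    \<open>X\<close> with \<open>mate\<close>, applying the isomorphism chosen there, and crossing
    back in \<open>B\<close>.\<close>
  define b where "b p = (if he p \<in> Ys then mate B (ord (xi A (he p)) (mate A p)) else ord (he p) p)" for p
  have b1: "b p = ord P p" if "P \<in> H A" "P \<notin> Ys" "p \<in> P" for p P
    using that he by (simp add: b_def)
  have b2: "b p = mate B (ord (xi A P) (mate A p))" if "P \<in> H A" "P \<in> Ys" "p \<in> P" for p P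
    using that he by (simp add: b_def)
  have Y: "A.glued P (xi A P) \<and> xi A P \<notin> Ys" if PY: "P \<in> Ys" for P
  proof -
    obtain g where g: "g \<in> Gam A" "P = Yg A g" using PY by (auto simp: Ys_def)
    then have gl: "A.glued P (Xg A g)" by (auto simp: A.glued_def)
    moreover have "Xg A g \<notin> Ys" using g(1) A.atlas unfolding is_striped_atlas_def Ys_def by blast
    ultimately show ?thesis using A.xi_glued by simp
  qed
  have nY: "xi A P \<in> Ys" if "P \<notin> Ys" "xi A P \<noteq> P" for P
    using A.xi_neq_glued[OF that(2)] that(1) by (auto simp: A.glued_def Ys_def)
  have ordH: "ord P p \<in> eta P" if "P \<in> H A" "p \<in> P" for P p
    using ord[OF that(1)] H_dall[OF that(1)] that(2) unfolding signed_iso_def by blast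
  have S0B: "z \<in> S0 B" if "z \<in> eta P" "P \<in> H A" for z P
    using B.half_edge_subset[OF iso_eta_in[OF that(2)]] that(1) by blast
  have S0A: "z \<in> S0 A" if "z \<in> P" "P \<in> H A" for z P
    using A.half_edge_subset[OF that(2)] that(1) by blast
  have "signed_iso l P b" if l: "l \<in> Lam A" and P: "P \<in> dall A l" for l P
  proof (cases "P \<in> Ys")
    case False
    have PH: "P \<in> H A" using dall_H[OF l P] .
    have "\<And>p. p \<in> P \<Longrightarrow> b p = ord P p" using b1[OF PH False] .
    then show ?thesis using ord[OF PH l P] by (auto simp: signed_iso_def image_def)
  next
    case True
    have PH: "P \<in> H A" using dall_H[OF l P] .
    let ?X = "xi A P"
    have gA: "A.glued P ?X" using Y[OF True] by blast
    have XH: "?X \<in> H A" using A.xi_in_H[OF PH] .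
    obtain m where m: "m \<in> Lam A" "?X \<in> dall A m" using H_dall[OF XH] by blast
    have xX: "xi A ?X = P" using A.xi_glued[OF A.glued_sym[OF gA]] .
    have o: "signed_iso m ?X (ord ?X)" using ord[OF XH m] .
    have ne: "?X \<noteq> P" using A.gluedD(3)[OF gA] by blast
    have eX: "xi B (eta ?X) = eta P" using iso_xi[OF XH] xX by simp
    have "eta ?X \<noteq> eta P" using iso_eta XH PH ne by (auto simp: bij_betw_def inj_on_def)
    then have gB: "B.glued (eta ?X) (eta P)" using B.xi_neq_glued[of "eta ?X"] eX by simp
    have "b ` P = (mate B \<circ> ord ?X \<circ> mate A) ` P" using b2[OF PH True] by (auto simp: image_def)
    also have "\<dots> = mate B ` ord ?X ` mate A ` P" by (simp add: image_comp)
    also have "\<dots> = eta P"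
      using A.mate_image[OF PH] o B.mate_image[OF iso_eta_in[OF XH]] eX by (simp add: signed_iso_def)
    finally have im: "b ` P = eta P" .
    have "delta l * xc (b p) < delta l * xc (b p')" if pp: "p \<in> P" "p' \<in> P" "xc p < xc p'" for p p'
    proof -
      let ?s = "sigma A P ?X" and ?t = "sigma B (eta ?X) (eta P)"
      have 1: "?s * xc (mate A p) < ?s * xc (mate A p')" using A.mate_monotone(2)[OF gA pp] .
      have sg: "?s \<in> {-1, 1}" "?t \<in> {-1, 1}" using A.mate_monotone(1)[OF gA] B.mate_monotone(1)[OF gB] .
      have dls: "delta l \<in> {-1, 1}" "delta m \<in> {-1, 1}" using iso_signs l m by auto
      have mX: "mate A p \<in> ?X" "mate A p' \<in> ?X" using A.mate_glued(1)[OF gA] pp by auto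
      define u u' where "u = ord ?X (mate A p)" "u' = ord ?X (mate A p')"
      have inc: "xc z < xc z' \<Longrightarrow> delta m * xc (ord ?X z) < delta m * xc (ord ?X z')" if "z \<in> ?X" "z' \<in> ?X" for z z'
        using o that unfolding signed_iso_def by blast
      have 2: "?s * delta m * xc u < ?s * delta m * xc u'"
        unfolding u_u'_def using 1 sg(1) inc[OF mX] inc[OF mX(2,1)] by auto
      have uX: "u \<in> eta ?X" "u' \<in> eta ?X" using ordH[OF XH] mX by (auto simp: u_u'_def)
      have 3: "?s * delta m * ?t * xc (mate B u) < ?s * delta m * ?t * xc (mate B u')"
        using 2 sg(1) dls(2) B.mate_monotone(2)[OF gB uX] B.mate_monotone(2)[OF gB uX(2,1)] by auto
      \<comment> \<open>Condition (c) says that the composite of the three monotone maps defining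
        \<open>b\<close> on a \<open>Y\<close> has the prescribed sign \<open>delta l\<close>; here
        every sign is its own inverse.\<close>
      have "delta l * ?s = ?t * delta m"
        using iso_sigma[OF PH ne l m(1) P m(2)] sigma_commute[of B "eta P"] by simp
      then have "delta l = ?s * delta m * ?t" using sg dls by auto
      then show ?thesis using 3 b2[OF PH True] pp by (simp add: u_u'_def)
    qed
    then show ?thesis using im by (auto simp: signed_iso_def)
  qed
  moreover have "b (mate A p) = mate B (b p)" if PH: "P \<in> H A" and p: "p \<in> P" for P p
  proof -
    have mm: "mate A (mate A p) = p" using A.mate_mate[OF S0A[OF p PH]] .
    consider "P \<in> Ys" | "P \<notin> Ys" "xi A P \<noteq> P" | "P \<notin> Ys" "xi A P = P" by blast
    then show ?thesis
    proof cases
      case 1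
      have X: "xi A P \<in> H A" "xi A P \<notin> Ys" "mate A p \<in> xi A P"
        using A.xi_in_H[OF PH] Y[OF 1] A.mate_glued(1)[of P "xi A P" p] p by auto
      have "b (mate A p) = ord (xi A P) (mate A p)" by (rule b1[OF X])
      moreover have "b p = mate B (ord (xi A P) (mate A p))" by (rule b2[OF PH 1 p])
      moreover have "ord (xi A P) (mate A p) \<in> S0 B" using S0B[OF ordH[OF X(1,3)] X(1)] .
      ultimately show ?thesis using B.mate_mate by simp
    next
      case 2
      have X: "xi A P \<in> H A" "xi A P \<in> Ys" "mate A p \<in> xi A P"
        using A.xi_in_H[OF PH] nY[OF 2] A.mate_glued(1)[OF A.xi_neq_glued[OF 2(2)] p] by auto
      have "xi A (xi A P) = P" using A.xi_glued[OF A.glued_sym[OF A.xi_neq_glued[OF 2(2)]]] .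
      then show ?thesis using b2[OF X] b1[OF PH 2(1) p] mm by simp
    next
      case 3
      have "b p \<in> eta P" using b1[OF PH 3(1) p] ordH[OF PH p] by simp
      moreover have "xi B (eta P) = eta P" using iso_xi[OF PH] 3(2) by simp
      ultimately show ?thesis using A.mate_unglued[OF PH 3(2) p] B.mate_unglued[OF iso_eta_in[OF PH]] by simp
    qed
  qed
  ultimately show ?thesis by (intro exI[of _ b]) simp
qed

theorem graph_iso_realized:
  "\<exists>h k. atlas_equiv A B h k \<and>
     (\<forall>l\<in>Lam A. h ` ({l} \<times> strip A l) = {nu l} \<times> strip B (nu l)) \<and>
     (\<forall>l\<in>Lam A. induced_nu A B h l = nu l) \<and>
     (\<forall>P\<in>H A. h ` P = eta P) \<and>
     (\<forall>l\<in>Lam A. induced_delta A h l = delta l \<and> induced_tau A h l = tau l)"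
proof -
  obtain b where b: "\<And>l P. l \<in> Lam A \<Longrightarrow> P \<in> dall A l \<Longrightarrow> signed_iso l P b"
    "\<And>P p. P \<in> H A \<Longrightarrow> p \<in> P \<Longrightarrow> b (mate A p) = mate B (b p)"
    using boundary_map_exists by blast
  define f where "f l s x = xc (b (l, (x, side s (strip A l))))" for l s x
  have ddall: "P \<in> dall A l" if "P \<in> d A s l" "s \<in> {-1, 1}" for P l s using that by (auto simp: dall_def)
  have ts: "tau l * s \<in> {-1, 1}" if "l \<in> Lam A" "s \<in> {-1, 1}" for l s using iso_signs[OF that(1)] that(2) by auto
  have bP: "b ` P = eta P" if "P \<in> H A" for P
    using b(1) H_dall[OF that] unfolding signed_iso_def by blast
  have bval: "b (l, (x, side s (strip A l))) = (nu l, (f l s x, side (tau l * s) (strip B (nu l)))) \<and>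
      f l s x \<in> btrace (tau l * s) (strip B (nu l))"
    if l: "l \<in> Lam A" and s: "s \<in> {-1, 1}" and x: "x \<in> btrace s (strip A l)" for l s x
  proof -
    obtain P where P: "P \<in> d A s l" "(l, (x, side s (strip A l))) \<in> P" using x by (rule A.d_cover)
    have "P \<in> H A" using P(1) A.d_subset_H[OF l s] by blast
    then have "b (l, (x, side s (strip A l))) \<in> eta P" using bP P(2) by blast
    moreover have "eta P \<in> d B (tau l * s) (nu l)" using iso_d[OF l s] P(1) by blast
    ultimately show ?thesis using B.d_point unfolding f_def by blast
  qed
  \<comment> \<open>Inside one half-edge the sign of \<open>b\<close> is right by construction;
    between two half-edges the order is that of their images under \<open>eta\<close>. Together they
    give monotonicity on the whole trace, as the extension requires.\<close>
  have mono: "strict_mono_on (btrace s (strip A l)) (\<lambda>x. delta l * f l s x)" if l: "l \<in> Lam A" and s: "s \<in> {-1, 1}" for l s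
  proof (rule strict_mono_onI)
    fix x x' assume x: "x \<in> btrace s (strip A l)" "x' \<in> btrace s (strip A l)" "x < x'"
    obtain P where P: "P \<in> d A s l" "(l, (x, side s (strip A l))) \<in> P" using x(1) by (rule A.d_cover)
    obtain Q where Q: "Q \<in> d A s l" "(l, (x', side s (strip A l))) \<in> Q" using x(2) by (rule A.d_cover)
    let ?p = "(l, (x, side s (strip A l)))" and ?q = "(l, (x', side s (strip A l)))"
    have xx: "xc ?p < xc ?q" using x(3) by (simp add: xc_def)
    show "delta l * f l s x < delta l * f l s x'"
    proof (cases "P = Q")
      case True
      then show ?thesis using b(1)[OF l ddall[OF P(1) s]] P(2) Q(2) xx unfolding signed_iso_def f_def by blast
    next
      case False
      have hlt: "hlt P Q" using A.d_trichotomy[OF l s P(1) Q(1) P(2) Q(2) xx False] .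
      have "b ?p \<in> eta P" "b ?q \<in> eta Q" using bP A.d_subset_H[OF l s] P Q by blast+
      then show ?thesis using iso_order[OF l s P(1) Q(1) hlt] iso_signs[OF l] by (auto simp: hlt_def f_def)
    qed
  qed
  have img: "f l s ` btrace s (strip A l) = btrace (tau l * s) (strip B (nu l))" if l: "l \<in> Lam A" and s: "s \<in> {-1, 1}" for l s
  proof
    show "f l s ` btrace s (strip A l) \<subseteq> btrace (tau l * s) (strip B (nu l))" using bval[OF l s] by blast
    show "btrace (tau l * s) (strip B (nu l)) \<subseteq> f l s ` btrace s (strip A l)"
    proof
      fix y assume "y \<in> btrace (tau l * s) (strip B (nu l))"
      then obtain Q where Q: "Q \<in> d B (tau l * s) (nu l)" "(nu l, (y, side (tau l * s) (strip B (nu l)))) \<in> Q" by (rule B.d_cover)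
      then obtain P where P: "P \<in> d A s l" "Q = eta P" using iso_d[OF l s] by blast
      then have "b ` P = Q" using bP A.d_subset_H[OF l s] by blast
      then obtain p where p: "p \<in> P" "b p = (nu l, (y, side (tau l * s) (strip B (nu l))))" using Q(2) by (metis imageE)
      then have "y = f l s (xc p)" using A.d_point(1)[OF P(1) p(1)] unfolding f_def by (metis fst_conv snd_conv xc_def)
      then show "y \<in> f l s ` btrace s (strip A l)" using A.d_point(2)[OF P(1) p(1)] by blast
    qed
  qed
  \<comment> \<open>Bundles the conclusions of \<open>strip_extension\<close>, so that a single
    choice over all strips supplies \<open>F\<close>, \<open>G\<close> and \<open>T\<close>.\<close>
  define \<Phi> where "\<Phi> l F G T \<longleftrightarrow> homeomorphism (strip A l) (strip B (nu l)) F G \<and> (\<forall>p\<in>strip A l. snd (F p) = T (snd p)) \<and>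
    strict_mono (\<lambda>y. tau l * T y) \<and>
    (\<forall>s\<in>{-1, 1}. \<forall>x\<in>btrace s (strip A l). F (x, side s (strip A l)) = (f l s x, side (tau l * s) (strip B (nu l)))) \<and>
    (\<forall>a b y. strip_lo (strip A l) < y \<longrightarrow> y < strip_hi (strip A l) \<longrightarrow> a < b \<longrightarrow> delta l * fst (F (a, y)) < delta l * fst (F (b, y)))"
    for l and F G :: "real \<times> real \<Rightarrow> real \<times> real" and T :: "real \<Rightarrow> real"
  have "\<forall>l\<in>Lam A. \<exists>F G T. \<Phi> l F G T"
  proof
    fix l assume l: "l \<in> Lam A"
    have dt: "delta l \<in> {-1, 1}" "tau l \<in> {-1, 1}" using iso_signs[OF l] by auto
    show "\<exists>F G T. \<Phi> l F G T"
      unfolding \<Phi>_def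
      by (rule strip_extension[OF A.strip_in[OF l] B.strip_in[OF iso_nu_in[OF l]] dt]) (fact mono[OF l] img[OF l])+
  qed
  then obtain F G T where FGT: "\<And>l. l \<in> Lam A \<Longrightarrow> \<Phi> l (F l) (G l) (T l)" by metis
  have F: "homeomorphism (strip A l) (strip B (nu l)) (F l) (G l)" "\<And>p. p \<in> strip A l \<Longrightarrow> snd (F l p) = T l (snd p)"
    "strict_mono (\<lambda>y. tau l * T l y)"
    "\<And>s x. s \<in> {-1, 1} \<Longrightarrow> x \<in> btrace s (strip A l) \<Longrightarrow> F l (x, side s (strip A l)) = (f l s x, side (tau l * s) (strip B (nu l)))"
    "\<And>a b y. strip_lo (strip A l) < y \<Longrightarrow> y < strip_hi (strip A l) \<Longrightarrow> a < b \<Longrightarrow> delta l * fst (F l (a, y)) < delta l * fst (F l (b, y))"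
    if "l \<in> Lam A" for l
    using FGT[OF that] unfolding \<Phi>_def by blast+
  define nu' where "nu' = inv_into (Lam A) nu"
  have nu': "nu' (nu l) = l" if "l \<in> Lam A" for l
    unfolding nu'_def using iso_nu that by (simp add: bij_betw_def)
  have nu'': "nu' m \<in> Lam A" "nu (nu' m) = m" if "m \<in> Lam B" for m
    unfolding nu'_def using iso_nu that by (auto simp: bij_betw_def inv_into_into f_inv_into_f)
  define h where "h p = (nu (fst p), F (fst p) (snd p))" for p
  define g where "g p = (nu' (fst p), G (nu' (fst p)) (snd p))" for p
  have Fin: "F l p \<in> strip B (nu l)" "G l (F l p) = p" if "l \<in> Lam A" "p \<in> strip A l" for l p
    using homeomorphism_image1[OF F(1)] homeomorphism_apply1[OF F(1)] that by blast+
  have Gin: "G l p \<in> strip A l" "F l (G l p) = p" if "l \<in> Lam A" "p \<in> strip B (nu l)" for l p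
    using homeomorphism_image2[OF F(1)] homeomorphism_apply2[OF F(1)] that by blast+
  have gh: "g (h p) = p" if "p \<in> S0 A" for p
    using that Fin nu' by (auto simp: S0_def g_def h_def)
  have hg: "h (g p) = p" if "p \<in> S0 B" for p
    using that Gin(2)[OF nu''(1)] nu'' by (auto simp: S0_def g_def h_def)
  have hcont: "continuous_map (S0top A) (S0top B) h"
  proof (rule continuous_map_from_S0top)
    fix l assume l: "l \<in> Lam A"
    show "continuous_map (top_of_set (strip A l)) (S0top B) (\<lambda>p. h (l, p))"
      unfolding h_def fst_conv snd_conv
      using Fin(1)[OF l] by (intro continuous_map_into_S0top iso_nu_in l homeomorphism_cont1[OF F(1)]) auto
  qed
  have gcont: "continuous_map (S0top B) (S0top A) g"
  proof (rule continuous_map_from_S0top)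
    fix m assume m: "m \<in> Lam B"
    show "continuous_map (top_of_set (strip B m)) (S0top A) (\<lambda>p. g (m, p))"
      unfolding g_def fst_conv snd_conv
    proof (rule continuous_map_into_S0top[OF nu''(1)[OF m]])
      show "continuous_on (strip B m) (\<lambda>p. G (nu' m) p)" using homeomorphism_cont2[OF F(1)[OF nu''(1)[OF m]]] nu''(2)[OF m] by simp
      show "(\<lambda>p. G (nu' m) p) ` strip B m \<subseteq> strip A (nu' m)" using Gin(1)[OF nu''(1)[OF m]] nu''(2)[OF m] by auto
    qed
  qed
  have maps: "homeomorphic_maps (S0top A) (S0top B) h g"
    using hcont gcont gh hg by (simp add: homeomorphic_maps_def)
  have hS: "h p \<in> S0 B" if "p \<in> S0 A" for p using hcont that by (auto simp: continuous_map_def)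
  have gS: "g p \<in> S0 A" if "p \<in> S0 B" for p using gcont that by (auto simp: continuous_map_def)
  have himg: "h ` ({l} \<times> M) = {nu l} \<times> (F l ` M)" for l M
  proof -
    have "{l} \<times> M = Pair l ` M" by auto
    then have "h ` ({l} \<times> M) = (\<lambda>p. (nu l, F l p)) ` M" by (simp add: image_image h_def)
    then show ?thesis by auto
  qed
  have hstrip: "h ` ({l} \<times> strip A l) = {nu l} \<times> strip B (nu l)" if l: "l \<in> Lam A" for l
    using himg homeomorphism_image1[OF F(1)[OF l]] by simp
  have hb: "h p = b p" if P: "P \<in> H A" "p \<in> P" for P p
  proof -
    obtain l s where ls: "l \<in> Lam A" "s \<in> {-1, 1}" "P \<in> d A s l" using P(1) by (rule A.half_edge_cases)
    have p: "p = (l, (xc p, side s (strip A l)))" "xc p \<in> btrace s (strip A l)" using A.d_point[OF ls(3) P(2)] .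
    have "h p = (nu l, F l (xc p, side s (strip A l)))" using p(1) unfolding h_def by (metis fst_conv snd_conv)
    also have "\<dots> = b (l, (xc p, side s (strip A l)))" using F(4)[OF ls(1,2) p(2)] bval[OF ls(1,2) p(2)] by simp
    finally show ?thesis using p(1) by simp
  qed
  have hP: "h ` P = eta P" if "P \<in> H A" for P
    using bP[OF that] hb[OF that] by (metis image_cong)
  have hint: "h p \<in> Sint B" if p: "p \<in> Sint A" for p
  proof -
    obtain l x y where p: "p = (l, (x, y))" "l \<in> Lam A" "(x, y) \<in> sint (strip A l)" using p by (auto simp: Sint_def sint_def)
    then have "F l (x, y) \<in> sint (strip B (nu l))"
      using homeomorphism_sint[OF A.strip_in[OF p(2)] B.strip_in[OF iso_nu_in[OF p(2)]] F(1)[OF p(2)]] by blast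
    then show ?thesis using p iso_nu_in[OF p(2)] by (cases "F l (x, y)") (auto simp: Sint_def sint_def h_def)
  qed
  have mate_Sint: "mate A p = p" if "p \<in> Sint A" for p
    using A.mate_single[of p] A.half_edge_subset[OF A.gluedD(1)] A.Sint_subset that by blast
  have mate_Sint': "mate B p = p" if "p \<in> Sint B" for p
    using B.mate_single[of p] B.half_edge_subset[OF B.gluedD(1)] B.Sint_subset that by blast
  \<comment> \<open>Interior points are fixed by both involutions; on half-edges \<open>h\<close>
    coincides with \<open>b\<close>, which commutes with \<open>mate\<close> by
    construction.\<close>
  have hmate: "h (mate A p) = mate B (h p)" if p: "p \<in> S0 A" for p
  proof (cases "p \<in> Sint A")
    case True
    then show ?thesis using mate_Sint mate_Sint'[OF hint] by simp
  next
    case False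
    obtain P where P: "P \<in> H A" "p \<in> P" using p False by (rule A.half_edges_cover)
    have "mate A p \<in> xi A P" using A.mate_image[OF P(1)] P(2) by blast
    then have "h (mate A p) = b (mate A p)" using hb A.xi_in_H[OF P(1)] by blast
    then show ?thesis using b(2)[OF P] hb[OF P] by simp
  qed
  \<comment> \<open>Thus \<open>h\<close> matches the fibres of the two quotient maps exactly, which
    is what both lifts below need: \<open>k\<close> from \<open>h\<close> and its inverse
    \<open>k'\<close> from \<open>g\<close>.\<close>
  have q_iff: "qmap B (h p) = qmap B (h p') \<longleftrightarrow> qmap A p = qmap A p'" if p: "p \<in> S0 A" "p' \<in> S0 A" for p p'
  proof -
    have "qmap B (h p) = qmap B (h p') \<longleftrightarrow> h p = h p' \<or> h p = h (mate A p')"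
      using B.qmap_eq_iff[OF hS[OF p(2)] hS[OF p(1)]] hmate[OF p(2)] by simp
    also have "\<dots> \<longleftrightarrow> p = p' \<or> p = mate A p'"
      using gh[OF p(1)] gh[OF p(2)] gh[OF A.mate_in_S0(1)[OF p(2)]] by metis
    finally show ?thesis using A.qmap_eq_iff[OF p(2,1)] by simp
  qed
  have "continuous_map (S0top A) (Zsp B) (qmap B \<circ> h)" using hcont B.continuous_qmap by (rule continuous_map_compose)
  then obtain k where k: "continuous_map (Zsp A) (Zsp B) k" "\<And>p. p \<in> S0 A \<Longrightarrow> k (qmap A p) = qmap B (h p)"
    by (rule quotient_map_lift_exists[OF A.quotient]) (use q_iff in auto)
  have qg_eq: "(qmap A \<circ> g) x = (qmap A \<circ> g) y" if "x \<in> topspace (S0top B)" "y \<in> topspace (S0top B)" "qmap B x = qmap B y" for x y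
    using q_iff[of "g x" "g y"] hg gS that by simp
  have qg: "continuous_map (S0top B) (Zsp A) (qmap A \<circ> g)" using gcont A.continuous_qmap by (rule continuous_map_compose)
  obtain k' where k': "continuous_map (Zsp B) (Zsp A) k'" "\<And>p. p \<in> S0 B \<Longrightarrow> k' (qmap B p) = qmap A (g p)"
  proof (rule quotient_map_lift_exists[OF B.quotient qg])
    show "(qmap A \<circ> g) x = (qmap A \<circ> g) y" if "x \<in> topspace (S0top B)" "y \<in> topspace (S0top B)" "qmap B x = qmap B y" for x y
      using that by (rule qg_eq)
  qed (use that in auto)
  have ZA: "qmap A ` S0 A = topspace (Zsp A)" and ZB: "qmap B ` S0 B = topspace (Zsp B)"
    using quotient_imp_surjective_map[OF A.quotient] quotient_imp_surjective_map[OF B.quotient] by simp_all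
  have "k' (k z) = z" if z: "z \<in> topspace (Zsp A)" for z
  proof -
    obtain p where p: "p \<in> S0 A" "z = qmap A p" using z ZA by blast
    then show ?thesis using k(2)[OF p(1)] k'(2)[OF hS[OF p(1)]] gh[OF p(1)] by simp
  qed
  moreover have "k (k' z) = z" if z: "z \<in> topspace (Zsp B)" for z
  proof -
    obtain p where p: "p \<in> S0 B" "z = qmap B p" using z ZB by blast
    then show ?thesis using k'(2)[OF p(1)] k(2)[OF gS[OF p(1)]] hg[OF p(1)] by simp
  qed
  ultimately have kmaps: "homeomorphic_maps (Zsp A) (Zsp B) k k'"
    using k(1) k'(1) by (simp add: homeomorphic_maps_def)
  have hrow: "h ` ({l} \<times> (UNIV \<times> {t})) = {nu l} \<times> (UNIV \<times> {T l t}) \<and>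
      strip_lo (strip B (nu l)) < T l t \<and> T l t < strip_hi (strip B (nu l))"
    if l: "l \<in> Lam A" and t: "strip_lo (strip A l) < t" "t < strip_hi (strip A l)" for l t
  proof -
    have S: "is_strip (strip A l)" "is_strip (strip B (nu l))" using A.strip_in[OF l] B.strip_in[OF iso_nu_in[OF l]] .
    have tS: "(x, t) \<in> strip A l" for x using t mem_strip_iff[OF S(1)] by blast
    have Fint: "F l ` sint (strip A l) = sint (strip B (nu l))" using homeomorphism_sint[OF S F(1)[OF l]] .
    have Fxt: "snd (F l (x, t)) = T l t" for x using F(2)[OF l tS[of x]] by simp
    have "(0, t) \<in> sint (strip A l)" using t by (simp add: sint_def)
    then have "F l (0, t) \<in> sint (strip B (nu l))" using Fint by blast
    then have Tt: "strip_lo (strip B (nu l)) < T l t" "T l t < strip_hi (strip B (nu l))"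
      using Fxt[of 0] by (simp_all add: sint_def mem_Times_iff)
    \<comment> \<open>The image fills its row: a preimage of such a point has height
      \<open>t\<close>, because \<open>T l\<close> is injective, being strictly monotone up to the
      sign \<open>tau l\<close>.\<close>
    have "(z, T l t) \<in> F l ` (UNIV \<times> {t})" for z
    proof -
      have "(z, T l t) \<in> strip B (nu l)" using Tt mem_strip_iff[OF S(2)] by blast
      then obtain p where p: "p \<in> strip A l" "F l p = (z, T l t)" using Gin l by metis
      then have "T l (snd p) = T l t" using F(2)[OF l p(1)] by simp
      then have "tau l * T l (snd p) = tau l * T l t" by simp
      then have "snd p = t" using strict_mono_eq[OF F(3)[OF l], of "snd p" t] by simp
      then show ?thesis using p(2) by (metis UNIV_I SigmaI imageI prod.collapse singletonI)
    qed
    moreover have "F l ` (UNIV \<times> {t}) \<subseteq> UNIV \<times> {T l t}" 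
      using Fxt by (intro image_subsetI) (auto simp: mem_Times_iff)
    ultimately have "F l ` (UNIV \<times> {t}) = UNIV \<times> {T l t}" by blast
    then show ?thesis using Tt himg by simp
  qed
  have hleaf: "h ` L \<in> S0_leaves B" if L: "L \<in> S0_leaves A" for L
    using L
  proof (cases rule: A.S0_leaf_cases)
    case (1 l t)
    then have "h ` L = {nu l} \<times> (UNIV \<times> {T l t})" using hrow[OF 1(1-3)] by simp
    moreover have "UNIV \<times> {T l t} \<in> strip_leaves (strip B (nu l))" using hrow[OF 1(1-3)] by (auto simp: strip_leaves_def)
    ultimately show ?thesis using iso_nu_in[OF 1(1)] by (auto simp: S0_leaves_def)
  next
    case 2
    then show ?thesis using hP[OF 2] iso_eta_in[OF 2] B.H_subset_leaves by auto
  qed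
  have hleaf_onto: "\<exists>L\<in>S0_leaves A. h ` L = L'" if L': "L' \<in> S0_leaves B" for L'
    using L'
  proof (cases rule: B.S0_leaf_cases)
    case (1 m t)
    define l where "l = nu' m"
    have l: "l \<in> Lam A" "nu l = m" using nu''[OF 1(1)] by (auto simp: l_def)
    have S: "is_strip (strip A l)" "is_strip (strip B (nu l))" using A.strip_in[OF l(1)] B.strip_in[OF iso_nu_in[OF l(1)]] .
    have "(0, t) \<in> sint (strip B (nu l))" using 1 l by (auto simp: sint_def)
    then have "(0, t) \<in> F l ` sint (strip A l)" using homeomorphism_sint[OF S F(1)[OF l(1)]] by simp
    then obtain x y where xy: "(x, y) \<in> sint (strip A l)" "F l (x, y) = (0, t)" by auto
    then have y: "strip_lo (strip A l) < y" "y < strip_hi (strip A l)" "(x, y) \<in> strip A l" using sint_subset[OF S(1)] by (auto simp: sint_def)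
    have "T l y = t" using F(2)[OF l(1) y(3)] xy(2) by simp
    then have "h ` ({l} \<times> (UNIV \<times> {y})) = L'" using hrow[OF l(1) y(1,2)] l 1(4) by simp
    moreover have "{l} \<times> (UNIV \<times> {y}) \<in> S0_leaves A" using l(1) y unfolding S0_leaves_def strip_leaves_def by blast
    ultimately show ?thesis by blast
  next
    case 2
    then obtain P where P: "P \<in> H A" "eta P = L'" using iso_eta by (metis bij_betw_imp_surj_on imageE)
    then show ?thesis using hP[OF P(1)] A.H_subset_leaves by (intro bexI[of _ P]) auto
  qed
  have leafS: "L \<subseteq> S0 A" if L: "L \<in> S0_leaves A" for L
    using L
  proof (cases rule: A.S0_leaf_cases)
    case (1 l t)
    then show ?thesis using A.Sint_subset by (auto simp: Sint_def)
  next
    case 2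
    then show ?thesis using A.half_edge_subset[OF 2] by blast
  qed
  have kq: "k ` qmap A ` L = qmap B ` h ` L" if "L \<in> S0_leaves A" for L
    using leafS[OF that] k(2) by (force simp: image_image)
  have "atlas_equiv A B h k"
    unfolding atlas_equiv_def foliated_homeo_def
  proof (intro conjI ballI)
    show "homeomorphic_map (S0top A) (S0top B) h" using maps by (metis homeomorphic_map_maps)
    show "homeomorphic_map (Zsp A) (Zsp B) k" using kmaps by (metis homeomorphic_map_maps)
    show "h ` L \<in> S0_leaves B" if "L \<in> S0_leaves A" for L using hleaf[OF that] .
    show "\<exists>L\<in>S0_leaves A. h ` L = L'" if "L' \<in> S0_leaves B" for L' using hleaf_onto[OF that] .
    show "qmap B (h p) = k (qmap A p)" if "p \<in> S0 A" for p using k(2)[OF that] by simp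
    show "k ` L \<in> Z_leaves B" if "L \<in> Z_leaves A" for L
      using that kq hleaf unfolding Z_leaves_def by auto
    show "\<exists>L\<in>Z_leaves A. k ` L = L'" if "L' \<in> Z_leaves B" for L'
    proof -
      obtain M where "M \<in> S0_leaves B" "L' = qmap B ` M" using \<open>L' \<in> Z_leaves B\<close> unfolding Z_leaves_def by blast
      moreover from this obtain L where "L \<in> S0_leaves A" "h ` L = M" using hleaf_onto by blast
      ultimately have "k ` qmap A ` L = L'" "qmap A ` L \<in> Z_leaves A" using kq by (auto simp: Z_leaves_def)
      then show ?thesis by blast
    qed
  qed
  moreover have "induced_nu A B h l = nu l" if l: "l \<in> Lam A" for l
    using induced_nu_eq[OF iso_nu_in[OF l] hstrip[OF l] strip_nonempty[OF B.strip_in[OF iso_nu_in[OF l]]]] .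
  moreover have "induced_delta A h l = delta l" if l: "l \<in> Lam A" for l
    by (rule induced_delta_eq[OF A.strip_in[OF l]]) (use iso_signs[OF l] F(5)[OF l] in \<open>auto simp: h_def xc_def\<close>)
  moreover have "induced_tau A h l = tau l" if l: "l \<in> Lam A" for l
    by (rule induced_tau_eq[OF A.strip_in[OF l]])
      (use iso_signs[OF l] F(2)[OF l] F(3)[OF l] in \<open>auto simp: h_def strict_mono_def\<close>)
  ultimately show ?thesis using hstrip hP by (intro exI[of _ h] exI[of _ k]) simp
qed

end

end

theorem mainTheorem7:
  fixes A :: "('i, 'g, 'z) striped_atlas" and B :: "('j, 'h, 'w) striped_atlas"
  assumes "is_striped_atlas A" and "is_striped_atlas B"
  shows "(\<forall>h k. atlas_equiv A B h k \<longrightarrow>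
            is_graph_iso A B (induced_nu A B h) (\<lambda>P. h ` P) (induced_delta A h) (induced_tau A h))
       \<and> (\<forall>nu eta delta tau. is_graph_iso A B nu eta delta tau \<longrightarrow>
            (\<exists>h k. atlas_equiv A B h k \<and>
               (\<forall>lam\<in>Lam A. h ` ({lam} \<times> strip A lam) = {nu lam} \<times> strip B (nu lam)) \<and>
               (\<forall>lam\<in>Lam A. induced_nu A B h lam = nu lam) \<and>
               (\<forall>P\<in>H A. h ` P = eta P) \<and>
               (\<forall>lam\<in>Lam A. induced_delta A h lam = delta lam \<and> induced_tau A h lam = tau lam)))"
proof -
  interpret striped_pair A B by unfold_locales (fact assms)+
  show ?thesis
  proof (intro conjI allI impI)
    fix h k assume "atlas_equiv A B h k"
    then show "is_graph_iso A B (induced_nu A B h) (\<lambda>P. h ` P) (induced_delta A h) (induced_tau A h)"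
      by (rule equivalence_induces_graph_iso)
  next
    fix nu eta delta tau assume "is_graph_iso A B nu eta delta tau"
    then show "\<exists>h k. atlas_equiv A B h k \<and>
               (\<forall>lam\<in>Lam A. h ` ({lam} \<times> strip A lam) = {nu lam} \<times> strip B (nu lam)) \<and>
               (\<forall>lam\<in>Lam A. induced_nu A B h lam = nu lam) \<and>
               (\<forall>P\<in>H A. h ` P = eta P) \<and>
               (\<forall>lam\<in>Lam A. induced_delta A h lam = delta lam \<and> induced_tau A h lam = tau lam)"
      by (rule graph_iso_realized)
  qed
qed

end
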